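(* Let $\Omega\subset\mathbb{R}^2$ be a disk, let $(x,y)$ be Cartesian coordinates with origin at its center and $\theta$ the corresponding polar angle. Then the spectrum of $\mathbf{K}^*$ consists of the eigenvalues $$\frac12,\qquad -\frac{\lambda}{2(2\mu+\lambda)},\qquad k_0,\qquad -k_0,\qquad k_0=\frac{\mu}{2(2\mu+\lambda)},$$ and the corresponding (not normalized) eigenfunctions on $\partial\Omega$ are: (i) for $\frac12$: $(1,0)^T$, $(0,1)^T$, $(y,-x)^T$; (ii) for $-\frac{\lambda}{2(2\mu+\lambda)}$: $(x,y)^T$; (iii) for $k_0$: $(\cos m\theta,\sin m\theta)^T$ and $(-\sin m\theta,\cos m\theta)^T$, $m=2,3,\ldots$; (iv) for $-k_0$: $(\cos m\theta,-\sin m\theta)^T$ and $(\sin m\theta,\cos m\theta)^T$, $m=1,2,\ldots$.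
   Context: Let $\lambda,\mu\in\mathbb{R}$ with $\mu>0$, $2\lambda+2\mu>0$. Put $\widehat\nabla\mathbf{u}=\frac12(\nabla\mathbf{u}+\nabla\mathbf{u}^T)$ and, with $\mathbf{n}$ the outward unit normal to $\partial\Omega$, $\partial_\nu\mathbf{u}=\lambda(\nabla\cdot\mathbf{u})\mathbf{n}+2\mu(\widehat\nabla\mathbf{u})\mathbf{n}$. The Kelvin matrix is $\Gamma_{ij}(\mathbf{x})=\frac{\alpha_1}{2\pi}\delta_{ij}\ln|\mathbf{x}|-\frac{\alpha_2}{2\pi}\frac{x_ix_j}{|\mathbf{x}|^2}$ $(i,j=1,2)$, $\alpha_1=\frac12\left(\frac1\mu+\frac1{2\mu+\lambda}\right)$, $\alpha_2=\frac12\left(\frac1\mu-\frac1{2\mu+\lambda}\right)$, and $\partial_{\nu_{\mathbf{x}}}\mathbf{\Gamma}(\mathbf{x}-\mathbf{y})\mathbf{b}=\partial_{\nu_{\mathbf{x}}}(\mathbf{\Gamma}(\mathbf{x}-\mathbf{y})\mathbf{b})$ for constant $\mathbf{b}$. The Neumann-Poincaré operator $\mathbf{K}^*$ on $\mathcal{H}^*=H^{-1/2}(\partial\Omega)^2$ is $\mathbf{K}^*[\boldsymbol{\varphi}](\mathbf{x})=\mathrm{p.v.}\int_{\partial\Omega}\partial_{\nu_{\mathbf{x}}}\mathbf{\Gamma}(\mathbf{x}-\mathbf{y})\boldsymbol{\varphi}(\mathbf{y})\,d\sigma(\mathbf{y})$. *)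

theory Defs
  imports "HOL-Analysis.Analysis" "HOL-Library.Function_Algebras"
begin

text \<open>
  Vector fields are complex valued, so that the spectrum is the usual subset of the complex plane.
  The boundary is represented by its arc length measure \<open>S\<close> (so \<open>space S\<close> is the boundary
  curve) together with its outward unit normal field \<open>n\<close>.
\<close>

type_synonym field = "real^2 \<Rightarrow> complex^2"
type_synonym functional = "field \<Rightarrow> complex"

definition circle_measure :: "real^2 \<Rightarrow> real \<Rightarrow> (real^2) measure" where
  "circle_measure c r =
     scale_measure (ennreal r)
       (distr (restrict_space lborel {0..<2*pi}) (restrict_space borel (sphere c r))
         (\<lambda>t. c + r *\<^sub>R vector [cos t, sin t]))"

definition circle_normal :: "real^2 \<Rightarrow> real \<Rightarrow> real^2 \<Rightarrow> real^2" where
  "circle_normal c r x = (x - c) /\<^sub>R r"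


subsection \<open>Kelvin matrix, conormal derivative, principal value operator\<close>

definition kelvin :: "real \<Rightarrow> real \<Rightarrow> real^2 \<Rightarrow> real^2^2" where
  "kelvin lam mu x =
     (let \<alpha>1 = (1 / mu + 1 / (2 * mu + lam)) / 2;
          \<alpha>2 = (1 / mu - 1 / (2 * mu + lam)) / 2
      in \<chi> i j. \<alpha>1 / (2 * pi) * (if i = j then 1 else 0) * ln (norm x)
               - \<alpha>2 / (2 * pi) * (x $ i * x $ j) / (norm x)\<^sup>2)"

definition kelvin_apply :: "real \<Rightarrow> real \<Rightarrow> real^2 \<Rightarrow> complex^2 \<Rightarrow> complex^2" where
  "kelvin_apply lam mu x b = (\<chi> i. \<Sum>j\<in>UNIV. of_real (kelvin lam mu x $ i $ j) * b $ j)"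

definition partial :: "field \<Rightarrow> real^2 \<Rightarrow> 2 \<Rightarrow> 2 \<Rightarrow> complex" where
  "partial u x i j = frechet_derivative u (at x) (axis j 1) $ i"

definition conormal :: "real \<Rightarrow> real \<Rightarrow> real^2 \<Rightarrow> field \<Rightarrow> real^2 \<Rightarrow> complex^2" where
  "conormal lam mu \<nu> u x =
     (\<chi> i. of_real lam * (\<Sum>j\<in>UNIV. partial u x j j) * of_real (\<nu> $ i)
         + 2 * of_real mu * (\<Sum>j\<in>UNIV. (partial u x i j + partial u x j i) / 2 * of_real (\<nu> $ j)))"

definition np_pv ::
  "real \<Rightarrow> real \<Rightarrow> (real^2) measure \<Rightarrow> (real^2 \<Rightarrow> real^2) \<Rightarrow> field \<Rightarrow> field" where
  "np_pv lam mu S n \<phi> x =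
     Lim (at_right 0)
       (\<lambda>\<epsilon>. LINT y : {y \<in> space S. \<epsilon> < dist x y} | S.
              conormal lam mu (n x) (\<lambda>z. kelvin_apply lam mu (z - y) (\<phi> y)) x)"


subsection \<open>The space \<open>H\<^sup>1\<^sup>/\<^sup>2\<close> of fields on the boundary\<close>

definition h_half_energy :: "(real^2) measure \<Rightarrow> field \<Rightarrow> ennreal" where
  "h_half_energy S f =
     (\<integral>\<^sup>+x. ennreal ((norm (f x))\<^sup>2) \<partial>S)
     + (\<integral>\<^sup>+x. (\<integral>\<^sup>+y. ennreal ((norm (f x - f y))\<^sup>2 / (dist x y)\<^sup>2) \<partial>S) \<partial>S)"

definition h_half :: "(real^2) measure \<Rightarrow> field set" where
  "h_half S = {f \<in> borel_measurable S. h_half_energy S f < \<infinity>}"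

definition h_half_norm :: "(real^2) measure \<Rightarrow> field \<Rightarrow> real" where
  "h_half_norm S f = sqrt (enn2real (h_half_energy S f))"


subsection \<open>Its dual \<open>H\<^sup>-\<^sup>1\<^sup>/\<^sup>2\<close>\<close>

definition fscale :: "complex \<Rightarrow> functional \<Rightarrow> functional" where
  "fscale a u = (\<lambda>f. a * u f)"

interpretation functional_space: vector_space fscale
  by unfold_locales (auto simp: fscale_def algebra_simps)

text \<open>
  Functionals are set to 0 outside \<open>H\<^sup>1\<^sup>/\<^sup>2\<close>, so that equality of functionals is equality of
  their restrictions. The bound makes them insensitive to changes on null sets.
\<close>

definition h_mhalf :: "(real^2) measure \<Rightarrow> functional set" where
  "h_mhalf S =
     {u. (\<forall>f\<in>h_half S. \<forall>g\<in>h_half S. u (\<lambda>x. f x + g x) = u f + u g) \<and>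
         (\<forall>a. \<forall>f\<in>h_half S. u (\<lambda>x. a *s f x) = a * u f) \<and>
         (\<exists>C. \<forall>f\<in>h_half S. cmod (u f) \<le> C * h_half_norm S f) \<and>
         (\<forall>f. f \<notin> h_half S \<longrightarrow> u f = 0)}"

definition h_mhalf_norm :: "(real^2) measure \<Rightarrow> functional \<Rightarrow> real" where
  "h_mhalf_norm S u = Sup {cmod (u f) |f. f \<in> h_half S \<and> h_half_norm S f \<le> 1}"

text \<open>A field regarded as an element of \<open>H\<^sup>-\<^sup>1\<^sup>/\<^sup>2\<close> through the (bilinear) \<open>L\<^sup>2\<close> pairing.\<close>

definition functional_of :: "(real^2) measure \<Rightarrow> field \<Rightarrow> functional" where
  "functional_of S \<phi> =
     (\<lambda>f. if f \<in> h_half S then LINT x|S. (\<Sum>i\<in>UNIV. \<phi> x $ i * f x $ i) else 0)"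


subsection \<open>Bounded operators on \<open>H\<^sup>-\<^sup>1\<^sup>/\<^sup>2\<close> and their spectra\<close>

definition bounded_operator :: "(real^2) measure \<Rightarrow> (functional \<Rightarrow> functional) \<Rightarrow> bool" where
  "bounded_operator S T \<longleftrightarrow>
     T \<in> h_mhalf S \<rightarrow> h_mhalf S \<and>
     (\<forall>u\<in>h_mhalf S. \<forall>v\<in>h_mhalf S. T (u + v) = T u + T v) \<and>
     (\<forall>a. \<forall>u\<in>h_mhalf S. T (fscale a u) = fscale a (T u)) \<and>
     (\<exists>C. \<forall>u\<in>h_mhalf S. h_mhalf_norm S (T u) \<le> C * h_mhalf_norm S u)"

definition op_spectrum :: "(real^2) measure \<Rightarrow> (functional \<Rightarrow> functional) \<Rightarrow> complex set" where
  "op_spectrum S T =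
     {z. \<not> (\<exists>R. bounded_operator S R \<and>
               (\<forall>u\<in>h_mhalf S. R (T u - fscale z u) = u \<and> T (R u) - fscale z (R u) = u))}"

definition eigenspace ::
  "(real^2) measure \<Rightarrow> (functional \<Rightarrow> functional) \<Rightarrow> complex \<Rightarrow> functional set" where
  "eigenspace S T z = {u \<in> h_mhalf S. T u = fscale z u}"

definition is_eigenvalue ::
  "(real^2) measure \<Rightarrow> (functional \<Rightarrow> functional) \<Rightarrow> complex \<Rightarrow> bool" where
  "is_eigenvalue S T z \<longleftrightarrow> (\<exists>u\<in>eigenspace S T z. u \<noteq> 0)"

definition is_eigenfunction ::
  "(real^2) measure \<Rightarrow> (functional \<Rightarrow> functional) \<Rightarrow> complex \<Rightarrow> field \<Rightarrow> bool" where
  "is_eigenfunction S T z \<phi> \<longleftrightarrow>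
     functional_of S \<phi> \<in> eigenspace S T z \<and> functional_of S \<phi> \<noteq> 0"

definition closed_span :: "(real^2) measure \<Rightarrow> functional set \<Rightarrow> functional set" where
  "closed_span S A =
     {u \<in> h_mhalf S. \<forall>e>0. \<exists>v\<in>functional_space.span A. h_mhalf_norm S (u - v) < e}"


subsection \<open>The Neumann--Poincare operator\<close>

text \<open>
  The principal value integral is meaningful pointwise only for sufficiently regular densities.
  The operator on \<open>H\<^sup>-\<^sup>1\<^sup>/\<^sup>2\<close> is its unique bounded extension from the (dense) Lipschitz densities;
  the clause for \<open>u \<notin> h_mhalf S\<close> only fixes the irrelevant values off the space.
\<close>

definition np_operator ::
  "real \<Rightarrow> real \<Rightarrow> (real^2) measure \<Rightarrow> (real^2 \<Rightarrow> real^2) \<Rightarrow> functional \<Rightarrow> functional" where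
  "np_operator lam mu S n =
     (THE T. bounded_operator S T \<and>
             (\<forall>u. u \<notin> h_mhalf S \<longrightarrow> T u = 0) \<and>
             (\<forall>\<phi>. (\<exists>L. L-lipschitz_on (space S) \<phi>) \<longrightarrow>
                  T (functional_of S \<phi>) = functional_of S (np_pv lam mu S n \<phi>)))"

end

(*
The traction of Gamma(x - y) b on a circle splits into a constant multiple of b, a reflection of b
depending on the product of the two boundary points, and a rotation of b with Hilbert kernel
cot((t - s) / 2).  Hence the operator is diagonal on the real fields (cos n t, sin n t) and
(- sin n t, cos n t), n an integer: the constant part sees only n = 0, the reflection only n = 1,
and the Hilbert transform contributes k0 sgn n.  These fields are orthogonal both in L^2 and for the
H^(1/2) energy: the substitution w = z zeta and Parseval's identity turn the Gagliardo double
integral into a sum with weights proportional to |n|, because |zeta^n - 1|^2 / |zeta - 1|^2 has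
integral 2 pi |n|.  So H^(-1/2) is isometric to a weighted sequence space on which the operator is
multiplication by a sequence with four values; spectrum and eigenspaces can be read off.
*)
theory Submission imports Defs
begin

section \<open>Arc length on the unit circle\<close>

text \<open>The operator is a definite description, so exhibiting a diagonal operator is only half
  of the work: any bounded operator with the prescribed values on Lipschitz densities must be shown
  to equal it. Hence the eigenfields are checked to be Lipschitz, and finite combinations of their
  functionals to be dense in the dual. The principal value needs no delicate estimate: each
  truncated integral of the Hilbert kernel alone vanishes by reflection symmetry, so the density may
  be replaced by its difference from its value at the pole, and for Lipschitz densities the
  integrand is then bounded. The components b1 + i b2 and b1 - i b2 make the Hilbert part scalar,
  but the reflection part mixes the two components; the real fields undo that mixing. They have a
  second advantage: the pairing that embeds fields into the dual is bilinear, without conjugation,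
  and real orthogonal fields stay orthogonal for it. Everything is pulled back to the unit circle of
  the complex plane, where integer powers of z serve both the geometry and the Fourier
  analysis.\<close>

definition ucirc :: "complex measure" where
  "ucirc = distr (restrict_space lborel {0..<2*pi}) (restrict_space borel (sphere 0 1)) cis"

lemma space_ucirc [simp]: "space ucirc = sphere 0 1"
  by (simp add: ucirc_def space_restrict_space)

lemma sets_ucirc [measurable_cong]: "sets ucirc = sets (restrict_space borel (sphere 0 1))"
  by (simp add: ucirc_def)

lemma cis_measurable_sphere [measurable]:
  "cis \<in> measurable (restrict_space lborel A) (restrict_space borel (sphere 0 1))"
  by (rule measurable_restrict_space2) (auto intro!: measurable_restrict_space1 borel_measurable_continuous_onI continuous_on_cis)

lemma measurable_ucirc_ident [measurable]: "(\<lambda>z. z) \<in> borel_measurable ucirc"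
proof -
  have "(\<lambda>z::complex. z) \<in> borel_measurable (restrict_space borel (sphere 0 1))"
    by (rule measurable_restrict_space1) simp
  then show ?thesis by (simp cong: measurable_cong_sets add: sets_ucirc)
qed

lemma measurable_into_ucirc:
  assumes "f \<in> borel_measurable M" and "\<And>x. x \<in> space M \<Longrightarrow> norm (f x) = 1"
  shows "f \<in> measurable M ucirc"
proof -
  have "f \<in> measurable M (restrict_space borel (sphere 0 1))"
    using assms by (intro measurable_restrict_space2) auto
  then show ?thesis by (simp cong: measurable_cong_sets add: sets_ucirc)
qed

lemma nn_integral_ucirc:
  assumes "f \<in> borel_measurable ucirc"
  shows "(\<integral>\<^sup>+z. f z \<partial>ucirc) = (\<integral>\<^sup>+t. f (cis t) * indicator {0..<2*pi} t \<partial>lborel)"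
proof -
  have f: "f \<in> borel_measurable (restrict_space borel (sphere 0 1))"
    using assms by (simp cong: measurable_cong_sets add: sets_ucirc)
  show ?thesis
    unfolding ucirc_def by (subst nn_integral_distr) (use f in \<open>auto simp: nn_integral_restrict_space\<close>)
qed

lemma emeasure_ucirc_space: "emeasure ucirc (sphere 0 1) = ennreal (2 * pi)"
proof -
  have "emeasure ucirc (sphere 0 1) = (\<integral>\<^sup>+z. 1 \<partial>ucirc)" by simp
  also have "\<dots> = ennreal (2 * pi)"
    by (subst nn_integral_ucirc) auto
  finally show ?thesis .
qed

global_interpretation ucirc: finite_measure ucirc
  by standard (simp add: emeasure_ucirc_space)

lemma measure_ucirc_space [simp]: "measure ucirc (sphere 0 1) = 2 * pi"
  by (simp add: Sigma_Algebra.measure_def emeasure_ucirc_space)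

global_interpretation ucirc2: pair_sigma_finite ucirc ucirc ..

text \<open>Substituting \<open>t \<mapsto> \<tau> + t\<close> moves the fundamental interval, and periodicity moves it back.\<close>

lemma nn_integral_circle_shift:
  fixes h :: "complex \<Rightarrow> ennreal"
  assumes [measurable]: "(\<lambda>t. h (cis t)) \<in> borel_measurable borel" and "0 \<le> \<tau>" "\<tau> < 2 * pi"
  shows "(\<integral>\<^sup>+t. h (cis (\<tau> + t)) * indicator {0..<2*pi} t \<partial>lborel)
       = (\<integral>\<^sup>+t. h (cis t) * indicator {0..<2*pi} t \<partial>lborel)"
proof -
  have "(\<integral>\<^sup>+t. h (cis (\<tau> + t)) * indicator {0..<2*pi} t \<partial>lborel)
      = (\<integral>\<^sup>+t. h (cis t) * indicator {\<tau>..<\<tau>+2*pi} t \<partial>lborel)"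
    by (subst (2) nn_integral_real_affine[where t=\<tau> and c=1])
       (auto intro!: nn_integral_cong split: split_indicator)
  also have "\<dots> = (\<integral>\<^sup>+t. h (cis t) * indicator {\<tau>..<2*pi} t + h (cis t) * indicator {2*pi..<\<tau>+2*pi} t \<partial>lborel)"
    using assms by (intro nn_integral_cong) (auto split: split_indicator)
  also have "\<dots> = (\<integral>\<^sup>+t. h (cis t) * indicator {\<tau>..<2*pi} t \<partial>lborel)
               + (\<integral>\<^sup>+t. h (cis t) * indicator {2*pi..<\<tau>+2*pi} t \<partial>lborel)"
    by (intro nn_integral_add) auto
  also have "(\<integral>\<^sup>+t. h (cis t) * indicator {2*pi..<\<tau>+2*pi} t \<partial>lborel)
     = (\<integral>\<^sup>+t. h (cis t) * indicator {0..<\<tau>} t \<partial>lborel)"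
    by (subst nn_integral_real_affine[where t="2*pi" and c=1])
       (auto intro!: nn_integral_cong split: split_indicator simp: cis_mult[symmetric])
  also have "(\<integral>\<^sup>+t. h (cis t) * indicator {\<tau>..<2*pi} t \<partial>lborel) + \<dots>
     = (\<integral>\<^sup>+t. h (cis t) * indicator {\<tau>..<2*pi} t + h (cis t) * indicator {0..<\<tau>} t \<partial>lborel)"
    by (intro nn_integral_add[symmetric]) auto
  also have "\<dots> = (\<integral>\<^sup>+t. h (cis t) * indicator {0..<2*pi} t \<partial>lborel)"
    using assms by (intro nn_integral_cong) (auto split: split_indicator)
  finally show ?thesis .
qed

lemma measurable_ucirc_cis:
  assumes "h \<in> borel_measurable ucirc"
  shows "(\<lambda>t. h (cis t)) \<in> borel_measurable borel"
proof -
  have "cis \<in> measurable borel ucirc"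
    by (intro measurable_into_ucirc borel_measurable_continuous_onI continuous_on_cis) auto
  from measurable_compose[OF this assms] show ?thesis .
qed

lemma nn_integral_ucirc_rotate:
  assumes h: "h \<in> borel_measurable ucirc" and "norm \<zeta> = 1"
  shows "(\<integral>\<^sup>+z. h (\<zeta> * z) \<partial>ucirc) = (\<integral>\<^sup>+z. h z \<partial>ucirc)"
proof -
  obtain \<tau> where \<tau>: "0 \<le> \<tau>" "\<tau> < 2 * pi" "\<zeta> = cis \<tau>"
  proof (rule that[of "Arg2pi \<zeta>"])
    show "\<zeta> = cis (Arg2pi \<zeta>)"
      using Arg2pi_eq[of \<zeta>] \<open>norm \<zeta> = 1\<close> by (simp add: cis_conv_exp)
  qed (auto simp: Arg2pi_ge_0 Arg2pi_lt_2pi)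
  have m: "(\<lambda>z. \<zeta> * z) \<in> measurable ucirc ucirc"
    using assms by (intro measurable_into_ucirc) (auto simp: norm_mult)
  have "(\<integral>\<^sup>+z. h (\<zeta> * z) \<partial>ucirc) = (\<integral>\<^sup>+t. h (cis (\<tau> + t)) * indicator {0..<2*pi} t \<partial>lborel)"
    by (subst nn_integral_ucirc) (use measurable_compose[OF m h] in \<open>auto simp: \<tau> cis_mult\<close>)
  then show ?thesis
    by (simp add: nn_integral_circle_shift measurable_ucirc_cis h \<tau> nn_integral_ucirc)
qed

text \<open>Phrased as an equality of measures, rotation invariance transfers from nonnegative
  integrals to Bochner integrals.\<close>

lemma distr_ucirc_rotate:
  assumes "norm \<zeta> = 1"
  shows "distr ucirc ucirc (\<lambda>z. \<zeta> * z) = ucirc"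
proof (rule measure_eqI)
  have m: "(\<lambda>z. \<zeta> * z) \<in> measurable ucirc ucirc"
    using assms by (intro measurable_into_ucirc) (auto simp: norm_mult)
  fix A assume "A \<in> sets (distr ucirc ucirc (\<lambda>z. \<zeta> * z))"
  then have A: "A \<in> sets ucirc" by simp
  have "emeasure (distr ucirc ucirc (\<lambda>z. \<zeta> * z)) A = (\<integral>\<^sup>+z. indicator A z \<partial>distr ucirc ucirc (\<lambda>z. \<zeta> * z))"
    using A by simp
  also have "\<dots> = (\<integral>\<^sup>+z. indicator A (\<zeta> * z) \<partial>ucirc)"
    using A m by (intro nn_integral_distr) auto
  also have "\<dots> = emeasure ucirc A"
    using A assms by (subst nn_integral_ucirc_rotate) auto
  finally show "emeasure (distr ucirc ucirc (\<lambda>z. \<zeta> * z)) A = emeasure ucirc A" .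
qed simp

lemma nn_integral_ucirc_cnj:
  assumes h: "h \<in> borel_measurable ucirc"
  shows "(\<integral>\<^sup>+z. h (cnj z) \<partial>ucirc) = (\<integral>\<^sup>+z. h z \<partial>ucirc)"
proof -
  have m: "cnj \<in> measurable ucirc ucirc"
    by (intro measurable_into_ucirc borel_measurable_continuous_on[OF _ measurable_ucirc_ident] continuous_intros) auto
  note [measurable] = measurable_ucirc_cis[OF h]
  have [measurable]: "(\<lambda>t. h (cis (- t))) \<in> borel_measurable borel"
    using measurable_compose[OF _ measurable_ucirc_cis[OF h], of uminus borel] by simp
  have "(\<integral>\<^sup>+z. h (cnj z) \<partial>ucirc) = (\<integral>\<^sup>+t. h (cis (- t)) * indicator {0..<2*pi} t \<partial>lborel)"
    by (subst nn_integral_ucirc) (use measurable_compose[OF m h] in \<open>auto simp: cis_cnj\<close>)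
  \<comment> \<open>The substitution is t -> 2 pi - t. The half-open interval exchanges its closed
    end, so the integrands differ only at 0 and 2 pi.\<close>
  also have "\<dots> = (\<integral>\<^sup>+t. h (cis t) * indicator {0<..2*pi} t \<partial>lborel)"
    by (subst nn_integral_real_affine[where t="2*pi" and c="-1"])
       (auto intro!: nn_integral_cong split: split_indicator simp: cis_mult[symmetric] cis_divide[symmetric])
  also have "\<dots> = (\<integral>\<^sup>+t. h (cis t) * indicator {0..<2*pi} t \<partial>lborel)"
  proof (rule nn_integral_cong_AE)
    have "AE t in lborel. t \<noteq> (0::real) \<and> t \<noteq> 2*pi"
      using AE_lborel_singleton[of "0::real"] AE_lborel_singleton[of "2*pi::real"] by eventually_elim auto
    then show "AE t in lborel. h (cis t) * indicator {0<..2*pi} t = h (cis t) * indicator {0..<2*pi} t"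
      by eventually_elim (auto split: split_indicator)
  qed
  finally show ?thesis by (simp add: nn_integral_ucirc h)
qed

lemma distr_ucirc_cnj: "distr ucirc ucirc cnj = ucirc"
proof (rule measure_eqI)
  have m: "cnj \<in> measurable ucirc ucirc"
    by (intro measurable_into_ucirc borel_measurable_continuous_on[OF _ measurable_ucirc_ident] continuous_intros) auto
  fix A assume "A \<in> sets (distr ucirc ucirc cnj)"
  then have A: "A \<in> sets ucirc" by simp
  have "emeasure (distr ucirc ucirc cnj) A = (\<integral>\<^sup>+z. indicator A z \<partial>distr ucirc ucirc cnj)"
    using A by simp
  also have "\<dots> = (\<integral>\<^sup>+z. indicator A (cnj z) \<partial>ucirc)"
    using A m by (intro nn_integral_distr) auto
  also have "\<dots> = emeasure ucirc A"
    using A by (subst nn_integral_ucirc_cnj) auto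
  finally show "emeasure (distr ucirc ucirc cnj) A = emeasure ucirc A" .
qed simp

lemma integral_ucirc_rotate:
  fixes h :: "complex \<Rightarrow> 'a::{banach, second_countable_topology}"
  assumes h: "h \<in> borel_measurable ucirc" and "norm \<zeta> = 1"
  shows "(LINT z|ucirc. h (\<zeta> * z)) = (LINT z|ucirc. h z)"
proof -
  have m: "(\<lambda>z. \<zeta> * z) \<in> measurable ucirc ucirc"
    using assms by (intro measurable_into_ucirc) (auto simp: norm_mult)
  show ?thesis
    using integral_distr[OF m h] by (simp add: distr_ucirc_rotate assms)
qed

lemma integral_ucirc_cnj:
  fixes h :: "complex \<Rightarrow> 'a::{banach, second_countable_topology}"
  assumes h: "h \<in> borel_measurable ucirc"
  shows "(LINT z|ucirc. h (cnj z)) = (LINT z|ucirc. h z)"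
proof -
  have m: "cnj \<in> measurable ucirc ucirc"
    by (intro measurable_into_ucirc borel_measurable_continuous_on[OF _ measurable_ucirc_ident] continuous_intros) auto
  show ?thesis
    using integral_distr[OF m h] by (simp add: distr_ucirc_cnj)
qed

text \<open>\<open>cis\<close> is injective on [0, 2 pi), so a point has at most one parameter. This
  makes the singularities of the kernels on the diagonal negligible.\<close>

lemma AE_ucirc_neq: "AE z in ucirc. z \<noteq> w"
proof -
  have A: "{w} \<inter> sphere 0 1 \<in> sets ucirc"
    unfolding sets_ucirc sets_restrict_space by (subst Int_commute) (rule imageI, simp)
  have "emeasure ucirc ({w} \<inter> sphere 0 1) = (\<integral>\<^sup>+z. indicator ({w} \<inter> sphere 0 1) z \<partial>ucirc)"
    using A by (rule nn_integral_indicator[symmetric])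
  also have "\<dots> = (\<integral>\<^sup>+t. indicator ({w} \<inter> sphere 0 1) (cis t) * indicator {0..<2*pi} t \<partial>lborel)"
    using A by (intro nn_integral_ucirc) simp
  also have "\<dots> \<le> (\<integral>\<^sup>+t. indicator {Arg2pi w} t \<partial>lborel)"
  proof (rule nn_integral_mono)
    fix t
    have "t = Arg2pi w" if "w = cis t" "0 \<le> t" "t < 2 * pi"
      using that by (simp add: Arg2pi_unique[of 1] cis_conv_exp)
    then show "indicator ({w} \<inter> sphere 0 1) (cis t) * indicator {0..<2*pi} t \<le> (indicator {Arg2pi w} t :: ennreal)"
      by (auto split: split_indicator)
  qed
  also have "\<dots> = 0" by simp
  finally have "emeasure ucirc ({w} \<inter> sphere 0 1) = 0" by simp
  then show ?thesis
    using A by (intro AE_I[of _ _ "{w} \<inter> sphere 0 1"]) auto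
qed

section \<open>Density of trigonometric polynomials\<close>

lemma measurable_ucirc_continuous:
  assumes "continuous_on (sphere 0 1) f"
  shows "f \<in> borel_measurable ucirc"
proof -
  have "f \<in> borel_measurable (restrict_space borel (sphere 0 1))"
    using assms by (rule borel_measurable_continuous_on_restrict)
  then show ?thesis by (simp cong: measurable_cong_sets add: sets_ucirc)
qed

lemma measurable_ucirc_powi [measurable]: "(\<lambda>z. z powi n) \<in> borel_measurable ucirc"
  by (intro measurable_ucirc_continuous continuous_intros) auto

lemma integrable_ucirc_bounded:
  fixes f :: "complex \<Rightarrow> 'a::{banach, second_countable_topology}"
  assumes "f \<in> borel_measurable ucirc" and "\<And>z. norm z = 1 \<Longrightarrow> norm (f z) \<le> B"
  shows "integrable ucirc f"
  using assms by (intro ucirc.integrable_const_bound[of _ B]) auto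

lemma integrable_ucirc_powi [simp]: "integrable ucirc (\<lambda>z. z powi n)"
  by (rule integrable_ucirc_bounded[of _ 1]) (auto simp: norm_power_int)

text \<open>Rotating by \<open>\<zeta>\<close> multiplies the integral by \<open>\<zeta>\<^sup>n\<close>, which can be made equal to \<open>-1\<close>.\<close>

lemma integral_ucirc_powi: "(LINT z|ucirc. z powi n) = (if n = 0 then of_real (2 * pi) else 0)"
proof (cases "n = 0")
  case False
  define \<zeta> where "\<zeta> = cis (pi / of_int n)"
  have "\<zeta> powi n = -1"
    using False by (simp add: \<zeta>_def cis_power_int)
  have "(LINT z|ucirc. z powi n) = (LINT z|ucirc. (\<zeta> * z) powi n)"
    by (subst integral_ucirc_rotate) (auto simp: \<zeta>_def)
  also have "\<dots> = - (LINT z|ucirc. z powi n)"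
    by (simp add: power_int_mult_distrib \<open>\<zeta> powi n = -1\<close>)
  finally show ?thesis using False by simp
qed (simp add: scaleR_conv_of_real)

definition fco :: "(complex \<Rightarrow> complex) \<Rightarrow> int \<Rightarrow> complex" where
  "fco g n = (LINT z|ucirc. g z * z powi (- n)) / of_real (2 * pi)"

text \<open>The squared L^2 norm, taken in \<open>ennreal\<close> so that square integrability is
  simply the finiteness of this value.\<close>

definition sq :: "(complex \<Rightarrow> complex) \<Rightarrow> ennreal" where
  "sq g = (\<integral>\<^sup>+z. ennreal ((cmod (g z))\<^sup>2) \<partial>ucirc)"

text \<open>Equality is asked only on the circle, where \<open>cnj z\<close> is
  \<open>z powi (- 1)\<close>; polynomials in Re z and Im z therefore qualify.\<close>

definition trig :: "(complex \<Rightarrow> complex) \<Rightarrow> bool" where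
  "trig p \<longleftrightarrow> (\<exists>F c. finite F \<and> (\<forall>z. norm z = 1 \<longrightarrow> p z = (\<Sum>n\<in>F. c n * z powi n)))"

lemma trig_cong: "trig p \<Longrightarrow> (\<And>z. norm z = 1 \<Longrightarrow> q z = p z) \<Longrightarrow> trig q"
  unfolding trig_def by metis

lemma trig_monom: "trig (\<lambda>z. a * z powi n)"
  unfolding trig_def by (rule exI[of _ "{n}"], rule exI[of _ "\<lambda>_. a"]) auto

lemma trig_add:
  assumes "trig p" "trig q" shows "trig (\<lambda>z. p z + q z)"
proof -
  obtain F c where F: "finite F" "\<And>z. norm z = 1 \<Longrightarrow> p z = (\<Sum>n\<in>F. c n * z powi n)"
    using assms(1) unfolding trig_def by auto
  obtain G d where G: "finite G" "\<And>z. norm z = 1 \<Longrightarrow> q z = (\<Sum>n\<in>G. d n * z powi n)"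
    using assms(2) unfolding trig_def by auto
  let ?e = "\<lambda>n. (if n \<in> F then c n else 0) + (if n \<in> G then d n else 0)"
  have "p z + q z = (\<Sum>n\<in>F\<union>G. ?e n * z powi n)" if "norm z = 1" for z
  proof -
    have "(\<Sum>n\<in>F\<union>G. ?e n * z powi n)
        = (\<Sum>n\<in>F\<union>G. (if n \<in> F then c n * z powi n else 0)) + (\<Sum>n\<in>F\<union>G. (if n \<in> G then d n * z powi n else 0))"
      by (subst sum.distrib[symmetric], rule sum.cong) (auto simp: algebra_simps)
    also have "\<dots> = (\<Sum>n\<in>F. c n * z powi n) + (\<Sum>n\<in>G. d n * z powi n)"
      using F(1) G(1) by (simp add: sum.If_cases Int_absorb1)
    finally show ?thesis using F(2) G(2) that by simp
  qed
  then show ?thesis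
    unfolding trig_def using F(1) G(1) by (intro exI[of _ "F \<union> G"] exI[of _ ?e]) auto
qed

lemma trig_sum: "(\<And>i. i \<in> I \<Longrightarrow> trig (f i)) \<Longrightarrow> trig (\<lambda>z. \<Sum>i\<in>I. f i z)"
proof (induction I rule: infinite_finite_induct)
  case (insert i I) then show ?case by (simp add: trig_add)
qed (use trig_monom[of 0] in auto)

lemma trig_mult:
  assumes "trig p" "trig q" shows "trig (\<lambda>z. p z * q z)"
proof -
  obtain F c where F: "finite F" "\<And>z. norm z = 1 \<Longrightarrow> p z = (\<Sum>n\<in>F. c n * z powi n)"
    using assms(1) unfolding trig_def by auto
  obtain G d where G: "finite G" "\<And>z. norm z = 1 \<Longrightarrow> q z = (\<Sum>n\<in>G. d n * z powi n)"
    using assms(2) unfolding trig_def by auto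
  have "trig (\<lambda>z. \<Sum>n\<in>F. \<Sum>m\<in>G. (c n * d m) * z powi (n + m))"
    by (intro trig_sum trig_monom)
  then show ?thesis
  proof (rule trig_cong)
    fix z :: complex assume z: "norm z = 1"
    then have "z \<noteq> 0" by auto
    then show "p z * q z = (\<Sum>n\<in>F. \<Sum>m\<in>G. (c n * d m) * z powi (n + m))"
      by (simp add: F G z sum_product power_int_add mult_ac)
  qed
qed

lemma trig_measurable: assumes "trig p" shows "p \<in> borel_measurable ucirc"
proof -
  obtain F c where F: "finite F" "\<And>z. norm z = 1 \<Longrightarrow> p z = (\<Sum>n\<in>F. c n * z powi n)"
    using assms unfolding trig_def by auto
  have "(\<lambda>z. \<Sum>n\<in>F. c n * z powi n) \<in> borel_measurable ucirc" by measurable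
  then show ?thesis using F(2) by (subst measurable_cong) auto
qed

lemma trig_real_polynomial:
  assumes "real_polynomial_function f"
  shows "trig (\<lambda>z. of_real (f z))"
  using assms
proof induction
  case (linear f)
  \<comment> \<open>On the circle Re z = (z + 1/z) / 2 and Im z = (z - 1/z) / (2 i), while a real
    linear f maps z to Re z times f 1 plus Im z times f i. These are the collected coefficients of z
    and 1/z.\<close>
  have "trig (\<lambda>z. ((of_real (f 1) - \<i> * of_real (f \<i>)) / 2) * z powi 1
               + ((of_real (f 1) + \<i> * of_real (f \<i>)) / 2) * z powi (-1))"
    by (intro trig_add trig_monom)
  then show ?case
  proof (rule trig_cong)
    fix z :: complex assume z: "norm z = 1"
    interpret bounded_linear f by fact
    have "f z = f (Re z *\<^sub>R 1 + Im z *\<^sub>R \<i>)"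
      by (rule arg_cong[of _ _ f]) (simp add: complex_eq_iff)
    then have *: "f z = Re z * f 1 + Im z * f \<i>" by (simp only: add scaleR) simp
    have "inverse z = cnj z"
      using z by (simp add: inverse_complex.ctr complex_eq_iff cmod_power2 flip: cmod_power2)
    then have "z powi (-1) = cnj z" by (simp add: power_int_minus)
    then show "of_real (f z) = ((of_real (f 1) - \<i> * of_real (f \<i>)) / 2) * z powi 1
               + ((of_real (f 1) + \<i> * of_real (f \<i>)) / 2) * z powi (-1)"
      by (simp only: *) (simp add: complex_eq_iff field_simps)
  qed
next
  case (const c) then show ?case using trig_monom[of "of_real c" 0] by simp
qed (auto intro: trig_add trig_mult)

text \<open>The L^2 closure of the trigonometric polynomials. Its stability under sums, multiples
  and limits carries it from continuous functions over indicators and simple functions to all of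
  L^2.\<close>

definition tapx :: "(complex \<Rightarrow> complex) \<Rightarrow> bool" where
  "tapx g \<longleftrightarrow> g \<in> borel_measurable ucirc \<and> (\<forall>e>0. \<exists>p. trig p \<and> sq (\<lambda>z. g z - p z) < ennreal e)"

text \<open>From (a + b)^2 \<le> 2 a^2 + 2 b^2. This crude bound stands in for Minkowski's
  inequality and causes the splitting of errors into e / 4.\<close>

lemma sq_add_le:
  assumes [measurable]: "g \<in> borel_measurable ucirc" "h \<in> borel_measurable ucirc"
  shows "sq (\<lambda>z. g z + h z) \<le> 2 * sq g + 2 * sq h"
proof -
  have "sq (\<lambda>z. g z + h z) \<le> (\<integral>\<^sup>+z. 2 * ennreal ((cmod (g z))\<^sup>2) + 2 * ennreal ((cmod (h z))\<^sup>2) \<partial>ucirc)"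
    unfolding sq_def
  proof (rule nn_integral_mono)
    fix z
    have "(cmod (g z + h z))\<^sup>2 \<le> (cmod (g z) + cmod (h z))\<^sup>2"
      by (intro power_mono norm_triangle_ineq) auto
    also have "\<dots> \<le> 2 * (cmod (g z))\<^sup>2 + 2 * (cmod (h z))\<^sup>2"
      using sum_squares_bound[of "cmod (g z)" "cmod (h z)"] by (simp add: power2_sum)
    finally show "ennreal ((cmod (g z + h z))\<^sup>2) \<le> 2 * ennreal ((cmod (g z))\<^sup>2) + 2 * ennreal ((cmod (h z))\<^sup>2)"
      by (simp add: ennreal_plus[symmetric] ennreal_mult[symmetric] ennreal_leI del: ennreal_plus
               flip: ennreal_numeral)
  qed
  also have "\<dots> = 2 * sq g + 2 * sq h"
    unfolding sq_def by (subst nn_integral_add) (auto simp: nn_integral_cmult)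
  finally show ?thesis .
qed

lemma sq_add_less:
  assumes "g \<in> borel_measurable ucirc" "h \<in> borel_measurable ucirc" and "e > 0"
    and "sq g < ennreal (e / 4)" "sq h < ennreal (e / 4)"
  shows "sq (\<lambda>z. g z + h z) < ennreal e"
proof -
  have "sq (\<lambda>z. g z + h z) \<le> 2 * sq g + 2 * sq h" by (rule sq_add_le[OF assms(1,2)])
  also have "\<dots> < 2 * ennreal (e / 4) + 2 * ennreal (e / 4)"
    using assms(4,5) by (intro add_strict_mono ennreal_mult_strict_left_mono) auto
  also have "\<dots> = ennreal e"
    using \<open>e > 0\<close> by (simp add: ennreal_plus[symmetric] ennreal_mult[symmetric] del: ennreal_plus
               flip: ennreal_numeral)
  finally show ?thesis .
qed

lemma sq_cmult: "g \<in> borel_measurable ucirc \<Longrightarrow> sq (\<lambda>z. a * g z) = ennreal ((cmod a)\<^sup>2) * sq g"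
  unfolding sq_def by (simp add: norm_mult power_mult_distrib ennreal_mult nn_integral_cmult)

lemma sq_le_const:
  assumes "\<And>z. norm z = 1 \<Longrightarrow> cmod (g z) \<le> B"
  shows "sq g \<le> ennreal (2 * pi * B\<^sup>2)"
proof -
  have "sq g \<le> (\<integral>\<^sup>+z. ennreal (B\<^sup>2) \<partial>ucirc)"
    unfolding sq_def using assms by (intro nn_integral_mono ennreal_leI power_mono) auto
  then show ?thesis
    by (simp add: emeasure_ucirc_space ennreal_mult[symmetric] mult_ac)
qed

lemma tapx_closed:
  assumes g: "g \<in> borel_measurable ucirc"
    and "\<And>e. e > 0 \<Longrightarrow> \<exists>h. tapx h \<and> sq (\<lambda>z. g z - h z) < ennreal e"
  shows "tapx g"
  unfolding tapx_def
proof (intro conjI g allI impI)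
  fix e :: real assume "e > 0"
  obtain h where h: "tapx h" "sq (\<lambda>z. g z - h z) < ennreal (e/4)"
    using assms(2)[of "e/4"] \<open>e > 0\<close> by auto
  obtain p where p: "trig p" "sq (\<lambda>z. h z - p z) < ennreal (e/4)"
    using h(1) \<open>e > 0\<close> unfolding tapx_def by (meson divide_pos_pos zero_less_numeral)
  have [measurable]: "h \<in> borel_measurable ucirc" "p \<in> borel_measurable ucirc"
    using h(1) p(1) by (auto simp: tapx_def trig_measurable)
  have "sq (\<lambda>z. (g z - h z) + (h z - p z)) < ennreal e"
    using g h(2) p(2) \<open>e > 0\<close> by (intro sq_add_less) auto
  then show "\<exists>p. trig p \<and> sq (\<lambda>z. g z - p z) < ennreal e" using p(1) by auto
qed

lemma tapx_limit:
  assumes g: "g \<in> borel_measurable ucirc"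
    and h: "\<And>i::nat. tapx (h i)" and lim: "(\<lambda>i. sq (\<lambda>z. g z - h i z)) \<longlonglongrightarrow> 0"
  shows "tapx g"
proof (rule tapx_closed[OF g])
  fix e :: real assume "e > 0"
  then have "eventually (\<lambda>i. sq (\<lambda>z. g z - h i z) < ennreal e) sequentially"
    by (intro order_tendstoD(2)[OF lim]) auto
  then show "\<exists>h. tapx h \<and> sq (\<lambda>z. g z - h z) < ennreal e"
    using h eventually_happens' sequentially_bot by blast
qed

lemma tapx_add:
  assumes "tapx g" "tapx h" shows "tapx (\<lambda>z. g z + h z)"
  unfolding tapx_def
proof (intro conjI allI impI)
  have [measurable]: "g \<in> borel_measurable ucirc" "h \<in> borel_measurable ucirc"
    using assms by (auto simp: tapx_def)
  show "(\<lambda>z. g z + h z) \<in> borel_measurable ucirc" by measurable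
  fix e :: real assume "e > 0"
  obtain p where p: "trig p" "sq (\<lambda>z. g z - p z) < ennreal (e/4)"
    using assms(1) \<open>e > 0\<close> unfolding tapx_def by (meson divide_pos_pos zero_less_numeral)
  obtain q where q: "trig q" "sq (\<lambda>z. h z - q z) < ennreal (e/4)"
    using assms(2) \<open>e > 0\<close> unfolding tapx_def by (meson divide_pos_pos zero_less_numeral)
  have [measurable]: "p \<in> borel_measurable ucirc" "q \<in> borel_measurable ucirc"
    using p q by (auto simp: trig_measurable)
  have "sq (\<lambda>z. (g z - p z) + (h z - q z)) < ennreal e"
    using p(2) q(2) \<open>e > 0\<close> by (intro sq_add_less) auto
  then show "\<exists>p. trig p \<and> sq (\<lambda>z. g z + h z - p z) < ennreal e"
    using trig_add[OF p(1) q(1)] by (auto simp: algebra_simps)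
qed

lemma tapx_trig: "trig p \<Longrightarrow> tapx p"
  unfolding tapx_def by (auto simp: trig_measurable sq_def intro!: exI[of _ p])

lemma tapx_cmult:
  assumes "tapx g" shows "tapx (\<lambda>z. a * g z)"
  unfolding tapx_def
proof (intro conjI allI impI)
  have [measurable]: "g \<in> borel_measurable ucirc"
    using assms by (auto simp: tapx_def)
  show "(\<lambda>z. a * g z) \<in> borel_measurable ucirc" by measurable
  fix e :: real assume "e > 0"
  \<comment> \<open>Adding 1 covers a = 0 and makes the final inequality strict.\<close>
  define d where "d = e / ((cmod a)\<^sup>2 + 1)"
  have "d > 0" using \<open>e > 0\<close> by (simp add: d_def add_nonneg_pos)
  then obtain p where p: "trig p" "sq (\<lambda>z. g z - p z) < ennreal d"
    using assms(1) unfolding tapx_def by meson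
  have [measurable]: "p \<in> borel_measurable ucirc"
    using p by (auto simp: trig_measurable)
  have "sq (\<lambda>z. a * g z - a * p z) = ennreal ((cmod a)\<^sup>2) * sq (\<lambda>z. g z - p z)"
    by (subst sq_cmult[symmetric]) (auto simp: algebra_simps)
  also have "\<dots> \<le> ennreal ((cmod a)\<^sup>2) * ennreal d"
    using p(2) by (intro mult_left_mono) auto
  also have "\<dots> = ennreal ((cmod a)\<^sup>2 * d)" using \<open>d > 0\<close> by (simp add: ennreal_mult)
  also have "\<dots> < ennreal e"
  proof (rule ennreal_lessI[OF \<open>e > 0\<close>])
    have "(cmod a)\<^sup>2 * d < ((cmod a)\<^sup>2 + 1) * d" using \<open>d > 0\<close> by simp
    also have "\<dots> = e" unfolding d_def using \<open>e > 0\<close>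
      by (metis add_nonneg_pos less_numeral_extra(1,3) nonzero_eq_divide_eq mult.commute zero_le_power2)
    finally show "(cmod a)\<^sup>2 * d < e" .
  qed
  finally show "\<exists>p. trig p \<and> sq (\<lambda>z. a * g z - p z) < ennreal e"
    using trig_mult[OF trig_monom[of a 0] p(1)] by auto
qed

lemma tapx_sum: "(\<And>i. i \<in> I \<Longrightarrow> tapx (f i)) \<Longrightarrow> tapx (\<lambda>z. \<Sum>i\<in>I. f i z)"
proof (induction I rule: infinite_finite_induct)
  case (insert i I) then show ?case by (simp add: tapx_add)
qed (use tapx_trig[OF trig_monom[of 0]] in auto)

lemma tapx_continuous:
  fixes f :: "complex \<Rightarrow> real"
  assumes "continuous_on (sphere 0 1) f"
  shows "tapx (\<lambda>z. of_real (f z))"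
  unfolding tapx_def
proof (intro conjI allI impI)
  show "(\<lambda>z. complex_of_real (f z)) \<in> borel_measurable ucirc"
    using assms by (intro measurable_ucirc_continuous continuous_intros)
  fix e :: real assume "e > 0"
  \<comment> \<open>Chosen so that a uniform error d costs 2 pi d^2 = e / 2 in mean square.\<close>
  define d where "d = sqrt (e / (4 * pi))"
  have "d > 0" using \<open>e > 0\<close> by (simp add: d_def)
  obtain g where g: "real_polynomial_function g" "\<And>x. x \<in> sphere 0 1 \<Longrightarrow> \<bar>f x - g x\<bar> < d"
    using Stone_Weierstrass_real_polynomial_function[OF compact_sphere assms \<open>d > 0\<close>] by metis
  have "sq (\<lambda>z. of_real (f z) - of_real (g z)) \<le> ennreal (2 * pi * d\<^sup>2)"
    using g(2) by (intro sq_le_const) (auto simp flip: of_real_diff intro: less_imp_le)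
  also have "\<dots> < ennreal e"
    using \<open>e > 0\<close> by (intro ennreal_lessI) (auto simp: d_def)
  finally show "\<exists>p. trig p \<and> sq (\<lambda>z. complex_of_real (f z) - p z) < ennreal e"
    using trig_real_polynomial[OF g(1)] by blast
qed

lemma tapx_indicator_closed:
  assumes K: "closed K"
  shows "tapx (\<lambda>z. of_real (indicator K z))"
\<comment> \<open>\<open>infdist z {}\<close> is 0 by convention, so the tent functions below would
  tend to 1 instead of 0.\<close>
proof (cases "K = {}")
  case True then show ?thesis using tapx_trig[OF trig_monom[of 0]] by simp
next
  case False
  \<comment> \<open>Tents of slope i around K: equal to 1 on K, and eventually 0 at every point off
    K because K is closed and the distance is positive there.\<close>
  define h where "h i z = max 0 (1 - real i * infdist z K)" for i z
  have [measurable]: "h i \<in> borel_measurable ucirc" for i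
    unfolding h_def by (intro measurable_ucirc_continuous continuous_intros)
  have [measurable]: "(indicator K :: complex \<Rightarrow> real) \<in> borel_measurable ucirc"
    using borel_measurable_indicator[of K borel, OF borel_closed[OF K]]
    by (rule measurable_compose[OF measurable_ucirc_ident])
  have h_lim: "(\<lambda>i. h i z) \<longlonglongrightarrow> indicator K z" for z
  proof (cases "z \<in> K")
    case True then show ?thesis by (simp add: h_def)
  next
    case F: False
    then have "infdist z K > 0"
      using in_closed_iff_infdist_zero[OF K False, of z] infdist_nonneg[of z K] by simp
    then obtain N where N: "1 < real N * infdist z K" using reals_Archimedean3 by metis
    have "eventually (\<lambda>i. h i z = 0) sequentially"
      using eventually_ge_at_top[of N]
    proof eventually_elim
      case (elim i)
      have "real N * infdist z K \<le> real i * infdist z K"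
        using elim by (intro mult_right_mono) (auto simp: infdist_nonneg)
      then show ?case using N by (simp add: h_def)
    qed
    then show ?thesis using F by (simp add: tendsto_eventually)
  qed
  show ?thesis
  proof (rule tapx_limit)
    show "tapx (\<lambda>z. of_real (h i z))" for i
      unfolding h_def by (intro tapx_continuous continuous_intros)
    have "(\<lambda>i. \<integral>\<^sup>+z. ennreal ((indicator K z - h i z)\<^sup>2) \<partial>ucirc) \<longlonglongrightarrow> (\<integral>\<^sup>+z. 0 \<partial>ucirc)"
    proof (rule nn_integral_dominated_convergence[where w="\<lambda>_. 1"])
      show "AE z in ucirc. ennreal ((indicator K z - h j z)\<^sup>2) \<le> 1" for j
      proof (rule AE_I2)
        fix z
        have "0 \<le> h j z" "h j z \<le> 1" by (auto simp: h_def infdist_nonneg)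
        then have "\<bar>indicator K z - h j z\<bar> \<le> 1" by (auto split: split_indicator)
        then show "ennreal ((indicator K z - h j z)\<^sup>2) \<le> 1"
          by (simp add: abs_square_le_1)
      qed
      have "(\<lambda>i. ennreal ((indicator K z - h i z)\<^sup>2)) \<longlonglongrightarrow> ennreal ((indicator K z - indicator K z)\<^sup>2)" for z
        by (intro tendsto_ennrealI tendsto_intros h_lim)
      then show "AE z in ucirc. (\<lambda>i. ennreal ((indicator K z - h i z)\<^sup>2)) \<longlonglongrightarrow> 0" by simp
    qed (auto simp: emeasure_ucirc_space)
    then show "(\<lambda>i. sq (\<lambda>z. of_real (indicator K z) - of_real (h i z))) \<longlonglongrightarrow> 0"
      by (simp add: sq_def flip: of_real_diff)
  qed measurable
qed

lemma tapx_indicator: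
  assumes "A \<in> sets ucirc"
  shows "tapx (\<lambda>z. of_real (indicator A z))"
proof -
  obtain B where B: "B \<in> sets borel" "A = sphere 0 1 \<inter> B"
    using assms by (auto simp: sets_ucirc sets_restrict_space)
  \<comment> \<open>Inner regularity is a statement about measures on all Borel sets, so arc length
    is pushed forward to the whole plane.\<close>
  define M where "M = distr ucirc borel (\<lambda>z. z)"
  have M: "sets M = sets borel" "emeasure M (space M) \<noteq> \<infinity>"
    by (auto simp: M_def emeasure_distr)
  have eM: "emeasure M X = emeasure ucirc (X \<inter> sphere 0 1)" if "X \<in> sets borel" for X
    using that by (auto simp: M_def emeasure_distr)
  have X: "sphere 0 1 \<inter> X \<in> sets ucirc" if "X \<in> sets borel" for X
    unfolding sets_ucirc sets_restrict_space using that by (rule imageI)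
  show ?thesis
  proof (rule tapx_closed)
    have A[measurable]: "A \<in> sets ucirc" by fact
    show "(\<lambda>z. complex_of_real (indicator A z)) \<in> borel_measurable ucirc" by measurable
    fix e :: real assume "e > 0"
    interpret M: finite_measure M using M(2) by (rule finite_measureI)
    have "\<exists>K\<in>{K. K \<subseteq> B \<and> compact K}. emeasure M B < emeasure M K + ennreal e"
    proof (cases "measure M B = 0")
      case True
      then show ?thesis using \<open>e > 0\<close> by (intro bexI[of _ "{}"]) (auto simp: M.emeasure_eq_measure)
    next
      case False
      then have "ennreal (measure M B - e) < emeasure M B"
        using \<open>e > 0\<close> by (auto simp: M.emeasure_eq_measure zero_less_measure_iff intro!: ennreal_lessI)
      then obtain K where K: "K \<subseteq> B" "compact K" "ennreal (measure M B - e) < ennreal (measure M K)"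
        unfolding inner_regular[OF M B(1)] less_SUP_iff by (auto simp: M.emeasure_eq_measure)
      then have "measure M B < measure M K + e"
        by (cases "measure M B - e \<ge> 0") (auto simp: ennreal_less_iff not_le intro: add_nonneg_pos order_less_le_trans)
      then show ?thesis
        using K \<open>e > 0\<close> by (intro bexI[of _ K]) (auto simp: M.emeasure_eq_measure ennreal_less_iff simp flip: ennreal_plus)
    qed
    then obtain K where K: "K \<subseteq> B" "compact K" "emeasure M B < emeasure M K + ennreal e" by auto
    have Kb: "K \<in> sets borel" using K(2) by (simp add: compact_imp_closed)
    have "sq (\<lambda>z. of_real (indicator A z) - of_real (indicator K z)) = (\<integral>\<^sup>+z. indicator (A - (sphere 0 1 \<inter> K)) z \<partial>ucirc)"
      unfolding sq_def using K(1) B(2)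
      by (intro nn_integral_cong) (auto split: split_indicator simp flip: of_real_diff)
    also have "\<dots> = emeasure ucirc (A - (sphere 0 1 \<inter> K))"
      using X[OF Kb] by (intro nn_integral_indicator) auto
    also have "\<dots> = emeasure ucirc A - emeasure ucirc (sphere 0 1 \<inter> K)"
      using K(1) B(2) X[OF Kb] A by (intro emeasure_Diff) auto
    also have "\<dots> < ennreal e"
    proof -
      have "emeasure ucirc A < emeasure ucirc (sphere 0 1 \<inter> K) + ennreal e"
        using K(3) B Kb by (simp add: eM Int_commute)
      then show ?thesis
        using \<open>e > 0\<close>
        by (auto simp: ucirc.emeasure_eq_measure ennreal_minus ennreal_less_iff intro!: ennreal_lessI simp flip: ennreal_plus)
    qed
    finally show "\<exists>h. tapx h \<and> sq (\<lambda>z. of_real (indicator A z) - h z) < ennreal e"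
      using tapx_indicator_closed[OF compact_imp_closed[OF K(2)]] by blast
  qed
qed

lemma tapx_simple:
  assumes s: "simple_function ucirc s"
  shows "tapx s"
proof -
  \<comment> \<open>The representation by indicators holds only on the space of the measure, so
    \<open>t\<close> agrees with \<open>s\<close> on the circle but need not be the same
    function.\<close>
  define t where "t z = (\<Sum>y \<in> s ` space ucirc. y * of_real (indicator (s -` {y} \<inter> space ucirc) z))" for z
  have t: "tapx t"
    unfolding t_def
    by (rule tapx_sum, rule tapx_cmult, rule tapx_indicator, rule simple_functionD(2)[OF s])
  have eq: "s z = t z" if "z \<in> space ucirc" for z
    using simple_function_indicator_representation_banach[OF s that]
    by (simp only: t_def scaleR_conv_of_real mult.commute[of _ "of_real _"])
  have "sq (\<lambda>z. s z - p z) = sq (\<lambda>z. t z - p z)" for p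
    unfolding sq_def by (intro nn_integral_cong) (simp only: eq)
  then show ?thesis using t borel_measurable_simple_function[OF s] unfolding tapx_def by simp
qed

theorem tapx_L2:
  assumes g[measurable]: "g \<in> borel_measurable ucirc" and L2: "sq g < \<infinity>"
  shows "tapx g"
proof -
  obtain s where s: "\<And>i. simple_function ucirc (s i)"
    and lim: "\<And>x. x \<in> space ucirc \<Longrightarrow> (\<lambda>i. s i x) \<longlonglongrightarrow> g x"
    and bd: "\<And>i x. x \<in> space ucirc \<Longrightarrow> dist (s i x) 0 \<le> 2 * dist (g x) 0"
    using borel_measurable_implies_sequence_metric[OF g, of 0] by metis
  note [measurable] = borel_measurable_simple_function[OF s]
  show ?thesis
  proof (rule tapx_limit[OF g tapx_simple[OF s]])
    have "(\<lambda>i. \<integral>\<^sup>+z. ennreal ((cmod (g z - s i z))\<^sup>2) \<partial>ucirc) \<longlonglongrightarrow> (\<integral>\<^sup>+z. 0 \<partial>ucirc)"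
    \<comment> \<open>The approximants satisfy cmod (s i z) \<le> 2 cmod (g z), so the error is at
      most 3 cmod (g z); squaring gives the 9.\<close>
    proof (rule nn_integral_dominated_convergence[where w="\<lambda>z. 9 * ennreal ((cmod (g z))\<^sup>2)"])
      show "AE z in ucirc. ennreal ((cmod (g z - s j z))\<^sup>2) \<le> 9 * ennreal ((cmod (g z))\<^sup>2)" for j
      proof (rule AE_I2)
        fix z assume z: "z \<in> space ucirc"
        have "cmod (g z - s j z) \<le> 3 * cmod (g z)"
          using bd[OF z, of j] norm_triangle_ineq4[of "g z" "s j z"] by simp
        then have "(cmod (g z - s j z))\<^sup>2 \<le> (3 * cmod (g z))\<^sup>2" by (intro power_mono) auto
        then show "ennreal ((cmod (g z - s j z))\<^sup>2) \<le> 9 * ennreal ((cmod (g z))\<^sup>2)"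
          by (simp add: power_mult_distrib ennreal_mult[symmetric] ennreal_leI flip: ennreal_numeral)
      qed
      show "(\<integral>\<^sup>+ x. 9 * ennreal ((cmod (g x))\<^sup>2) \<partial>ucirc) < \<infinity>"
        using L2 by (simp add: nn_integral_cmult sq_def ennreal_mult_less_top)
      have "(\<lambda>i. ennreal ((cmod (g z - s i z))\<^sup>2)) \<longlonglongrightarrow> ennreal ((cmod (g z - g z))\<^sup>2)" if "z \<in> space ucirc" for z
        by (intro tendsto_ennrealI tendsto_intros lim that)
      then show "AE z in ucirc. (\<lambda>i. ennreal ((cmod (g z - s i z))\<^sup>2)) \<longlonglongrightarrow> 0"
        by (intro AE_I2) simp
    qed auto
    then show "(\<lambda>i. sq (\<lambda>z. g z - s i z)) \<longlonglongrightarrow> 0"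
      by (simp add: sq_def)
  qed
qed

section \<open>Parseval's identity and the Gagliardo seminorm\<close>

text \<open>Nonnegative sums are used in two guises: integrals over counting measure can be
  exchanged with other integrals, while \<open>has_sum\<close> permits subtraction and limits. This
  lemma and the next translate.\<close>

lemma nn_integral_count_space_has_sum:
  fixes f :: "'a \<Rightarrow> real"
  assumes "\<And>x. f x \<ge> 0" and "(f has_sum S) UNIV"
  shows "(\<integral>\<^sup>+x. ennreal (f x) \<partial>count_space UNIV) = ennreal S"
proof -
  have "Infinite_Set_Sum.abs_summable_on f UNIV"
    using assms has_sum_imp_summable by (auto simp: abs_summable_equivalent[symmetric])
  then have i: "integrable (count_space UNIV) f" by (simp add: Infinite_Set_Sum.abs_summable_on_def)
  have "(\<integral>\<^sup>+x. ennreal (f x) \<partial>count_space UNIV) = ennreal (infsetsum f UNIV)"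
    using assms(1) i by (simp add: nn_integral_eq_integral infsetsum_def)
  also have "infsetsum f UNIV = S"
    using infsetsum_infsum[OF \<open>Infinite_Set_Sum.abs_summable_on f UNIV\<close>] assms(2) by (simp add: infsumI)
  finally show ?thesis .
qed

lemma has_sum_of_nn_integral_count_space:
  fixes f :: "'a \<Rightarrow> real"
  assumes "\<And>x. f x \<ge> 0" and "(\<integral>\<^sup>+x. ennreal (f x) \<partial>count_space UNIV) < \<infinity>"
  shows "(f has_sum enn2real (\<integral>\<^sup>+x. ennreal (f x) \<partial>count_space UNIV)) UNIV"
proof -
  have "integrable (count_space UNIV) f"
    using assms by (intro integrableI_nonneg) auto
  then have "Infinite_Set_Sum.abs_summable_on f UNIV" by (simp add: Infinite_Set_Sum.abs_summable_on_def)
  then have "f summable_on UNIV"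
    using abs_summable_equivalent abs_summable_summable by blast
  then have hs: "(f has_sum infsum f UNIV) UNIV" by (rule has_sum_infsum)
  then show ?thesis
    using nn_integral_count_space_has_sum[OF assms(1) hs] assms(1) by (simp add: infsum_nonneg)
qed

text \<open>Arc length is finite, so L^2 is contained in L^1, by x \<le> 1 + x^2.\<close>

lemma integrable_of_sq:
  assumes [measurable]: "g \<in> borel_measurable ucirc" and "sq g < \<infinity>"
  shows "integrable ucirc (\<lambda>z. (cmod (g z))\<^sup>2)" and "sq g = ennreal (LINT z|ucirc. (cmod (g z))\<^sup>2)"
    and "integrable ucirc g"
proof -
  show i: "integrable ucirc (\<lambda>z. (cmod (g z))\<^sup>2)"
    using assms(2) unfolding sq_def by (intro integrableI_nonneg) auto
  show "sq g = ennreal (LINT z|ucirc. (cmod (g z))\<^sup>2)"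
    unfolding sq_def by (intro nn_integral_eq_integral i) auto
  show "integrable ucirc g"
  proof (rule Bochner_Integration.integrable_bound)
    show "integrable ucirc (\<lambda>z. 1 + (cmod (g z))\<^sup>2)" using i by auto
    have "x \<le> 1 + x\<^sup>2" for x :: real
      using zero_le_power2[of "x - 1/2"] by (simp add: power2_diff power_divide)
    then show "AE z in ucirc. norm (g z) \<le> norm (1 + (cmod (g z))\<^sup>2)" by (intro AE_I2) (auto intro: order_trans)
  qed auto
qed

lemma integrable_ucirc_times_bounded:
  assumes "integrable ucirc g" and [measurable]: "k \<in> borel_measurable ucirc"
    and "\<And>z. norm z = 1 \<Longrightarrow> cmod (k z) \<le> B"
  shows "integrable ucirc (\<lambda>z. g z * k z)"
proof -
  have [measurable]: "g \<in> borel_measurable ucirc" using assms(1) by auto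
  show ?thesis
  proof (rule Bochner_Integration.integrable_bound)
    show "integrable ucirc (\<lambda>z. B * norm (g z))" using assms(1) by auto
    show "AE z in ucirc. norm (g z * k z) \<le> norm (B * norm (g z))"
    proof (rule AE_I2)
      fix z assume "z \<in> space ucirc"
      then have "norm (g z) * cmod (k z) \<le> norm (g z) * B"
        using assms(3) by (intro mult_left_mono) auto
      also have "\<dots> \<le> norm (g z) * \<bar>B\<bar>" by (intro mult_left_mono) auto
      finally show "norm (g z * k z) \<le> norm (B * norm (g z))" by (simp add: norm_mult abs_mult mult.commute)
    qed
  qed auto
qed

lemma integrable_ucirc_times_powi:
  "integrable ucirc g \<Longrightarrow> integrable ucirc (\<lambda>z. g z * z powi n)"
  by (rule integrable_ucirc_times_bounded[where B=1]) (auto simp: norm_power_int)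

lemma cnj_powi_unit: "norm z = 1 \<Longrightarrow> cnj z powi n = z powi (- n)"
  using divide_conv_cnj[of "z powi n" 1] by (simp add: norm_power_int power_int_minus inverse_eq_divide)

lemma integral_fco: "(LINT z|ucirc. g z * z powi (- n)) = of_real (2 * pi) * fco g n"
  by (simp add: fco_def)

lemma fco_powi: "fco (\<lambda>z. z powi n) m = (if m = n then 1 else 0)"
proof -
  have "(LINT z|ucirc. z powi n * z powi (- m)) = (LINT z|ucirc. z powi (n - m))"
  proof (rule Bochner_Integration.integral_cong[OF refl])
    fix z :: complex assume "z \<in> space ucirc"
    then have "z \<noteq> 0" by auto
    then show "z powi n * z powi (- m) = z powi (n - m)"
      by (simp add: power_int_add[symmetric])
  qed
  then show ?thesis by (auto simp: fco_def integral_ucirc_powi)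
qed

lemma fco_add:
  assumes "integrable ucirc g" "integrable ucirc h"
  shows "fco (\<lambda>z. g z + h z) n = fco g n + fco h n"
  by (simp add: fco_def distrib_right integrable_ucirc_times_powi assms add_divide_distrib)

lemma fco_diff:
  assumes "integrable ucirc g" "integrable ucirc h"
  shows "fco (\<lambda>z. g z - h z) n = fco g n - fco h n"
  by (simp add: fco_def left_diff_distrib integrable_ucirc_times_powi assms diff_divide_distrib)

lemma fco_cmult: "fco (\<lambda>z. a * g z) n = a * fco g n"
  by (simp add: fco_def mult.assoc)

lemma fco_rotate:
  assumes [measurable]: "g \<in> borel_measurable ucirc" and "norm \<zeta> = 1"
  shows "fco (\<lambda>z. g (\<zeta> * z)) n = \<zeta> powi n * fco g n"
proof -
  have "\<zeta> \<noteq> 0" using assms by auto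
  have "(LINT z|ucirc. g (\<zeta> * z) * z powi (- n)) = (LINT z|ucirc. \<zeta> powi n * (g (\<zeta> * z) * (\<zeta> * z) powi (- n)))"
    using \<open>\<zeta> \<noteq> 0\<close>
    by (intro Bochner_Integration.integral_cong refl) (simp add: power_int_mult_distrib power_int_minus)
  also have "\<dots> = \<zeta> powi n * (LINT z|ucirc. g z * z powi (- n))"
    using assms by (subst integral_mult_right_zero, subst integral_ucirc_rotate[where h="\<lambda>z. g z * z powi (- n)"]) auto
  finally show ?thesis by (simp add: fco_def)
qed

text \<open>Expanding the square and using orthogonality of the powers leaves a completed square in
  each \<open>c n\<close>. With c = \<open>fco g\<close> it yields Bessel's inequality; with c free
  it shows that no polynomial with exponents in F approximates better than the Fourier sum.\<close>

lemma bessel_identity: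
  assumes [measurable]: "g \<in> borel_measurable ucirc" and "sq g < \<infinity>" and "finite F"
  shows "(LINT z|ucirc. (cmod (g z - (\<Sum>n\<in>F. c n * z powi n)))\<^sup>2)
    = (LINT z|ucirc. (cmod (g z))\<^sup>2) - 2 * pi * (\<Sum>n\<in>F. (cmod (fco g n))\<^sup>2)
        + 2 * pi * (\<Sum>n\<in>F. (cmod (fco g n - c n))\<^sup>2)"
proof -
  note I = integrable_of_sq[OF assms(1,2)]
  let ?p = "\<lambda>z. \<Sum>n\<in>F. c n * z powi n"
  let ?A = "\<lambda>z. \<Sum>n\<in>F. cnj (c n) * (g z * z powi (- n))"
  let ?B = "\<lambda>z. \<Sum>n\<in>F. \<Sum>m\<in>F. c n * cnj (c m) * z powi (n - m)"
  have pw: "(cmod (g z - ?p z))\<^sup>2 = (cmod (g z))\<^sup>2 - 2 * Re (?A z) + Re (?B z)" if z: "norm z = 1" for z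
  proof -
    have "z \<noteq> 0" using z by auto
    have A: "g z * cnj (?p z) = ?A z"
      using z by (simp add: cnj_powi_unit sum_distrib_left mult_ac)
    have B: "?p z * cnj (?p z) = ?B z"
      using z \<open>z \<noteq> 0\<close> by (simp add: cnj_powi_unit sum_product mult_ac power_int_diff power_int_minus_divide)
    have "(cmod (a - b))\<^sup>2 = (cmod a)\<^sup>2 - 2 * Re (a * cnj b) + Re (b * cnj b)" for a b
      unfolding cmod_power2 by (simp add: power2_eq_square algebra_simps)
    from this[of "g z" "?p z"] show ?thesis by (simp only: A B)
  qed
  have iA: "integrable ucirc ?A" using I(3) integrable_ucirc_times_powi by auto
  have iB: "integrable ucirc ?B" by auto
  have "(LINT z|ucirc. (cmod (g z - ?p z))\<^sup>2) = (LINT z|ucirc. (cmod (g z))\<^sup>2 - 2 * Re (?A z) + Re (?B z))"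
    by (intro Bochner_Integration.integral_cong refl pw) auto
  also have "\<dots> = (LINT z|ucirc. (cmod (g z))\<^sup>2) - 2 * Re (LINT z|ucirc. ?A z) + Re (LINT z|ucirc. ?B z)"
    using I(1) iA iB by (simp only: integral_Re[symmetric] integral_mult_right_zero[symmetric]
        Bochner_Integration.integral_add Bochner_Integration.integral_diff Bochner_Integration.integrable_diff
        Bochner_Integration.integrable_add Bochner_Integration.integrable_mult_right integrable_Re)
  also have "(LINT z|ucirc. ?A z) = (\<Sum>n\<in>F. cnj (c n) * (of_real (2*pi) * fco g n))"
    using I(3) integrable_ucirc_times_powi by (subst Bochner_Integration.integral_sum) (auto simp: fco_def)
  also have "(LINT z|ucirc. ?B z) = (\<Sum>n\<in>F. \<Sum>m\<in>F. c n * cnj (c m) * (LINT z|ucirc. z powi (n - m)))"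
    by (simp add: Bochner_Integration.integral_sum)
  also have "\<dots> = (\<Sum>n\<in>F. c n * cnj (c n) * of_real (2 * pi))"
  proof (rule sum.cong[OF refl])
    fix n assume "n \<in> F"
    have "(\<Sum>m\<in>F. c n * cnj (c m) * (LINT z|ucirc. z powi (n - m)))
       = (\<Sum>m\<in>F. if m = n then c n * cnj (c n) * of_real (2 * pi) else 0)"
      by (intro sum.cong) (auto simp: integral_ucirc_powi)
    then show "(\<Sum>m\<in>F. c n * cnj (c m) * (LINT z|ucirc. z powi (n - m))) = c n * cnj (c n) * of_real (2 * pi)"
      using \<open>finite F\<close> \<open>n \<in> F\<close> by simp
  qed
  finally have *: "(LINT z|ucirc. (cmod (g z - ?p z))\<^sup>2) = (LINT z|ucirc. (cmod (g z))\<^sup>2)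
      - 2 * Re (\<Sum>n\<in>F. cnj (c n) * (of_real (2*pi) * fco g n)) + Re (\<Sum>n\<in>F. c n * cnj (c n) * of_real (2 * pi))" .
  have "2 * pi * (\<Sum>n\<in>F. (cmod (fco g n - c n))\<^sup>2) - 2 * pi * (\<Sum>n\<in>F. (cmod (fco g n))\<^sup>2)
     = (\<Sum>n\<in>F. 2 * pi * (cmod (fco g n - c n))\<^sup>2 - 2 * pi * (cmod (fco g n))\<^sup>2)"
    by (simp add: sum_distrib_left sum_subtractf)
  also have "\<dots> = (\<Sum>n\<in>F. - 2 * Re (cnj (c n) * (of_real (2*pi) * fco g n)) + Re (c n * cnj (c n) * of_real (2 * pi)))"
    unfolding cmod_power2 by (intro sum.cong refl) (simp add: power2_eq_square algebra_simps)
  also have "\<dots> = - 2 * Re (\<Sum>n\<in>F. cnj (c n) * (of_real (2*pi) * fco g n)) + Re (\<Sum>n\<in>F. c n * cnj (c n) * of_real (2 * pi))"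
    by (simp only: Re_sum sum.distrib sum_distrib_left)
  finally show ?thesis using * by simp
qed

text \<open>Bessel's inequality bounds every finite sum by the integral. Density supplies one finite
  F whose sum comes within e of it, and larger sets only increase the sum.\<close>

theorem parseval_has_sum:
  assumes [measurable]: "g \<in> borel_measurable ucirc" and fin: "sq g < \<infinity>"
  shows "((\<lambda>n. 2 * pi * (cmod (fco g n))\<^sup>2) has_sum (LINT z|ucirc. (cmod (g z))\<^sup>2)) UNIV"
  unfolding has_sum_def
proof (rule tendstoI)
  let ?I = "LINT z|ucirc. (cmod (g z))\<^sup>2"
  fix e :: real assume "e > 0"
  obtain p where p: "trig p" "sq (\<lambda>z. g z - p z) < ennreal e"
    using tapx_L2[OF assms] \<open>e > 0\<close> unfolding tapx_def by meson
  then obtain F c where F: "finite F" "\<And>z. norm z = 1 \<Longrightarrow> p z = (\<Sum>n\<in>F. c n * z powi n)"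
    unfolding trig_def by auto
  have [measurable]: "p \<in> borel_measurable ucirc" using p by (simp add: trig_measurable)
  have s: "sq (\<lambda>z. g z - p z) = ennreal (LINT z|ucirc. (cmod (g z - p z))\<^sup>2)"
    using p(2) by (intro integrable_of_sq(2)) (auto intro: order_less_trans)
  have "(LINT z|ucirc. (cmod (g z - p z))\<^sup>2) < e"
    using p(2) unfolding s by (simp add: ennreal_less_iff)
  also have "(LINT z|ucirc. (cmod (g z - p z))\<^sup>2) = (LINT z|ucirc. (cmod (g z - (\<Sum>n\<in>F. c n * z powi n)))\<^sup>2)"
    using F(2) by (intro Bochner_Integration.integral_cong) auto
  finally have lt: "?I - 2 * pi * (\<Sum>n\<in>F. (cmod (fco g n))\<^sup>2) < e"
    unfolding bessel_identity[OF assms F(1)]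
    using sum_nonneg[of F "\<lambda>n. (cmod (fco g n - c n))\<^sup>2"] by (smt (verit) pi_gt_zero mult_nonneg_nonneg zero_le_power2)
  show "\<forall>\<^sub>F X in finite_subsets_at_top UNIV. dist (\<Sum>n\<in>X. 2 * pi * (cmod (fco g n))\<^sup>2) ?I < e"
    unfolding eventually_finite_subsets_at_top
  proof (intro exI[of _ F] conjI F(1) subset_UNIV allI impI)
    fix X :: "int set" assume X: "finite X \<and> F \<subseteq> X \<and> X \<subseteq> UNIV"
    have "0 \<le> (LINT z|ucirc. (cmod (g z - (\<Sum>n\<in>X. fco g n * z powi n)))\<^sup>2)" by simp
    then have "2 * pi * (\<Sum>n\<in>X. (cmod (fco g n))\<^sup>2) \<le> ?I"
      using bessel_identity[OF assms, of X "fco g"] X by simp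
    moreover have "2 * pi * (\<Sum>n\<in>F. (cmod (fco g n))\<^sup>2) \<le> 2 * pi * (\<Sum>n\<in>X. (cmod (fco g n))\<^sup>2)"
      using X by (intro mult_left_mono sum_mono2) auto
    ultimately show "dist (\<Sum>n\<in>X. 2 * pi * (cmod (fco g n))\<^sup>2) ?I < e"
      using lt by (simp add: dist_real_def sum_distrib_left)
  qed
qed

lemma parseval:
  assumes "g \<in> borel_measurable ucirc" and "sq g < \<infinity>"
  shows "sq g = (\<integral>\<^sup>+n. ennreal (2 * pi * (cmod (fco g n))\<^sup>2) \<partial>count_space UNIV)"
  using nn_integral_count_space_has_sum[OF _ parseval_has_sum[OF assms]] integrable_of_sq(2)[OF assms] by simp

text \<open>By conjugation the modulus depends only on the absolute value m of n. The quotient is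
  then the squared modulus of the geometric sum of m terms, a Fejer kernel up to normalisation, and
  orthogonality counts the terms.\<close>

lemma nn_integral_fejer:
  "(\<integral>\<^sup>+\<zeta>. ennreal ((cmod (1 - \<zeta> powi n))\<^sup>2 / (cmod (1 - \<zeta>))\<^sup>2) \<partial>ucirc) = ennreal (2 * pi * \<bar>of_int n\<bar>)"
proof -
  define m where "m = nat \<bar>n\<bar>"
  have "(\<integral>\<^sup>+\<zeta>. ennreal ((cmod (1 - \<zeta> powi n))\<^sup>2 / (cmod (1 - \<zeta>))\<^sup>2) \<partial>ucirc)
      = sq (\<lambda>\<zeta>. \<Sum>k<m. \<zeta> ^ k)"
    unfolding sq_def
  proof (rule nn_integral_cong_AE)
    have eq: "cmod (1 - \<zeta> powi n) = cmod (1 - \<zeta> ^ m)" if "norm \<zeta> = 1" for \<zeta>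
    proof (cases "n \<ge> 0")
      case True then show ?thesis by (simp add: m_def power_int_def)
    next
      case False
      then have "\<zeta> powi n = inverse (\<zeta> ^ m)" by (simp add: m_def power_int_def power_inverse)
      also have "\<dots> = cnj (\<zeta> ^ m)"
        using cnj_powi_unit[OF that, of "int m"] by (simp add: power_int_minus)
      also have "cmod (1 - \<dots>) = cmod (cnj (1 - \<zeta> ^ m))" by simp
      also have "\<dots> = cmod (1 - \<zeta> ^ m)" by (rule complex_mod_cnj)
      finally show ?thesis .
    qed
    show "AE \<zeta> in ucirc. ennreal ((cmod (1 - \<zeta> powi n))\<^sup>2 / (cmod (1 - \<zeta>))\<^sup>2) = ennreal ((cmod (\<Sum>k<m. \<zeta> ^ k))\<^sup>2)"
      using AE_ucirc_neq[of 1] AE_space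
    proof eventually_elim
      case (elim \<zeta>)
      then have "cmod (1 - \<zeta> powi n) = cmod (1 - \<zeta>) * cmod (\<Sum>k<m. \<zeta> ^ k)"
        using eq[of \<zeta>] by (simp add: one_diff_power_eq norm_mult)
      then show ?case using elim by (simp add: power_mult_distrib)
    qed
  qed
  \<comment> \<open>Bessel's identity is used with g = 0 and all coefficients -1, so the geometric
    sum appears as the error in approximating zero.\<close>
  also have "\<dots> = sq (\<lambda>z. 0 - (\<Sum>k\<in>int ` {..<m}. (- 1) * z powi k))"
    by (simp add: sum.reindex sum_negf)
  also have "\<dots> = ennreal (LINT z|ucirc. (cmod (0 - (\<Sum>k\<in>int ` {..<m}. (- 1) * z powi k)))\<^sup>2)"
  proof (rule integrable_of_sq(2))
    have "sq (\<lambda>z. 0 - (\<Sum>k\<in>int ` {..<m}. (- 1) * z powi k)) \<le> ennreal (2 * pi * (real m)\<^sup>2)"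
    proof (rule sq_le_const)
      fix z :: complex assume "norm z = 1"
      then show "cmod (0 - (\<Sum>k\<in>int ` {..<m}. (- 1) * z powi k)) \<le> real m"
        using norm_sum[of "\<lambda>k. z ^ k" "{..<m}"] by (simp add: sum.reindex sum_negf norm_power)
    qed
    then show "sq (\<lambda>z. 0 - (\<Sum>k\<in>int ` {..<m}. (- 1) * z powi k)) < \<infinity>"
      by (simp add: order_le_less_trans)
  qed measurable
  also have "(LINT z|ucirc. (cmod (0 - (\<Sum>k\<in>int ` {..<m}. (- 1) * z powi k)))\<^sup>2) = 2 * pi * real m"
    by (subst bessel_identity) (auto simp: sq_def fco_def card_image)
  finally show ?thesis by (simp add: m_def)
qed

section \<open>Double integrals over pairs of points of the circle\<close>

lemma measurable_ucirc_fst [measurable]: "fst \<in> borel_measurable (ucirc \<Otimes>\<^sub>M M)"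
  by (rule measurable_compose[OF measurable_fst measurable_ucirc_ident])

lemma measurable_ucirc_snd [measurable]: "snd \<in> borel_measurable (M \<Otimes>\<^sub>M ucirc)"
  by (rule measurable_compose[OF measurable_snd measurable_ucirc_ident])

lemma measurable_ucirc_mult:
  "(\<lambda>p. fst p * snd p) \<in> measurable (ucirc \<Otimes>\<^sub>M ucirc) ucirc"
  by (rule measurable_into_ucirc) (auto simp: space_pair_measure norm_mult)

text \<open>Substituting \<open>w = z \<zeta>\<close> reduces the double integral to Parseval's identity for
  \<open>g - g(\<zeta> \<cdot>)\<close>, whose coefficients are \<open>1 - \<zeta>\<^sup>n\<close> times those of \<open>g\<close>.\<close>

lemma gagliardo_fourier:
  assumes g[measurable]: "g \<in> borel_measurable ucirc" and fin: "sq g < \<infinity>"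
  shows "(\<integral>\<^sup>+z. (\<integral>\<^sup>+w. ennreal ((cmod (g z - g w))\<^sup>2 / (cmod (z - w))\<^sup>2) \<partial>ucirc) \<partial>ucirc)
    = (\<integral>\<^sup>+n. ennreal (4 * pi\<^sup>2 * \<bar>of_int n\<bar> * (cmod (fco g n))\<^sup>2) \<partial>count_space UNIV)"
proof -
  have [measurable]: "(\<lambda>p. g (fst p * snd p)) \<in> borel_measurable (ucirc \<Otimes>\<^sub>M ucirc)"
    by (rule measurable_compose[OF measurable_ucirc_mult g])
  have gz: "(\<lambda>z. g (\<zeta> * z)) \<in> borel_measurable ucirc" if "norm \<zeta> = 1" for \<zeta>
    using that by (intro measurable_compose[OF _ g] measurable_into_ucirc) (auto simp: norm_mult)
  have "(\<integral>\<^sup>+z. (\<integral>\<^sup>+w. ennreal ((cmod (g z - g w))\<^sup>2 / (cmod (z - w))\<^sup>2) \<partial>ucirc) \<partial>ucirc)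
     = (\<integral>\<^sup>+z. (\<integral>\<^sup>+\<zeta>. ennreal ((cmod (g z - g (z * \<zeta>)))\<^sup>2 / (cmod (1 - \<zeta>))\<^sup>2) \<partial>ucirc) \<partial>ucirc)"
  proof (rule nn_integral_cong)
    fix z :: complex assume "z \<in> space ucirc"
    then have z: "norm z = 1" by simp
    have "(\<integral>\<^sup>+w. ennreal ((cmod (g z - g w))\<^sup>2 / (cmod (z - w))\<^sup>2) \<partial>ucirc)
        = (\<integral>\<^sup>+\<zeta>. ennreal ((cmod (g z - g (z * \<zeta>)))\<^sup>2 / (cmod (z - z * \<zeta>))\<^sup>2) \<partial>ucirc)"
      by (rule nn_integral_ucirc_rotate[symmetric, OF _ z]) measurable
    also have "\<dots> = (\<integral>\<^sup>+\<zeta>. ennreal ((cmod (g z - g (z * \<zeta>)))\<^sup>2 / (cmod (1 - \<zeta>))\<^sup>2) \<partial>ucirc)"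
    proof (rule nn_integral_cong)
      fix \<zeta>
      have "cmod (z - z * \<zeta>) = cmod z * cmod (1 - \<zeta>)"
        by (simp add: norm_mult[symmetric] algebra_simps)
      then show "ennreal ((cmod (g z - g (z * \<zeta>)))\<^sup>2 / (cmod (z - z * \<zeta>))\<^sup>2)
            = ennreal ((cmod (g z - g (z * \<zeta>)))\<^sup>2 / (cmod (1 - \<zeta>))\<^sup>2)" by (simp add: z)
    qed
    finally show "(\<integral>\<^sup>+w. ennreal ((cmod (g z - g w))\<^sup>2 / (cmod (z - w))\<^sup>2) \<partial>ucirc)
        = (\<integral>\<^sup>+\<zeta>. ennreal ((cmod (g z - g (z * \<zeta>)))\<^sup>2 / (cmod (1 - \<zeta>))\<^sup>2) \<partial>ucirc)" .
  qed
  also have "\<dots> = (\<integral>\<^sup>+\<zeta>. (\<integral>\<^sup>+z. ennreal ((cmod (g z - g (z * \<zeta>)))\<^sup>2 / (cmod (1 - \<zeta>))\<^sup>2) \<partial>ucirc) \<partial>ucirc)"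
    by (rule ucirc2.Fubini'[symmetric]) (simp add: split_beta')
  also have "\<dots> = (\<integral>\<^sup>+\<zeta>. (\<integral>\<^sup>+n. ennreal (2 * pi * (cmod (fco g n))\<^sup>2) *
        ennreal ((cmod (1 - \<zeta> powi n))\<^sup>2 / (cmod (1 - \<zeta>))\<^sup>2) \<partial>count_space UNIV) \<partial>ucirc)"
  proof (rule nn_integral_cong)
    fix \<zeta> :: complex assume "\<zeta> \<in> space ucirc"
    then have \<zeta>: "norm \<zeta> = 1" by simp
    note [measurable] = gz[OF \<zeta>]
    have "sq (\<lambda>z. g (\<zeta> * z)) = sq g"
      unfolding sq_def by (rule nn_integral_ucirc_rotate[OF _ \<zeta>, of "\<lambda>z. ennreal ((cmod (g z))\<^sup>2)"]) measurable
    then have fin2: "sq (\<lambda>z. - 1 * g (\<zeta> * z)) < \<infinity>"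
      using fin by (subst sq_cmult) auto
    have fd: "sq (\<lambda>z. g z - g (\<zeta> * z)) < \<infinity>"
      using order_le_less_trans[OF sq_add_le[of g "\<lambda>z. - 1 * g (\<zeta> * z)"]] fin fin2 by (auto simp: ennreal_mult_less_top)
    have ig: "integrable ucirc g" "integrable ucirc (\<lambda>z. g (\<zeta> * z))"
      using fin \<open>sq (\<lambda>z. g (\<zeta> * z)) = sq g\<close>
      by (auto intro!: integrable_of_sq(3) gz[OF \<zeta>])
    have co: "fco (\<lambda>z. g z - g (\<zeta> * z)) n = (1 - \<zeta> powi n) * fco g n" for n
      by (simp only: fco_diff[OF ig] fco_rotate[OF g \<zeta>] left_diff_distrib mult_1)
    have "(\<integral>\<^sup>+z. ennreal ((cmod (g z - g (z * \<zeta>)))\<^sup>2 / (cmod (1 - \<zeta>))\<^sup>2) \<partial>ucirc)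
        = (\<integral>\<^sup>+z. ennreal (1 / (cmod (1 - \<zeta>))\<^sup>2) * ennreal ((cmod (g z - g (\<zeta> * z)))\<^sup>2) \<partial>ucirc)"
      by (intro nn_integral_cong) (simp add: ennreal_mult[symmetric] mult.commute)
    also have "\<dots> = ennreal (1 / (cmod (1 - \<zeta>))\<^sup>2) * sq (\<lambda>z. g z - g (\<zeta> * z))"
      unfolding sq_def by (intro nn_integral_cmult) measurable
    also have "\<dots> = ennreal (1 / (cmod (1 - \<zeta>))\<^sup>2) *
         (\<integral>\<^sup>+n. ennreal (2 * pi * (cmod ((1 - \<zeta> powi n) * fco g n))\<^sup>2) \<partial>count_space UNIV)"
      by (subst parseval[OF _ fd]) (simp_all only: co, measurable)
    also have "\<dots> = (\<integral>\<^sup>+n. ennreal (2 * pi * (cmod (fco g n))\<^sup>2) *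
        ennreal ((cmod (1 - \<zeta> powi n))\<^sup>2 / (cmod (1 - \<zeta>))\<^sup>2) \<partial>count_space UNIV)"
      by (subst nn_integral_cmult[symmetric])
         (auto intro!: nn_integral_cong arg_cong[of _ _ ennreal] simp: ennreal_mult[symmetric] norm_mult power_mult_distrib)
    finally show "(\<integral>\<^sup>+z. ennreal ((cmod (g z - g (z * \<zeta>)))\<^sup>2 / (cmod (1 - \<zeta>))\<^sup>2) \<partial>ucirc)
      = (\<integral>\<^sup>+n. ennreal (2 * pi * (cmod (fco g n))\<^sup>2) *
        ennreal ((cmod (1 - \<zeta> powi n))\<^sup>2 / (cmod (1 - \<zeta>))\<^sup>2) \<partial>count_space UNIV)" .
  qed
  also have "\<dots> = (\<integral>\<^sup>+n. (\<integral>\<^sup>+\<zeta>. ennreal (2 * pi * (cmod (fco g n))\<^sup>2) *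
        ennreal ((cmod (1 - \<zeta> powi n))\<^sup>2 / (cmod (1 - \<zeta>))\<^sup>2) \<partial>ucirc) \<partial>count_space UNIV)"
    by (rule nn_integral_count_space_nn_integral) auto
  also have "\<dots> = (\<integral>\<^sup>+n. ennreal (4 * pi\<^sup>2 * \<bar>of_int n\<bar> * (cmod (fco g n))\<^sup>2) \<partial>count_space UNIV)"
  proof (rule nn_integral_cong)
    fix n :: int
    have "(\<integral>\<^sup>+\<zeta>. ennreal (2 * pi * (cmod (fco g n))\<^sup>2) *
        ennreal ((cmod (1 - \<zeta> powi n))\<^sup>2 / (cmod (1 - \<zeta>))\<^sup>2) \<partial>ucirc)
       = ennreal (2 * pi * (cmod (fco g n))\<^sup>2) * ennreal (2 * pi * \<bar>of_int n\<bar>)"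
      by (subst nn_integral_cmult) (simp_all only: nn_integral_fejer, measurable)
    also have "\<dots> = ennreal (4 * pi\<^sup>2 * \<bar>of_int n\<bar> * (cmod (fco g n))\<^sup>2)"
      by (simp add: ennreal_mult[symmetric] power2_eq_square mult_ac)
    finally show "(\<integral>\<^sup>+\<zeta>. ennreal (2 * pi * (cmod (fco g n))\<^sup>2) *
        ennreal ((cmod (1 - \<zeta> powi n))\<^sup>2 / (cmod (1 - \<zeta>))\<^sup>2) \<partial>ucirc)
       = ennreal (4 * pi\<^sup>2 * \<bar>of_int n\<bar> * (cmod (fco g n))\<^sup>2)" .
  qed
  finally show ?thesis .
qed

section \<open>The Hilbert transform on the circle\<close>

lemma finite_measure_ucirc_pair: "finite_measure (ucirc \<Otimes>\<^sub>M ucirc)"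
  by (intro finite_measure_pair_measure) unfold_locales

text \<open>For \<open>z = e\<^sup>i\<^sup>t\<close> and \<open>w = e\<^sup>i\<^sup>s\<close> the kernel \<open>(z + w) / (z - w)\<close> is \<open>- \<i> cot ((t - s) / 2)\<close>.
Subtracting \<open>g z\<close> makes the integral absolutely convergent for Lipschitz \<open>g\<close>.\<close>

definition hil :: "(complex \<Rightarrow> complex) \<Rightarrow> complex \<Rightarrow> complex" where
  "hil g z = (LINT w|ucirc. (z + w) / (z - w) * (g w - g z)) / of_real (2 * pi)"

definition circ_lipschitz :: "real \<Rightarrow> (complex \<Rightarrow> complex) \<Rightarrow> bool" where
  "circ_lipschitz L g \<longleftrightarrow> (\<forall>z w. norm z = 1 \<longrightarrow> norm w = 1 \<longrightarrow> cmod (g z - g w) \<le> L * cmod (z - w))"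

lemma circ_lipschitz_measurable:
  assumes "circ_lipschitz L g" shows "g \<in> borel_measurable ucirc"
proof -
  \<comment> \<open>\<open>lipschitz_on\<close> demands a nonnegative constant;
    \<open>circ_lipschitz\<close> does not state one.\<close>
  have "\<bar>L\<bar>-lipschitz_on (sphere 0 1) g"
  proof (rule lipschitz_onI)
    fix z w :: complex assume "z \<in> sphere 0 1" "w \<in> sphere 0 1"
    then have "dist (g z) (g w) \<le> L * dist z w"
      using assms by (simp add: circ_lipschitz_def dist_norm)
    also have "\<dots> \<le> \<bar>L\<bar> * dist z w" by (intro mult_right_mono) auto
    finally show "dist (g z) (g w) \<le> \<bar>L\<bar> * dist z w" .
  qed auto
  then show ?thesis by (intro measurable_ucirc_continuous lipschitz_on_continuous_on)
qed

text \<open>The Lipschitz bound cancels the simple pole, and cmod (z + w) \<le> 2. On the diagonal,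
  division by zero makes the kernel 0.\<close>

lemma hil_kernel_bound:
  assumes "circ_lipschitz L g" and z: "norm z = 1" and w: "norm w = 1"
  shows "cmod ((z + w) / (z - w) * (g w - g z)) \<le> 2 * \<bar>L\<bar>"
proof (cases "z = w")
  case False
  have "cmod (z + w) \<le> 2" using norm_triangle_ineq[of z w] z w by simp
  have "cmod (g w - g z) \<le> L * cmod (w - z)" using assms by (simp add: circ_lipschitz_def)
  also have "\<dots> \<le> \<bar>L\<bar> * cmod (z - w)" by (subst norm_minus_commute) (intro mult_right_mono, auto)
  finally have "cmod (z + w) * cmod (g w - g z) \<le> 2 * (\<bar>L\<bar> * cmod (z - w))"
    using \<open>cmod (z + w) \<le> 2\<close> by (intro mult_mono) auto
  then show ?thesis using False
    unfolding norm_mult norm_divide by (simp add: divide_le_eq mult_ac)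
qed simp

lemma hil_kernel_measurable:
  assumes [measurable]: "g \<in> borel_measurable ucirc"
  shows "(\<lambda>p. (fst p + snd p) / (fst p - snd p) * (g (snd p) - g (fst p))) \<in> borel_measurable (ucirc \<Otimes>\<^sub>M ucirc)"
  by measurable

lemma hil_measurable:
  assumes "g \<in> borel_measurable ucirc" shows "hil g \<in> borel_measurable ucirc"
  using ucirc.borel_measurable_lebesgue_integral[of "\<lambda>z w. (z + w) / (z - w) * (g w - g z)" ucirc]
    hil_kernel_measurable[OF assms] unfolding hil_def[abs_def] by (auto simp: split_beta')

lemma hil_kernel_integrable:
  assumes L: "circ_lipschitz L g" and "norm z = 1"
  shows "integrable ucirc (\<lambda>w. (z + w) / (z - w) * (g w - g z))"
proof (rule integrable_ucirc_bounded)
  note [measurable] = circ_lipschitz_measurable[OF L]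
  show "(\<lambda>w. (z + w) / (z - w) * (g w - g z)) \<in> borel_measurable ucirc" by measurable
qed (rule hil_kernel_bound[OF assms])

lemma hil_bound:
  assumes L: "circ_lipschitz L g" and z: "norm z = 1"
  shows "cmod (hil g z) \<le> 2 * \<bar>L\<bar>"
proof -
  have "cmod (LINT w|ucirc. (z + w) / (z - w) * (g w - g z)) \<le> (LINT w|ucirc. cmod ((z + w) / (z - w) * (g w - g z)))"
    by simp
  also have "\<dots> \<le> (LINT w|ucirc. 2 * \<bar>L\<bar>)"
    by (intro integral_mono integrable_norm hil_kernel_integrable[OF assms] hil_kernel_bound[OF assms]) auto
  finally show ?thesis by (simp add: hil_def norm_divide field_simps)
qed

lemma integral_hil_multiplier:
  "(LINT \<zeta>|ucirc. (1 + \<zeta>) / (1 - \<zeta>) * (\<zeta> powi n - 1)) = - of_int (sgn n) * of_real (2 * pi)"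
proof -
  define m where "m = nat \<bar>n\<bar>"
  \<comment> \<open>For n < 0 the power z^n is factored out, so that a geometric sum remains.
    Multiplying that sum by 1 + z gives two copies shifted by one, and together they contain the
    constant term exactly once: at k = 0 in the first copy if n > 0, at k = - n - 1 in the second if
    n < 0.\<close>
  define a where "a = (if n \<ge> 0 then 0 else n)"
  have "(LINT \<zeta>|ucirc. (1 + \<zeta>) / (1 - \<zeta>) * (\<zeta> powi n - 1))
     = (LINT \<zeta>|ucirc. - of_int (sgn n) * (\<Sum>k<m. \<zeta> powi (a + int k) + \<zeta> powi (a + int k + 1)))"
  proof (rule integral_cong_AE)
    show "AE \<zeta> in ucirc. (1 + \<zeta>) / (1 - \<zeta>) * (\<zeta> powi n - 1)
        = - of_int (sgn n) * (\<Sum>k<m. \<zeta> powi (a + int k) + \<zeta> powi (a + int k + 1))"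
      using AE_ucirc_neq[of 1] AE_space
    proof eventually_elim
      case (elim \<zeta>)
      then have "\<zeta> \<noteq> 0" by auto
      have s: "(\<Sum>k<m. \<zeta> powi (a + int k) + \<zeta> powi (a + int k + 1)) = (1 + \<zeta>) * \<zeta> powi a * (\<Sum>k<m. \<zeta> ^ k)"
        unfolding sum_distrib_left using \<open>\<zeta> \<noteq> 0\<close>
        by (intro sum.cong refl) (simp add: power_int_add algebra_simps)
      have "\<zeta> powi n - 1 = - of_int (sgn n) * \<zeta> powi a * (1 - \<zeta> ^ m)"
      proof (cases "n \<ge> 0")
        case True
        then have "\<zeta> powi n = \<zeta> ^ m" by (simp add: m_def power_int_def)
        then show ?thesis using True by (cases "n = 0") (auto simp: a_def m_def)
      next
        case False
        then have "\<zeta> powi n = inverse (\<zeta> ^ m)" by (simp add: m_def power_int_def power_inverse)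
        then show ?thesis using False \<open>\<zeta> \<noteq> 0\<close> by (simp add: a_def field_simps)
      qed
      also have "1 - \<zeta> ^ m = (1 - \<zeta>) * (\<Sum>k<m. \<zeta> ^ k)" by (rule one_diff_power_eq)
      finally show ?case using elim by (simp add: s)
    qed
  qed measurable
  also have "\<dots> = - of_int (sgn n) * (\<Sum>k<m. (LINT \<zeta>|ucirc. \<zeta> powi (a + int k)) + (LINT \<zeta>|ucirc. \<zeta> powi (a + int k + 1)))"
    by simp
  also have "(\<Sum>k<m. (LINT \<zeta>|ucirc. \<zeta> powi (a + int k)) + (LINT \<zeta>|ucirc. \<zeta> powi (a + int k + 1)))
     = (\<Sum>k<m. if int k = (if n \<ge> 0 then 0 else -n - 1) then of_real (2 * pi) else 0)"
    by (intro sum.cong) (auto simp: integral_ucirc_powi a_def m_def)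
  also have "\<dots> = (\<Sum>k<m. if k = nat (if n \<ge> 0 then 0 else -n - 1) then of_real (2 * pi) else 0)"
    by (intro sum.cong) auto
  also have "\<dots> = (if n = 0 then 0 else of_real (2 * pi))"
    by (subst sum.delta) (auto simp: m_def)
  finally show ?thesis by auto
qed

text \<open>With w = z \<zeta> the kernel depends on \<zeta> alone. The Lipschitz bound keeps the
  integrand bounded, so Fubini applies, and the inner integral is a coefficient of g(\<zeta> z) - g
  z; what is left is the multiplier integral.\<close>

lemma fco_hil:
  assumes L: "circ_lipschitz L g"
  shows "fco (hil g) n = - of_int (sgn n) * fco g n"
proof -
  have g[measurable]: "g \<in> borel_measurable ucirc" by (rule circ_lipschitz_measurable[OF L])
  have gm[measurable]: "(\<lambda>p. g (fst p * snd p)) \<in> borel_measurable (ucirc \<Otimes>\<^sub>M ucirc)"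
    by (rule measurable_compose[OF measurable_ucirc_mult g])
  have ig: "integrable ucirc g"
  proof (rule integrable_ucirc_bounded[OF g])
    fix z :: complex assume z: "norm z = 1"
    have "cmod (g z - g 1) \<le> L * cmod (z - 1)" using L z by (simp add: circ_lipschitz_def)
    also have "\<dots> \<le> \<bar>L\<bar> * 2"
      using norm_triangle_ineq4[of z 1] z by (intro mult_mono) auto
    finally show "cmod (g z) \<le> cmod (g 1) + \<bar>L\<bar> * 2"
      using norm_triangle_sub[of "g z" "g 1"] by simp
  qed
  define f where "f z \<zeta> = (1 + \<zeta>) / (1 - \<zeta>) * (g (z * \<zeta>) - g z) * z powi (- n)" for z \<zeta>
  have eq: "(z + z * \<zeta>) / (z - z * \<zeta>) = (1 + \<zeta>) / (1 - \<zeta>)" if "norm z = 1" for z \<zeta> :: complex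
  proof -
    have "z \<noteq> 0" using that by auto
    then show ?thesis using mult_divide_mult_cancel_left[of z "1 + \<zeta>" "1 - \<zeta>"] by (simp add: algebra_simps)
  qed
  have "of_real (2 * pi) * (of_real (2 * pi) * fco (hil g) n)
      = (LINT z|ucirc. (LINT w|ucirc. (z + w) / (z - w) * (g w - g z)) * z powi (- n))"
    by (simp add: fco_def hil_def)
  also have "\<dots> = (LINT z|ucirc. (LINT \<zeta>|ucirc. f z \<zeta>))"
  proof (rule Bochner_Integration.integral_cong[OF refl])
    fix z :: complex assume "z \<in> space ucirc"
    then have z: "norm z = 1" by simp
    have "(LINT w|ucirc. (z + w) / (z - w) * (g w - g z))
       = (LINT \<zeta>|ucirc. (z + z * \<zeta>) / (z - z * \<zeta>) * (g (z * \<zeta>) - g z))"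
      by (rule integral_ucirc_rotate[OF _ z, symmetric]) measurable
    then show "(LINT w|ucirc. (z + w) / (z - w) * (g w - g z)) * z powi (- n) = (LINT \<zeta>|ucirc. f z \<zeta>)"
      unfolding f_def by (simp only: eq[OF z] integral_mult_left_zero)
  qed
  also have "\<dots> = (LINT \<zeta>|ucirc. (LINT z|ucirc. f z \<zeta>))"
  proof (rule ucirc2.Fubini_integral[symmetric])
    interpret P: finite_measure "ucirc \<Otimes>\<^sub>M ucirc" by (rule finite_measure_ucirc_pair)
    have "AE p in ucirc \<Otimes>\<^sub>M ucirc. norm (f (fst p) (snd p)) \<le> 2 * \<bar>L\<bar>"
    proof (rule AE_I2)
      fix p assume "p \<in> space (ucirc \<Otimes>\<^sub>M ucirc)"
      then have p: "norm (fst p) = 1" "norm (snd p) = 1" by (auto simp: space_pair_measure)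
      have "cmod ((fst p + fst p * snd p) / (fst p - fst p * snd p) * (g (fst p * snd p) - g (fst p))) \<le> 2 * \<bar>L\<bar>"
        by (intro hil_kernel_bound[OF L]) (auto simp: p norm_mult)
      then show "norm (f (fst p) (snd p)) \<le> 2 * \<bar>L\<bar>"
        by (simp add: f_def eq[OF p(1)] p(1) norm_mult norm_power_int norm_divide)
    qed
    then show "integrable (ucirc \<Otimes>\<^sub>M ucirc) (case_prod f)"
      by (intro P.integrable_const_bound) (auto simp: split_beta' f_def)
  qed
  also have "\<dots> = (LINT \<zeta>|ucirc. (1 + \<zeta>) / (1 - \<zeta>) * (\<zeta> powi n - 1) * (of_real (2 * pi) * fco g n))"
  proof (rule Bochner_Integration.integral_cong[OF refl])
    fix \<zeta> :: complex assume "\<zeta> \<in> space ucirc"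
    then have \<zeta>: "norm \<zeta> = 1" by simp
    have "integrable ucirc (\<lambda>z. g (\<zeta> * z))"
    proof (rule integrable_ucirc_bounded[where B="cmod (g 1) + \<bar>L\<bar> * 2"])
      show "(\<lambda>z. g (\<zeta> * z)) \<in> borel_measurable ucirc"
        using \<zeta> by (intro measurable_compose[OF _ g] measurable_into_ucirc) (auto simp: norm_mult)
      fix z :: complex assume "norm z = 1"
      then have z: "norm (\<zeta> * z) = 1" using \<zeta> by (simp add: norm_mult)
      have "cmod (g (\<zeta> * z) - g 1) \<le> L * cmod (\<zeta> * z - 1)" using L z by (simp add: circ_lipschitz_def)
      also have "\<dots> \<le> \<bar>L\<bar> * 2"
        using norm_triangle_ineq4[of "\<zeta> * z" 1] z by (intro mult_mono) auto
      finally show "cmod (g (\<zeta> * z)) \<le> cmod (g 1) + \<bar>L\<bar> * 2"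
        using norm_triangle_sub[of "g (\<zeta> * z)" "g 1"] by simp
    qed
    then have d: "fco (\<lambda>z. g (\<zeta> * z) - g z) n = (\<zeta> powi n - 1) * fco g n"
      using ig by (simp only: fco_diff fco_rotate[OF g \<zeta>] left_diff_distrib mult_1)
    have "(LINT z|ucirc. f z \<zeta>) = (1 + \<zeta>) / (1 - \<zeta>) * (LINT z|ucirc. (g (\<zeta> * z) - g z) * z powi (- n))"
      by (subst integral_mult_right_zero[symmetric]) (simp add: f_def mult.assoc mult.commute[of \<zeta>])
    then show "(LINT z|ucirc. f z \<zeta>) = (1 + \<zeta>) / (1 - \<zeta>) * (\<zeta> powi n - 1) * (of_real (2 * pi) * fco g n)"
      unfolding integral_fco d by (simp only: mult_ac)
  qed
  also have "\<dots> = (- of_int (sgn n) * of_real (2 * pi)) * (of_real (2 * pi) * fco g n)"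
    by (subst integral_mult_left_zero) (simp only: integral_hil_multiplier)
  also have "\<dots> = of_real (2 * pi) * (of_real (2 * pi) * (- of_int (sgn n) * fco g n))"
    by (simp only: mult_ac)
  finally show ?thesis
    by (simp only: mult_cancel_left of_real_eq_0_iff) (use pi_gt_zero in simp)
qed

section \<open>Truncated kernels and principal values\<close>

lemma measurable_far [measurable]:
  "(\<lambda>w. (indicator {w. \<epsilon> < r * cmod (z - w)} w :: real)) \<in> borel_measurable ucirc"
  by (rule borel_measurable_indicator') measurable

text \<open>For an integrable function truncation is harmless by dominated convergence. The factor
  \<open>r\<close> is there because the cut-off distance is measured on the original circle, while
  integration runs over the unit circle.\<close>

lemma integral_far_tendsto:
  fixes h :: "complex \<Rightarrow> 'a::{banach, second_countable_topology}"
  assumes h: "integrable ucirc h" and "r > 0"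
  shows "((\<lambda>\<epsilon>. LINT w|ucirc. indicator {w. \<epsilon> < r * cmod (z - w)} w *\<^sub>R h w) \<longlongrightarrow> (LINT w|ucirc. h w)) (at_right 0)"
proof (rule tendsto_at_right_sequentially[where b=1])
  fix S :: "nat \<Rightarrow> real" assume S: "\<And>n. 0 < S n" "S \<longlonglongrightarrow> 0"
  note [measurable] = borel_measurable_integrable[OF h]
  show "(\<lambda>n. LINT w|ucirc. indicator {w. S n < r * cmod (z - w)} w *\<^sub>R h w) \<longlonglongrightarrow> (LINT w|ucirc. h w)"
  proof (rule integral_dominated_convergence[where w="\<lambda>w. norm (h w)"])
    show "AE w in ucirc. (\<lambda>n. indicator {w. S n < r * cmod (z - w)} w *\<^sub>R h w) \<longlonglongrightarrow> h w"
      using AE_ucirc_neq[of z]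
    proof eventually_elim
      case (elim w)
      then have "0 < r * cmod (z - w)" using \<open>r > 0\<close> by auto
      then have "eventually (\<lambda>n. S n < r * cmod (z - w)) sequentially"
        by (rule order_tendstoD(2)[OF S(2)])
      then have "eventually (\<lambda>n. indicator {w. S n < r * cmod (z - w)} w *\<^sub>R h w = h w) sequentially"
        by eventually_elim simp
      then show ?case by (rule tendsto_eventually)
    qed
    show "AE w in ucirc. norm (indicator {w. S n < r * cmod (z - w)} w *\<^sub>R h w) \<le> norm (h w)" for n
      by (intro AE_I2) (auto split: split_indicator)
    show "(\<lambda>w. indicator {w. S n < r * cmod (z - w)} w *\<^sub>R h w) \<in> borel_measurable ucirc" for n
      by measurable
  qed (use h in auto)
qed simp

lemma far_kernel_bound:
  assumes z: "norm z = 1" and w: "norm w = 1" and "\<epsilon> > 0" and "r > 0"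
  shows "cmod (indicator {w. \<epsilon> < r * cmod (z - w)} w *\<^sub>R ((z + w) / (z - w))) \<le> 2 * r / \<epsilon>"
proof -
  have "cmod (z + w) \<le> 2" using norm_triangle_ineq[of z w] z w by simp
  have "cmod ((z + w) / (z - w)) \<le> 2 * r / \<epsilon>" if e: "\<epsilon> < r * cmod (z - w)"
  proof -
    have "0 < r * cmod (z - w)" using \<open>\<epsilon> > 0\<close> e by linarith
    then have "cmod (z - w) > 0" using \<open>r > 0\<close> by (simp add: zero_less_mult_iff)
    have "cmod (z + w) * \<epsilon> \<le> 2 * (r * cmod (z - w))"
      using e \<open>\<epsilon> > 0\<close> \<open>cmod (z + w) \<le> 2\<close> by (intro mult_mono) auto
    then show ?thesis using \<open>cmod (z - w) > 0\<close> \<open>\<epsilon> > 0\<close> by (simp add: norm_divide field_simps)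
  qed
  then show ?thesis using assms by (auto split: split_indicator)
qed

lemma integrable_far_kernel:
  assumes g: "integrable ucirc g" and "norm z = 1" and "\<epsilon> > 0" and "r > 0"
  shows "integrable ucirc (\<lambda>w. indicator {w. \<epsilon> < r * cmod (z - w)} w *\<^sub>R ((z + w) / (z - w) * g w))"
proof -
  have "integrable ucirc (\<lambda>w. g w * (indicator {w. \<epsilon> < r * cmod (z - w)} w *\<^sub>R ((z + w) / (z - w))))"
    by (rule integrable_ucirc_times_bounded[OF g _ far_kernel_bound[OF assms(2) _ assms(3,4)]]) measurable
  then show ?thesis by (simp add: mult.commute[of "g _"])
qed

text \<open>The reflection \<open>w \<mapsto> z\<^sup>2 / w\<close> of the circle fixes \<open>\<bar>z - w\<bar>\<close> and reverses the sign of the kernel.\<close>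

lemma integral_far_kernel:
  assumes z: "norm z = 1" and "\<epsilon> > 0"
  shows "(LINT w|ucirc. indicator {w. \<epsilon> < r * cmod (z - w)} w *\<^sub>R ((z + w) / (z - w))) = 0"
proof -
  define k where "k w = indicator {w. \<epsilon> < r * cmod (z - w)} w *\<^sub>R ((z + w) / (z - w))" for w
  have k[measurable]: "k \<in> borel_measurable ucirc" unfolding k_def[abs_def] by measurable
  have z2: "norm (z * z) = 1" using z by (simp add: norm_mult)
  have k2: "(\<lambda>w. k (z * z * w)) \<in> borel_measurable ucirc"
    using z2 by (intro measurable_compose[OF _ k] measurable_into_ucirc) (auto simp: norm_mult)
  have k_refl: "k (z * z * cnj w) = - k w" if w: "norm w = 1" for w
  proof -
    have ww: "cnj w = inverse w" using cnj_powi_unit[OF w, of 1] by (simp add: power_int_minus)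
    have nz: "z \<noteq> 0" "w \<noteq> 0" using z w by auto
    have d: "z - z * z * cnj w = (w - z) * (z / w)" using nz by (simp add: ww field_simps)
    have s: "z + z * z * cnj w = (w + z) * (z / w)" using nz by (simp add: ww field_simps)
    have "cmod (z / w) = 1" using z w by (simp add: norm_divide)
    then have n: "cmod (z - z * z * cnj w) = cmod (z - w)"
      unfolding d norm_mult by (simp add: norm_minus_commute)
    have "z / w \<noteq> 0" using nz by simp
    then have "(z + z * z * cnj w) / (z - z * z * cnj w) = (w + z) / (w - z)"
      unfolding d s by (rule mult_divide_mult_cancel_right)
    also have "\<dots> = - ((z + w) / (z - w))"
      using minus_divide_right[of "z + w" "z - w"] by (simp add: add.commute)
    finally show ?thesis by (simp add: k_def indicator_def n)
  qed
  have "(LINT w|ucirc. k w) = (LINT w|ucirc. k (z * z * w))"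
    using z2 by (simp add: integral_ucirc_rotate)
  also have "\<dots> = (LINT w|ucirc. k (z * z * cnj w))"
    by (rule integral_ucirc_cnj[OF k2, symmetric])
  also have "\<dots> = (LINT w|ucirc. - k w)"
    by (intro Bochner_Integration.integral_cong refl) (simp add: k_refl)
  finally show ?thesis by (simp add: k_def)
qed

text \<open>The truncated kernel integrates to zero, so subtracting g z changes no truncated
  integral; the difference g w - g z then makes the limit an absolutely convergent integral.\<close>

lemma hil_principal_value:
  assumes L: "circ_lipschitz L g" and z: "norm z = 1" and "r > 0"
  shows "((\<lambda>\<epsilon>. LINT w|ucirc. indicator {w. \<epsilon> < r * cmod (z - w)} w *\<^sub>R ((z + w) / (z - w) * g w))
    \<longlongrightarrow> of_real (2 * pi) * hil g z) (at_right 0)"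
proof -
  have [measurable]: "g \<in> borel_measurable ucirc" by (rule circ_lipschitz_measurable[OF L])
  have "((\<lambda>\<epsilon>. LINT w|ucirc. indicator {w. \<epsilon> < r * cmod (z - w)} w *\<^sub>R ((z + w) / (z - w) * (g w - g z)))
    \<longlongrightarrow> of_real (2 * pi) * hil g z) (at_right 0)"
    using integral_far_tendsto[OF hil_kernel_integrable[OF L z] \<open>r > 0\<close>] by (simp add: hil_def)
  then show ?thesis
  proof (rule tendsto_cong[THEN iffD1, rotated])
    have "eventually (\<lambda>\<epsilon>. \<epsilon> > (0::real)) (at_right 0)" by (simp add: eventually_at_right_less)
    then show "\<forall>\<^sub>F \<epsilon> in at_right 0. (LINT w|ucirc. indicator {w. \<epsilon> < r * cmod (z - w)} w *\<^sub>R ((z + w) / (z - w) * (g w - g z)))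
       = (LINT w|ucirc. indicator {w. \<epsilon> < r * cmod (z - w)} w *\<^sub>R ((z + w) / (z - w) * g w))"
    proof eventually_elim
      case (elim \<epsilon>)
      have "integrable ucirc (\<lambda>w. indicator {w. \<epsilon> < r * cmod (z - w)} w *\<^sub>R ((z + w) / (z - w) * (g w - g z)))"
        by (rule Bochner_Integration.integrable_bound[OF hil_kernel_integrable[OF L z]])
           (auto split: split_indicator)
      moreover have "integrable ucirc (\<lambda>w. indicator {w. \<epsilon> < r * cmod (z - w)} w *\<^sub>R ((z + w) / (z - w)))"
        using integrable_far_kernel[of "\<lambda>_. 1", OF _ z elim \<open>r > 0\<close>] by simp
      ultimately have "(LINT w|ucirc. indicator {w. \<epsilon> < r * cmod (z - w)} w *\<^sub>R ((z + w) / (z - w) * (g w - g z))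
           + g z * (indicator {w. \<epsilon> < r * cmod (z - w)} w *\<^sub>R ((z + w) / (z - w))))
        = (LINT w|ucirc. indicator {w. \<epsilon> < r * cmod (z - w)} w *\<^sub>R ((z + w) / (z - w) * (g w - g z)))
          + g z * (LINT w|ucirc. indicator {w. \<epsilon> < r * cmod (z - w)} w *\<^sub>R ((z + w) / (z - w)))"
        by (simp only: Bochner_Integration.integral_add integrable_mult_right integral_mult_right_zero)
      moreover have "i *\<^sub>R (k * (a - b)) + b * (i *\<^sub>R k) = i *\<^sub>R (k * a)" for i :: real and k a b :: complex
        by (simp add: scaleR_conv_of_real algebra_simps)
      ultimately show ?case
        unfolding integral_far_kernel[OF z elim] by (simp only: mult_zero_right add_0_right)
    qed
  qed
qed

section \<open>The conormal derivative of the Kelvin matrix\<close>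

text \<open>Covers the origin too, where both sides are 0, so that it can rewrite under the binder
  of a function to be differentiated; the square root disappears from the derivative.\<close>

lemma ln_norm_vec2: "ln (norm (w::real^2)) = ln ((w$1)\<^sup>2 + (w$2)\<^sup>2) / 2"
proof (cases "(w$1)\<^sup>2 + (w$2)\<^sup>2 > 0")
  case True
  then show ?thesis by (simp add: norm_vec_def L2_set_def sum_2 ln_sqrt)
next
  case False
  then have "(w$1)\<^sup>2 + (w$2)\<^sup>2 = 0" using sum_power2_ge_zero[of "w$1" "w$2"] by linarith
  then show ?thesis by (simp add: norm_vec_def L2_set_def sum_2)
qed

lemma norm_vec2_sq: "(norm (w::real^2))\<^sup>2 = (w$1)\<^sup>2 + (w$2)\<^sup>2"
  by (simp add: norm_vec_def L2_set_def sum_2)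

lemma has_derivative_ln_norm_vec2:
  fixes x y :: "real^2"
  assumes "x \<noteq> y"
  shows "((\<lambda>z. ln (norm (z - y))) has_derivative (\<lambda>h. ((x - y) \<bullet> h) / (norm (x - y))\<^sup>2)) (at x)"
proof -
  have ne: "x$1 \<noteq> y$1 \<or> x$2 \<noteq> y$2" using assms by (auto simp: vec_eq_iff forall_2)
  have "(norm (x - y))\<^sup>2 > 0" using assms by simp
  then have pos: "(x$1 - y$1)\<^sup>2 + (x$2 - y$2)\<^sup>2 > 0" by (simp add: norm_vec2_sq)
  show ?thesis
    unfolding ln_norm_vec2 norm_vec2_sq using pos ne
    by (auto intro!: derivative_eq_intros bounded_linear.has_derivative[OF bounded_linear_vec_nth]
        simp: inner_vec_def sum_2 field_simps)
qed

lemma has_derivative_quotient_vec2: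
  fixes x y :: "real^2"
  assumes "x \<noteq> y"
  shows "((\<lambda>z. (z - y) $ i * (z - y) $ j / (norm (z - y))\<^sup>2) has_derivative
     (\<lambda>h. (h $ i * (x - y) $ j + (x - y) $ i * h $ j) / (norm (x - y))\<^sup>2
        - 2 * (x - y) $ i * (x - y) $ j * ((x - y) \<bullet> h) / (norm (x - y))^4)) (at x)"
proof -
  have vn: "((\<lambda>z. (z - y) $ k) has_derivative (\<lambda>h. h $ k)) (at x)" for k
    by (auto intro!: derivative_eq_intros bounded_linear.has_derivative[OF bounded_linear_vec_nth])
  have num: "((\<lambda>z. (z - y) $ i * (z - y) $ j) has_derivative (\<lambda>h. h $ i * (x - y) $ j + (x - y) $ i * h $ j)) (at x)"
    by (rule has_derivative_eq_rhs[OF has_derivative_mult[OF vn vn]]) (simp add: fun_eq_iff)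
  have den: "((\<lambda>z. (norm (z - y))\<^sup>2) has_derivative (\<lambda>h. 2 * ((x - y) \<bullet> h))) (at x)"
    unfolding dot_square_norm[symmetric]
    by (auto intro!: derivative_eq_intros simp: inner_commute)
  have ne: "(norm (x - y))\<^sup>2 \<noteq> 0" using assms by simp
  have 4: "(norm (x - y))^4 = (norm (x - y))\<^sup>2 * (norm (x - y))\<^sup>2" by (simp flip: power_add)
  show ?thesis
    by (rule has_derivative_eq_rhs[OF has_derivative_divide[OF num den ne]])
       (simp only: 4 fun_eq_iff divide_inverse inverse_mult_distrib mult_minus_left uminus_add_conv_diff, simp only: mult_ac simp_thms)
qed

text \<open>Here \<open>\<alpha>1\<close> and \<open>\<alpha>2\<close> absorb the factor 1 / (2 pi)
  of the Kelvin matrix.\<close>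

lemma partial_kelvin_apply:
  fixes x y :: "real^2" and lam mu :: real
  assumes "x \<noteq> y"
  defines "w \<equiv> x - y"
  defines "\<alpha>1 \<equiv> (1 / mu + 1 / (2 * mu + lam)) / 2 / (2 * pi)"
  defines "\<alpha>2 \<equiv> (1 / mu - 1 / (2 * mu + lam)) / 2 / (2 * pi)"
  shows "partial (\<lambda>z. kelvin_apply lam mu (z - y) b) x i j
    = (\<Sum>k\<in>UNIV. of_real (\<alpha>1 * (if i = k then 1 else 0) * w $ j / (norm w)\<^sup>2
        - \<alpha>2 * (((if i = j then w $ k else 0) + (if k = j then w $ i else 0)) / (norm w)\<^sup>2
              - 2 * w $ i * w $ k * w $ j / (norm w)^4)) * b $ k)"
proof -
  define D where "D i k h = \<alpha>1 * (if i = k then 1 else 0) * ((w \<bullet> h) / (norm w)\<^sup>2)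
     - \<alpha>2 * ((h $ i * w $ k + w $ i * h $ k) / (norm w)\<^sup>2 - 2 * w $ i * w $ k * (w \<bullet> h) / (norm w)^4)" for i k h
  have G: "((\<lambda>z. kelvin lam mu (z - y) $ i $ k) has_derivative D i k) (at x)" for i k
  proof -
    have "((\<lambda>z. \<alpha>1 * (if i = k then 1 else 0) * ln (norm (z - y)) - \<alpha>2 * ((z - y) $ i * (z - y) $ k / (norm (z - y))\<^sup>2))
       has_derivative D i k) (at x)"
      unfolding D_def[abs_def] w_def
      by (intro has_derivative_diff has_derivative_mult_right has_derivative_ln_norm_vec2
          has_derivative_quotient_vec2 assms(1))
    moreover have "kelvin lam mu v $ i $ k = \<alpha>1 * (if i = k then 1 else 0) * ln (norm v) - \<alpha>2 * (v $ i * v $ k / (norm v)\<^sup>2)" for v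
      by (simp only: kelvin_def Let_def vec_lambda_beta \<alpha>1_def \<alpha>2_def times_divide_eq_right)
    ultimately show ?thesis by simp
  qed
  \<comment> \<open>Real matrix entries times fixed complex vectors: only real-valued functions have
    to be differentiated.\<close>
  have u: "(\<lambda>z. kelvin_apply lam mu (z - y) b) = (\<lambda>z. \<Sum>i\<in>UNIV. \<Sum>k\<in>UNIV. (kelvin lam mu (z - y) $ i $ k) *\<^sub>R axis i (b $ k))"
    by (auto simp: fun_eq_iff kelvin_apply_def vec_eq_iff sum_2 forall_2 axis_def scaleR_conv_of_real[where 'a=complex])
  have "((\<lambda>z. kelvin_apply lam mu (z - y) b) has_derivative
      (\<lambda>h. \<Sum>i\<in>UNIV. \<Sum>k\<in>UNIV. D i k h *\<^sub>R axis i (b $ k))) (at x)"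
    unfolding u by (intro has_derivative_sum has_derivative_scaleR_left G)
  note fd = frechet_derivative_at[OF this, symmetric]
  have ia: "w \<bullet> axis j 1 = w $ j" by (simp add: inner_axis)
  have ax: "axis j (1::real) $ k = (if k = j then 1 else 0)" for k by (simp add: axis_def)
  have "partial (\<lambda>z. kelvin_apply lam mu (z - y) b) x i j = (\<Sum>i'\<in>UNIV. \<Sum>k\<in>UNIV. D i' k (axis j 1) *\<^sub>R axis i' (b $ k)) $ i"
    unfolding partial_def fd ..
  also have "\<dots> = (\<Sum>k\<in>UNIV. of_real (D i k (axis j 1)) * b $ k)"
    using exhaust_2[of i] by (elim disjE; simp add: sum_2 axis_def[of _ "b $ _"] scaleR_conv_of_real[where 'a=complex])
  also have "\<dots> = (\<Sum>k\<in>UNIV. of_real (\<alpha>1 * (if i = k then 1 else 0) * w $ j / (norm w)\<^sup>2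
        - \<alpha>2 * (((if i = j then w $ k else 0) + (if k = j then w $ i else 0)) / (norm w)\<^sup>2
              - 2 * w $ i * w $ k * w $ j / (norm w)^4)) * b $ k)"
    by (intro sum.cong refl arg_cong2[of _ _ _ _ times] arg_cong[of _ _ of_real])
       (simp only: D_def ia ax, auto)
  finally show ?thesis .
qed

text \<open>The traction of the Kelvin solution. Two constants suffice because of \<open>c2\<close>:
  the trace term and the symmetric gradient combine on \<open>n $ i\<close> to minus the coefficient
  in front of the two other terms. This holds for the given \<alpha>1 and \<alpha>2 since mu times
  1/mu and 2 mu + lam times its inverse are both 1; \<open>c1\<close> and \<open>c3\<close> then
  identify the constants as \<open>k0\<close> / pi and \<open>kap\<close> / pi.\<close>

lemma conormal_kelvin_apply:
  fixes x y n :: "real^2" and b :: "complex^2" and lam mu :: real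
  assumes "x \<noteq> y" and "mu > 0" and "2 * mu + lam > 0"
  defines "w \<equiv> x - y"
  defines "k0 \<equiv> mu / (2 * (2 * mu + lam))" and "kap \<equiv> (mu + lam) / (2 * mu + lam)"
  defines "bw \<equiv> b$1 * of_real (w$1) + b$2 * of_real (w$2)"
  defines "bn \<equiv> b$1 * of_real (n$1) + b$2 * of_real (n$2)"
  defines "wn \<equiv> w$1 * n$1 + w$2 * n$2"
  shows "conormal lam mu n (\<lambda>z. kelvin_apply lam mu (z - y) b) x $ i
    = of_real (k0 / pi) * (b $ i * of_real wn + of_real (w $ i) * bn - of_real (n $ i) * bw) / of_real ((norm w)\<^sup>2)
     + of_real (kap / pi) * of_real (w $ i) * of_real wn * bw / of_real ((norm w)^4)"
proof -
  define \<alpha>1 where "\<alpha>1 = (1 / mu + 1 / (2 * mu + lam)) / 2 / (2 * pi)"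
  define \<alpha>2 where "\<alpha>2 = (1 / mu - 1 / (2 * mu + lam)) / 2 / (2 * pi)"
  \<comment> \<open>Inverses are kept as atoms, here \<open>v\<close> and below \<open>p\<close> and
    \<open>q\<close>, so that the identities become polynomial modulo the relations
    \<open>wv\<close> and \<open>pq\<close>.\<close>
  define v where "v = complex_of_real (inverse ((norm w)\<^sup>2))"
  have N: "(norm w)\<^sup>2 > 0" using assms(1) by (simp add: w_def)
  have wv: "((of_real (w$1))\<^sup>2 + (of_real (w$2))\<^sup>2) * v = 1"
  proof -
    have "((w$1)\<^sup>2 + (w$2)\<^sup>2) * inverse ((norm w)\<^sup>2) = 1"
      using N by (simp add: norm_vec2_sq[symmetric])
    from arg_cong[OF this, of complex_of_real] show ?thesis by (simp add: v_def)
  qed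
  have v1: "of_real (a / (norm w)\<^sup>2) = of_real a * v" for a by (simp add: v_def field_simps)
  have v2: "of_real (a / (norm w)^4) = of_real a * v\<^sup>2" for a
    by (simp add: v_def field_simps flip: power_mult)
  define p q where "p = 1 / mu" and "q = 1 / (2 * mu + lam)"
  have pq: "mu * p = 1" "(2 * mu + lam) * q = 1" using assms(2,3) by (auto simp: p_def q_def)
  have \<alpha>: "\<alpha>1 = (p + q) / (4 * pi)" "\<alpha>2 = (p - q) / (4 * pi)"
    by (simp_all add: \<alpha>1_def \<alpha>2_def p_def q_def)
  have k: "k0 = mu * q / 2" "kap = (mu + lam) * q"
    by (simp_all add: k0_def kap_def q_def)
  have c1: "of_real k0 / of_real pi = of_real mu * (of_real \<alpha>1 - complex_of_real \<alpha>2)"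
  proof -
    have "k0 / pi = mu * (\<alpha>1 - \<alpha>2)" by (simp add: \<alpha> k field_simps)
    from arg_cong[OF this, of complex_of_real] show ?thesis by simp
  qed
  have c2: "of_real lam * (of_real \<alpha>1 - of_real \<alpha>2) - 2 * of_real mu * of_real \<alpha>2 = - (of_real mu * (of_real \<alpha>1 - complex_of_real \<alpha>2))"
  proof -
    have "(lam * (\<alpha>1 - \<alpha>2) - 2 * mu * \<alpha>2 + mu * (\<alpha>1 - \<alpha>2)) * (2 * pi) = (2 * mu + lam) * q - mu * p"
      by (simp add: \<alpha> field_simps)
    then have "lam * (\<alpha>1 - \<alpha>2) - 2 * mu * \<alpha>2 = - (mu * (\<alpha>1 - \<alpha>2))"
      using pq by simp
    from arg_cong[OF this, of complex_of_real] show ?thesis by simp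
  qed
  have c3: "of_real kap / of_real pi = 4 * of_real mu * complex_of_real \<alpha>2"
  proof -
    have "kap = mu * p - mu * q" using pq by (simp add: k algebra_simps)
    then have "kap / pi = 4 * mu * \<alpha>2" by (simp add: \<alpha> field_simps)
    from arg_cong[OF this, of complex_of_real] show ?thesis by simp
  qed
  have P: "partial (\<lambda>z. kelvin_apply lam mu (z - y) b) x i j
    = (\<Sum>k\<in>UNIV. (of_real \<alpha>1 * (if i = k then 1 else 0) * of_real (w $ j) * v
        - of_real \<alpha>2 * (((if i = j then of_real (w $ k) else 0) + (if k = j then of_real (w $ i) else 0)) * v
              - 2 * of_real (w $ i) * of_real (w $ k) * of_real (w $ j) * v\<^sup>2)) * b $ k)" for i j
    unfolding partial_kelvin_apply[OF assms(1)] \<alpha>1_def[symmetric] \<alpha>2_def[symmetric] w_def[symmetric]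
    by (intro sum.cong refl) (simp only: of_real_diff of_real_mult v1 v2, auto)
  have i: "i = 1 \<or> i = 2" by (rule exhaust_2)
  have R: "of_real (k0 / pi) * (b $ i * of_real wn + of_real (w $ i) * bn - of_real (n $ i) * bw) / of_real ((norm w)\<^sup>2)
     + of_real (kap / pi) * of_real (w $ i) * of_real wn * bw / of_real ((norm w)^4)
    = (of_real k0 / of_real pi) * (b $ i * of_real wn + of_real (w $ i) * bn - of_real (n $ i) * bw) * v
     + (of_real kap / of_real pi) * of_real (w $ i) * of_real wn * bw * v\<^sup>2"
    by (simp add: v_def divide_inverse power_inverse[symmetric] flip: power_mult)
  let ?A = "complex_of_real \<alpha>1" and ?B = "complex_of_real \<alpha>2" and ?l = "complex_of_real lam" and ?m = "complex_of_real mu"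
  have div: "(\<Sum>j\<in>UNIV. partial (\<lambda>z. kelvin_apply lam mu (z - y) b) x j j) = (?A - ?B) * bw * v"
  proof -
    have "(\<Sum>j\<in>UNIV. partial (\<lambda>z. kelvin_apply lam mu (z - y) b) x j j)
      = ?A * bw * v - ?B * (3 * bw * v - 2 * bw * v * (((of_real (w$1))\<^sup>2 + (of_real (w$2))\<^sup>2) * v))"
      by (simp add: P sum_2 bw_def power2_eq_square algebra_simps)
    also have "\<dots> = (?A - ?B) * bw * v" by (simp only: wv) (simp add: algebra_simps)
    finally show ?thesis .
  qed
  have sym: "(\<Sum>j\<in>UNIV. (partial (\<lambda>z. kelvin_apply lam mu (z - y) b) x i j
        + partial (\<lambda>z. kelvin_apply lam mu (z - y) b) x j i) * of_real (n $ j))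
      = (?A - ?B) * (b $ i * of_real wn + of_real (w $ i) * bn) * v - 2 * ?B * of_real (n $ i) * bw * v
         + 4 * ?B * of_real (w $ i) * of_real wn * bw * v\<^sup>2"
    using i by (elim disjE; simp add: P sum_2 bw_def bn_def wn_def; simp add: power2_eq_square algebra_simps)
  have "conormal lam mu n (\<lambda>z. kelvin_apply lam mu (z - y) b) x $ i
     = ?l * ((?A - ?B) * bw * v) * of_real (n $ i) + ?m * (\<Sum>j\<in>UNIV. (partial (\<lambda>z. kelvin_apply lam mu (z - y) b) x i j
        + partial (\<lambda>z. kelvin_apply lam mu (z - y) b) x j i) * of_real (n $ j))"
    by (simp only: conormal_def vec_lambda_beta div) (simp add: sum_distrib_left)
  also have "\<dots> = (?l * (?A - ?B) - 2 * ?m * ?B) * (of_real (n $ i) * bw * v)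
     + ?m * (?A - ?B) * (b $ i * of_real wn + of_real (w $ i) * bn) * v
     + 4 * ?m * ?B * of_real (w $ i) * of_real wn * bw * v\<^sup>2"
    unfolding sym by (simp add: algebra_simps)
  also have "\<dots> = ?m * (?A - ?B) * (b $ i * of_real wn + of_real (w $ i) * bn - of_real (n $ i) * bw) * v
     + 4 * ?m * ?B * of_real (w $ i) * of_real wn * bw * v\<^sup>2"
    unfolding c2 by (simp add: algebra_simps)
  finally show ?thesis unfolding R c1 c3 .
qed

section \<open>The circle in complex coordinates\<close>

text \<open>In the coordinates \<open>b\<^sub>1 \<plusminus> \<i> b\<^sub>2\<close> of \<open>\<complex>\<^sup>2\<close> a rotation acts by scalars and a reflection
  interchanges the two coordinates up to scalars.\<close>

definition bp :: "complex^2 \<Rightarrow> complex" where "bp b = b $ 1 + \<i> * b $ 2"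
definition bm :: "complex^2 \<Rightarrow> complex" where "bm b = b $ 1 - \<i> * b $ 2"
definition mk2 :: "complex \<Rightarrow> complex \<Rightarrow> complex^2" where
  "mk2 a d = (\<chi> i. if i = 1 then (a + d) / 2 else (a - d) / (2 * \<i>))"

lemma bp_mk2 [simp]: "bp (mk2 a d) = a" and bm_mk2 [simp]: "bm (mk2 a d) = d"
  by (simp_all add: bp_def bm_def mk2_def field_simps)

lemma mk2_bp_bm [simp]: "mk2 (bp b) (bm b) = b"
  by (simp add: bp_def bm_def mk2_def vec_eq_iff forall_2)

lemma vec2_components: "b $ 1 = (bp b + bm b) / 2" "b $ 2 = (bp b - bm b) / (2 * \<i>)"
  by (simp_all add: bp_def bm_def)

lemma norm_complex2: "(norm (b :: complex^2))\<^sup>2 = ((cmod (bp b))\<^sup>2 + (cmod (bm b))\<^sup>2) / 2"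
proof -
  have "(norm b)\<^sup>2 = (cmod (b$1))\<^sup>2 + (cmod (b$2))\<^sup>2"
    by (simp add: norm_vec_def L2_set_def sum_2)
  then show ?thesis
    unfolding cmod_power2 by (simp add: bp_def bm_def power2_eq_square algebra_simps)
qed

lemma mk2_scaleR: "c *\<^sub>R mk2 a d = mk2 (c *\<^sub>R a) (c *\<^sub>R d)"
  by (simp add: mk2_def vec_eq_iff scaleR_conv_of_real[where 'a=complex] algebra_simps)

text \<open>Splitting \<open>mk2\<close> into two bounded linear maps carries measurability,
  integrals and limits over from complex to vector values.\<close>

lemma bounded_linear_mk2_left: "bounded_linear (\<lambda>a. mk2 a 0)"
  and bounded_linear_mk2_right: "bounded_linear (\<lambda>d. mk2 0 d)"
proof -
  have n: "norm (mk2 a 0) \<le> norm a * 1" "norm (mk2 0 a) \<le> norm a * 1" for a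
    by (rule power2_le_imp_le; simp add: norm_complex2)+
  show "bounded_linear (\<lambda>a. mk2 a 0)"
    by (rule bounded_linear_intro[where K=1, OF _ _ n(1)]) (auto simp: mk2_def vec_eq_iff scaleR_conv_of_real[where 'a=complex] field_simps)
  show "bounded_linear (\<lambda>d. mk2 0 d)"
    by (rule bounded_linear_intro[where K=1, OF _ _ n(2)]) (auto simp: mk2_def vec_eq_iff scaleR_conv_of_real[where 'a=complex] field_simps)
qed

lemma mk2_split: "mk2 a d = mk2 a 0 + mk2 0 d"
  by (simp add: mk2_def vec_eq_iff field_simps)

lemma bounded_linear_bp: "bounded_linear bp" and bounded_linear_bm: "bounded_linear bm"
  unfolding bp_def[abs_def] bm_def[abs_def]
  by (intro bounded_linear_add bounded_linear_sub bounded_linear_vec_nth bounded_linear_compose[OF bounded_linear_mult_right])+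

lemma borel_measurable_mk2:
  assumes [measurable]: "f \<in> borel_measurable M" "g \<in> borel_measurable M"
  shows "(\<lambda>x. mk2 (f x) (g x)) \<in> borel_measurable M"
proof -
  note [measurable] =
    borel_measurable_continuous_onI[OF linear_continuous_on[OF bounded_linear_mk2_left]]
    borel_measurable_continuous_onI[OF linear_continuous_on[OF bounded_linear_mk2_right]]
  show ?thesis by (subst mk2_split) measurable
qed

lemma borel_measurable_bp: "f \<in> borel_measurable M \<Longrightarrow> (\<lambda>x. bp (f x)) \<in> borel_measurable M"
  and borel_measurable_bm: "f \<in> borel_measurable M \<Longrightarrow> (\<lambda>x. bm (f x)) \<in> borel_measurable M"
  by (rule measurable_compose[OF _ borel_measurable_continuous_onI[OF linear_continuous_on[OF bounded_linear_bp]]],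
      assumption,
      rule measurable_compose[OF _ borel_measurable_continuous_onI[OF linear_continuous_on[OF bounded_linear_bm]]],
      assumption)

lemma integral_mk2:
  assumes "integrable M f" "integrable M g"
  shows "(LINT x|M. mk2 (f x) (g x)) = mk2 (LINT x|M. f x) (LINT x|M. g x)"
  using integral_bounded_linear[OF bounded_linear_mk2_left assms(1)]
    integral_bounded_linear[OF bounded_linear_mk2_right assms(2)]
    integrable_bounded_linear[OF bounded_linear_mk2_left assms(1)]
    integrable_bounded_linear[OF bounded_linear_mk2_right assms(2)]
  by (subst mk2_split, subst (2) mk2_split) simp

lemma tendsto_mk2:
  assumes "(f \<longlongrightarrow> a) F" "(g \<longlongrightarrow> d) F"
  shows "((\<lambda>x. mk2 (f x) (g x)) \<longlongrightarrow> mk2 a d) F"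
  by (subst mk2_split, subst (2) mk2_split)
     (intro tendsto_add bounded_linear.tendsto[OF bounded_linear_mk2_left] bounded_linear.tendsto[OF bounded_linear_mk2_right] assms)

section \<open>Transport between the unit circle and the circle with centre c and radius r\<close>

definition pt :: "real^2 \<Rightarrow> real \<Rightarrow> complex \<Rightarrow> real^2" where
  "pt c r z = c + r *\<^sub>R vector [Re z, Im z]"

lemma pt_nth: "pt c r z $ 1 = c $ 1 + r * Re z" "pt c r z $ 2 = c $ 2 + r * Im z"
  by (simp_all add: pt_def)

lemma norm_vec2_complex: "norm (v :: real^2) = cmod (Complex (v $ 1) (v $ 2))"
  by (simp add: norm_vec_def L2_set_def sum_2 complex_norm)

lemma dist_pt: "r > 0 \<Longrightarrow> dist (pt c r z) (pt c r w) = r * cmod (z - w)"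
proof -
  assume "r > 0"
  have "dist (pt c r z) (pt c r w) = cmod (of_real r * (z - w))"
    unfolding dist_norm norm_vec2_complex by (rule arg_cong[of _ _ cmod]) (simp add: pt_nth complex_eq_iff algebra_simps)
  then show ?thesis using \<open>r > 0\<close> by (simp add: norm_mult)
qed

text \<open>Defined on the whole plane, so that it inverts \<open>pt\<close> without reference to
  the circle.\<close>

definition unpt :: "real^2 \<Rightarrow> real \<Rightarrow> real^2 \<Rightarrow> complex" where
  "unpt c r x = Complex ((x - c) $ 1 / r) ((x - c) $ 2 / r)"

lemma unpt_pt [simp]: "r > 0 \<Longrightarrow> unpt c r (pt c r z) = z"
  by (simp add: unpt_def pt_nth complex_eq_iff)

lemma pt_unpt [simp]:
  assumes "r > 0" shows "pt c r (unpt c r x) = x"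
proof -
  have "r * ((x - c) $ i / r) = x $ i - c $ i" for i using assms by simp
  then have "pt c r (unpt c r x) $ 1 = x $ 1" "pt c r (unpt c r x) $ 2 = x $ 2"
    unfolding pt_nth unpt_def complex.sel by simp_all
  then show ?thesis by (simp only: vec_eq_iff forall_2 simp_thms)
qed

lemma norm_unpt: "r > 0 \<Longrightarrow> norm (unpt c r x) = dist c x / r"
proof -
  assume r: "r > 0"
  have "dist c x = cmod (of_real r * unpt c r x)"
    unfolding dist_norm norm_minus_commute[of c x]
    unfolding norm_vec2_complex
    using r by (intro arg_cong[of _ _ cmod]) (simp add: unpt_def complex_eq_iff)
  then show ?thesis using r by (simp add: norm_mult)
qed

lemma pt_in_sphere: "r > 0 \<Longrightarrow> pt c r z \<in> sphere c r \<longleftrightarrow> norm z = 1"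
  using norm_unpt[of r c "pt c r z"] by auto

lemma space_circle_measure [simp]: "space (circle_measure c r) = sphere c r"
  by (simp add: circle_measure_def space_scale_measure space_restrict_space)

lemma sets_circle_measure: "sets (circle_measure c r) = sets (restrict_space borel (sphere c r))"
  by (simp add: circle_measure_def)

lemma continuous_on_pt: "continuous_on A (pt c r)"
proof -
  have i: "continuous_on A (\<lambda>z. if i = 1 then c $ 1 + r * Re z else c $ 2 + r * Im z)" for i :: 2
    by (cases "i = 1") (auto intro!: continuous_intros)
  have "continuous_on A (\<lambda>z. \<chi> i::2. (if i = 1 then c $ 1 + r * Re z else c $ 2 + r * Im z))"
    by (rule continuous_on_vec_lambda) (rule i)
  then show ?thesis
    by (rule continuous_on_eq) (simp add: vec_eq_iff forall_2 pt_nth)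
qed

lemma measurable_pt:
  assumes "r > 0" shows "pt c r \<in> measurable ucirc (restrict_space borel (sphere c r))"
proof (rule measurable_restrict_space2)
  show "pt c r \<in> space ucirc \<rightarrow> sphere c r"
    using pt_in_sphere[OF assms] by (intro funcsetI) simp
qed (rule measurable_ucirc_continuous[OF continuous_on_pt])

lemma measurable_unpt:
  assumes "r > 0" shows "unpt c r \<in> measurable (circle_measure c r) ucirc"
proof (rule measurable_into_ucirc)
  have "unpt c r \<in> borel_measurable (restrict_space borel (sphere c r))"
    unfolding unpt_def[abs_def] Complex_eq
    by (intro borel_measurable_continuous_on_restrict continuous_intros)  (use assms in auto)
  then show "unpt c r \<in> borel_measurable (circle_measure c r)"
    by (simp cong: measurable_cong_sets add: sets_circle_measure)
qed (use assms in \<open>auto simp: norm_unpt\<close>)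

lemma circle_measure_eq:
  assumes "r > 0"
  shows "circle_measure c r = scale_measure (ennreal r) (distr ucirc (restrict_space borel (sphere c r)) (pt c r))"
proof -
  have "(\<lambda>t. c + r *\<^sub>R vector [cos t, sin t]) = pt c r \<circ> cis"
    by (auto simp: pt_def)
  then show ?thesis
    unfolding circle_measure_def ucirc_def
    by (subst distr_distr) (use measurable_pt[OF assms, of c] in \<open>auto cong: measurable_cong_sets simp: sets_ucirc\<close>)
qed

text \<open>An equivalence because \<open>pt\<close> has a measurable inverse; measurability on the
  given circle is always decided on the unit circle.\<close>

lemma measurable_circle_iff:
  assumes "r > 0"
  shows "f \<in> measurable (circle_measure c r) M \<longleftrightarrow> (\<lambda>z. f (pt c r z)) \<in> measurable ucirc M"
proof
  have pt: "pt c r \<in> measurable ucirc (circle_measure c r)"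
    using measurable_pt[OF assms, of c] by (simp cong: measurable_cong_sets add: sets_circle_measure)
  show "(\<lambda>z. f (pt c r z)) \<in> measurable ucirc M" if "f \<in> measurable (circle_measure c r) M"
    by (rule measurable_compose[OF pt that])
  show "f \<in> measurable (circle_measure c r) M" if "(\<lambda>z. f (pt c r z)) \<in> measurable ucirc M"
    using measurable_compose[OF measurable_unpt[OF assms, of c] that] assms by simp
qed

lemma nn_integral_circle:
  assumes "r > 0" and f: "f \<in> borel_measurable (circle_measure c r)"
  shows "(\<integral>\<^sup>+x. f x \<partial>circle_measure c r) = ennreal r * (\<integral>\<^sup>+z. f (pt c r z) \<partial>ucirc)"
proof -
  have "f \<in> borel_measurable (restrict_space borel (sphere c r))"
    using f by (simp cong: measurable_cong_sets add: sets_circle_measure)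
  then show ?thesis
    unfolding circle_measure_eq[OF assms(1)]
    by (simp add: nn_integral_scale_measure nn_integral_distr measurable_pt[OF assms(1)])
qed

text \<open>Turns the scaling by the radius into a constant density, for which Bochner integrals
  have a transformation rule.\<close>

lemma scale_measure_eq_density: "scale_measure a M = density M (\<lambda>_. a)"
proof (rule measure_eqI)
  fix A assume "A \<in> sets (scale_measure a M)"
  then show "emeasure (scale_measure a M) A = emeasure (density M (\<lambda>_. a)) A"
    by (simp add: emeasure_density_const)
qed simp

lemma integral_circle:
  fixes f :: "real^2 \<Rightarrow> 'a::{banach, second_countable_topology}"
  assumes "r > 0" and f: "f \<in> borel_measurable (circle_measure c r)"
  shows "(LINT x|circle_measure c r. f x) = r *\<^sub>R (LINT z|ucirc. f (pt c r z))"
proof -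
  have f': "f \<in> borel_measurable (restrict_space borel (sphere c r))"
    using f by (simp cong: measurable_cong_sets add: sets_circle_measure)
  have "(LINT x|circle_measure c r. f x) = (LINT x|distr ucirc (restrict_space borel (sphere c r)) (pt c r). r *\<^sub>R f x)"
    unfolding circle_measure_eq[OF assms(1)] scale_measure_eq_density
    using assms(1) f' by (intro integral_density) auto
  also have "\<dots> = r *\<^sub>R (LINT z|ucirc. f (pt c r z))"
    using integral_distr[OF measurable_pt[OF assms(1), of c] f'] by simp
  finally show ?thesis .
qed

context
  fixes lam mu k0 kap :: real
  assumes mu: "mu > 0" and lm: "2 * mu + lam > 0"
    and k0_def: "k0 = mu / (2 * (2 * mu + lam))" and kap_def: "kap = (mu + lam) / (2 * mu + lam)"
begin

text \<open>On a circle the normal component of a chord w is |w|^2 / (2 r), see \<open>wnN\<close>,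
  and this cancels one factor |w|^2. The terms containing \<open>wn\<close> become bounded; only the
  skew term, w times \<open>bn\<close> minus n times \<open>bw\<close>, keeps a simple pole and
  gives the Hilbert kernel.\<close>

lemma conormal_circle:
  fixes b :: "complex^2" and Z W :: complex and c :: "real^2"
  assumes r: "r > 0" and Z: "norm Z = 1" and W: "norm W = 1" and "Z \<noteq> W"
  shows "conormal lam mu (circle_normal c r (pt c r Z)) (\<lambda>z. kelvin_apply lam mu (z - pt c r W) b) (pt c r Z)
    = mk2 ((bp b / 2 - of_real kap / 2 * (Z * W) * bm b - of_real k0 * ((Z + W) / (Z - W) * bp b)) / of_real (2 * pi * r))
          ((bm b / 2 - of_real kap / 2 / (Z * W) * bp b + of_real k0 * ((Z + W) / (Z - W) * bm b)) / of_real (2 * pi * r))"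
    (is "?T = mk2 ?P ?M")
proof -
  define x y where "x = pt c r Z" and "y = pt c r W"
  define n where "n = circle_normal c r x"
  define w where "w = x - y"
  define R where "R = complex_of_real r"
  have nz: "Z \<noteq> 0" "W \<noteq> 0" "Z - W \<noteq> 0" "R \<noteq> 0" using Z W \<open>Z \<noteq> W\<close> r by (auto simp: R_def)
  have cZ: "cnj Z = 1 / Z" "cnj W = 1 / W"
    using cnj_powi_unit[OF Z, of 1] cnj_powi_unit[OF W, of 1] by (simp_all add: power_int_minus inverse_eq_divide)
  have "x \<noteq> y" using unpt_pt[OF r] \<open>Z \<noteq> W\<close> unfolding x_def y_def by metis
  have n12: "n $ 1 = Re Z" "n $ 2 = Im Z" using r by (simp_all add: n_def circle_normal_def x_def pt_def)
  have w12: "w $ 1 = r * Re (Z - W)" "w $ 2 = r * Im (Z - W)"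
    by (simp_all add: w_def x_def y_def pt_nth algebra_simps)
  have re_im: "of_real (Re u) = (u + cnj u) / 2" "of_real (Im u) = (u - cnj u) / (2 * \<i>)" for u
    by (simp_all add: complex_eq_iff)
  have cw: "complex_of_real (w$1) = (R * (Z - W) + R * (1 / Z - 1 / W)) / 2"
     "complex_of_real (w$2) = (R * (Z - W) - R * (1 / Z - 1 / W)) / (2 * \<i>)"
    unfolding w12 of_real_mult re_im by (simp_all add: R_def cZ field_simps)
  have cn: "complex_of_real (n$1) = (Z + 1 / Z) / 2" "complex_of_real (n$2) = (Z - 1 / Z) / (2 * \<i>)"
    unfolding n12 re_im by (simp_all add: cZ)
  \<comment> \<open>This is |w|^2 with conjugates replaced by inverses: R^2 (Z - W) (1/Z - 1/W). All
    quantities thus become rational functions of Z and W.\<close>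
  define N where "N = - R\<^sup>2 * (Z - W)\<^sup>2 / (Z * W)"
  define wn where "wn = w$1 * n$1 + w$2 * n$2"
  define bw where "bw = b$1 * of_real (w$1) + b$2 * of_real (w$2)"
  define bn where "bn = b$1 * of_real (n$1) + b$2 * of_real (n$2)"
  have Nz: "N \<noteq> 0" using nz by (simp add: N_def)
  have N: "complex_of_real ((norm w)\<^sup>2) = N"
    unfolding norm_vec2_sq of_real_add of_real_power cw N_def using nz
    by (simp add: field_simps power2_eq_square)
  have N4: "complex_of_real ((norm w)^4) = N * N"
    unfolding N[symmetric] of_real_mult[symmetric] by (simp flip: power_add)
  have wnN: "complex_of_real wn = N / (2 * R)"
    unfolding wn_def of_real_add of_real_mult cw cn N_def using nz
    by (simp add: field_simps power2_eq_square)
  \<comment> \<open>The bilinear dot product in the coordinates v1 + i v2 and v1 - i v2.\<close>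
  have dot: "(p + m) / 2 * ((s + t) / 2) + (p - m) / (2 * \<i>) * ((s - t) / (2 * \<i>)) = (p * t + m * s) / 2" for p m s t
    by (simp add: field_simps)
  have bw: "bw = R * (bp b * (1 / Z - 1 / W) + bm b * (Z - W)) / 2"
    unfolding bw_def cw vec2_components dot by (simp add: algebra_simps)
  have bn: "bn = (bp b / Z + bm b * Z) / 2"
    unfolding bn_def cn vec2_components dot by simp
  have T: "?T $ i = of_real (k0 / pi) * (b $ i * of_real wn + of_real (w $ i) * bn - of_real (n $ i) * bw) / N
     + of_real (kap / pi) * of_real (w $ i) * of_real wn * bw / (N * N)" for i
    using conormal_kelvin_apply[OF \<open>x \<noteq> y\<close> mu lm, of n b i]
    unfolding w_def[symmetric] N N4 wn_def[symmetric] bn_def[symmetric] bw_def[symmetric] k0_def[symmetric] kap_def[symmetric]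
    unfolding n_def x_def y_def .
  have wpm: "of_real (w$1) + \<i> * of_real (w$2) = R * (Z - W)" "of_real (w$1) - \<i> * of_real (w$2) = R * (1 / Z - 1 / W)"
    unfolding cw by (simp_all add: field_simps)
  have npm: "of_real (n$1) + \<i> * of_real (n$2) = Z" "of_real (n$1) - \<i> * of_real (n$2) = 1 / Z"
    unfolding cn by (simp_all add: field_simps)
  \<comment> \<open>The constant parts of both groups add up to (2 \<open>k0\<close> +
    \<open>kap\<close>) / 2, which this relation makes 1/2.\<close>
  have kk: "of_real kap = 1 - 2 * complex_of_real k0"
  proof -
    have "kap = 1 - 2 * k0" using lm by (simp add: kap_def k0_def field_simps)
    then show ?thesis by simp
  qed
  \<comment> \<open>Treats both component combinations at once: e is i for \<open>bp\<close> and - i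
    for \<open>bm\<close>.\<close>
  have comb: "(k * (b1 * t + w1 * u - n1 * v) / N + l * w1 * t * v / (N * N))
       + e * (k * (b2 * t + w2 * u - n2 * v) / N + l * w2 * t * v / (N * N))
     = k * (((b1 + e * b2) * t + (w1 + e * w2) * u - (n1 + e * n2) * v) / N)
       + l * ((w1 + e * w2) * t * v / (N * N))" for k l e t u v b1 b2 w1 w2 n1 n2
    by (simp add: divide_inverse algebra_simps)
  have bm_add: "bm v = v $ 1 + (- \<i>) * v $ 2" for v by (simp add: bm_def)
  have P: "bp ?T = of_real k0 / of_real pi * ((bp b * of_real wn + R * (Z - W) * bn - Z * bw) / N)
     + of_real kap / of_real pi * (R * (Z - W) * of_real wn * bw / (N * N))"
    unfolding bp_def[of ?T] T comb wpm(1) npm(1) bp_def[of b] of_real_divide ..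
  have wpm': "of_real (w$1) + (- \<i>) * of_real (w$2) = R * (1 / Z - 1 / W)"
    "of_real (n$1) + (- \<i>) * of_real (n$2) = 1 / Z" using wpm(2) npm(2) by simp_all
  have M: "bm ?T = of_real k0 / of_real pi * ((bm b * of_real wn + R * (1 / Z - 1 / W) * bn - 1 / Z * bw) / N)
     + of_real kap / of_real pi * (R * (1 / Z - 1 / W) * of_real wn * bw / (N * N))"
    unfolding bm_add[of ?T] T comb wpm' bm_add[of b] of_real_divide ..
  have P1: "(bp b * of_real wn + R * (Z - W) * bn - Z * bw) / N = bp b / (2 * R) - bp b * (Z + W) / (2 * R * (Z - W))"
    unfolding wnN bn bw N_def using nz by (simp add: divide_simps) (simp add: algebra_simps power2_eq_square)
  have P2: "R * (Z - W) * of_real wn * bw / (N * N) = (bp b - Z * W * bm b) / (4 * R)"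
    unfolding wnN bw N_def using nz by (simp add: divide_simps) (simp add: algebra_simps power2_eq_square)
  have M1: "(bm b * of_real wn + R * (1 / Z - 1 / W) * bn - 1 / Z * bw) / N = bm b / (2 * R) + bm b * (Z + W) / (2 * R * (Z - W))"
    unfolding wnN bn bw N_def using nz by (simp add: divide_simps) (simp add: algebra_simps power2_eq_square)
  have M2: "R * (1 / Z - 1 / W) * of_real wn * bw / (N * N) = (bm b - bp b / (Z * W)) / (4 * R)"
    unfolding wnN bw N_def using nz by (simp add: divide_simps) (simp add: algebra_simps power2_eq_square)
  have "bp ?T = ?P"
    unfolding P P1 P2 kk R_def[symmetric] of_real_mult using nz by (simp add: field_simps)
  moreover have "bm ?T = ?M"
    unfolding M M1 M2 kk R_def[symmetric] of_real_mult using nz by (simp add: field_simps)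
  ultimately show ?thesis using mk2_bp_bm[of ?T] by simp
qed

end

section \<open>The principal value operator on Lipschitz densities\<close>

lemma hil_principal_value_sum:
  assumes L: "circ_lipschitz L g" and g: "integrable ucirc g" and h: "integrable ucirc h"
    and z: "norm z = 1" and "r > 0"
  shows "\<epsilon> > 0 \<Longrightarrow> integrable ucirc (\<lambda>w. indicator {w. \<epsilon> < r * cmod (z - w)} w *\<^sub>R (h w + k * ((z + w) / (z - w) * g w)))"
    and "((\<lambda>\<epsilon>. LINT w|ucirc. indicator {w. \<epsilon> < r * cmod (z - w)} w *\<^sub>R (h w + k * ((z + w) / (z - w) * g w)))
      \<longlongrightarrow> (LINT w|ucirc. h w) + k * (of_real (2 * pi) * hil g z)) (at_right 0)"
proof -
  let ?I = "\<lambda>\<epsilon> w. indicator {w. \<epsilon> < r * cmod (z - w)} w :: real"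
  have split: "?I \<epsilon> w *\<^sub>R (h w + k * ((z + w) / (z - w) * g w))
      = ?I \<epsilon> w *\<^sub>R h w + k * (?I \<epsilon> w *\<^sub>R ((z + w) / (z - w) * g w))" for \<epsilon> w
    by (simp add: scaleR_conv_of_real algebra_simps)
  have hi: "integrable ucirc (\<lambda>w. ?I \<epsilon> w *\<^sub>R h w)" for \<epsilon>
  proof (rule Bochner_Integration.integrable_bound[OF h])
    have [measurable]: "h \<in> borel_measurable ucirc" using h by auto
    show "(\<lambda>w. ?I \<epsilon> w *\<^sub>R h w) \<in> borel_measurable ucirc" by measurable
  qed (auto split: split_indicator)
  have ki: "integrable ucirc (\<lambda>w. k * (?I \<epsilon> w *\<^sub>R ((z + w) / (z - w) * g w)))" if "\<epsilon> > 0" for \<epsilon>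
    by (intro integrable_mult_right integrable_far_kernel[OF g z that \<open>r > 0\<close>])
  show "integrable ucirc (\<lambda>w. ?I \<epsilon> w *\<^sub>R (h w + k * ((z + w) / (z - w) * g w)))" if "\<epsilon> > 0" for \<epsilon>
    unfolding split by (intro Bochner_Integration.integrable_add hi ki that)
  have "((\<lambda>\<epsilon>. (LINT w|ucirc. ?I \<epsilon> w *\<^sub>R h w) + k * (LINT w|ucirc. ?I \<epsilon> w *\<^sub>R ((z + w) / (z - w) * g w)))
      \<longlongrightarrow> (LINT w|ucirc. h w) + k * (of_real (2 * pi) * hil g z)) (at_right 0)"
    by (intro tendsto_intros integral_far_tendsto[OF h] hil_principal_value[OF L z] \<open>r > 0\<close>)
  then show "((\<lambda>\<epsilon>. LINT w|ucirc. ?I \<epsilon> w *\<^sub>R (h w + k * ((z + w) / (z - w) * g w)))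
      \<longlongrightarrow> (LINT w|ucirc. h w) + k * (of_real (2 * pi) * hil g z)) (at_right 0)"
  proof (rule tendsto_cong[THEN iffD1, rotated])
    have "eventually (\<lambda>\<epsilon>. \<epsilon> > (0::real)) (at_right 0)" by (simp add: eventually_at_right_less)
    then show "\<forall>\<^sub>F \<epsilon> in at_right 0. (LINT w|ucirc. ?I \<epsilon> w *\<^sub>R h w) + k * (LINT w|ucirc. ?I \<epsilon> w *\<^sub>R ((z + w) / (z - w) * g w))
        = (LINT w|ucirc. ?I \<epsilon> w *\<^sub>R (h w + k * ((z + w) / (z - w) * g w)))"
    proof eventually_elim
      case (elim \<epsilon>)
      show ?case
        unfolding split by (subst Bochner_Integration.integral_add[OF hi ki[OF elim]]) (simp only: integral_mult_right_zero)
    qed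
  qed
qed

lemma circ_lipschitz_bounded:
  assumes L: "circ_lipschitz L g" and z: "norm z = 1"
  shows "cmod (g z) \<le> cmod (g 1) + \<bar>L\<bar> * 2"
proof -
  have "cmod (g z - g 1) \<le> L * cmod (z - 1)" using L z by (simp add: circ_lipschitz_def)
  also have "\<dots> \<le> \<bar>L\<bar> * 2"
    using norm_triangle_ineq4[of z 1] z by (intro mult_mono) auto
  finally show ?thesis using norm_triangle_sub[of "g z" "g 1"] by simp
qed

lemma circ_lipschitz_integrable:
  assumes "circ_lipschitz L g" shows "integrable ucirc g"
  using circ_lipschitz_measurable[OF assms] circ_lipschitz_bounded[OF assms]
  by (intro integrable_ucirc_bounded) auto

locale elastic_disk =
  fixes lam mu r :: real and c :: "real^2"
  assumes mu: "mu > 0" and lm: "2 * mu + lam > 0" and r: "r > 0"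
begin

definition k0 :: real where "k0 = mu / (2 * (2 * mu + lam))"
definition kap :: real where "kap = (mu + lam) / (2 * mu + lam)"

abbreviation S where "S \<equiv> circle_measure c r"

definition gp :: "field \<Rightarrow> complex \<Rightarrow> complex" where "gp f z = bp (f (pt c r z))"
definition gm :: "field \<Rightarrow> complex \<Rightarrow> complex" where "gm f z = bm (f (pt c r z))"

text \<open>The two components of the principal value. The constant kernel keeps the mean, and the
  kernel Z w of the reflection keeps one mode of the other component: integrating \<open>gm\<close>
  against w gives its coefficient -1. The Hilbert transform enters \<open>Np\<close> and
  \<open>Nm\<close> with opposite signs.\<close>

definition Np :: "field \<Rightarrow> complex \<Rightarrow> complex" where
  "Np \<phi> Z = fco (gp \<phi>) 0 / 2 - of_real kap / 2 * fco (gm \<phi>) (- 1) * Z - of_real k0 * hil (gp \<phi>) Z"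
definition Nm :: "field \<Rightarrow> complex \<Rightarrow> complex" where
  "Nm \<phi> Z = fco (gm \<phi>) 0 / 2 - of_real kap / 2 * fco (gp \<phi>) 1 * Z powi (- 1) + of_real k0 * hil (gm \<phi>) Z"

lemma np_pv_circle:
  assumes Lp: "circ_lipschitz L (gp \<phi>)" and Lm: "circ_lipschitz L (gm \<phi>)" and Z: "norm Z = 1"
  shows "np_pv lam mu S (circle_normal c r) \<phi> (pt c r Z) = mk2 (Np \<phi> Z) (Nm \<phi> Z)"
proof -
  define T where "T y = conormal lam mu (circle_normal c r (pt c r Z)) (\<lambda>z. kelvin_apply lam mu (z - y) (\<phi> y)) (pt c r Z)" for y
  let ?I = "\<lambda>\<epsilon> w. indicator {w. \<epsilon> < r * cmod (Z - w)} w :: real"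
  define hp where "hp w = gp \<phi> w / 2 - of_real kap / 2 * (Z * w) * gm \<phi> w" for w
  define hm where "hm w = gm \<phi> w / 2 - of_real kap / 2 / (Z * w) * gp \<phi> w" for w
  define Kp where "Kp w = hp w + (- of_real k0) * ((Z + w) / (Z - w) * gp \<phi> w)" for w
  define Km where "Km w = hm w + of_real k0 * ((Z + w) / (Z - w) * gm \<phi> w)" for w
  \<comment> \<open>The arc length factor r cancels against \<open>q\<close> and leaves the 1 / (2
    pi) of Fourier coefficients: the operator does not see the radius.\<close>
  define q where "q = 1 / (2 * pi * r)"
  note ip = circ_lipschitz_integrable[OF Lp] and im = circ_lipschitz_integrable[OF Lm]
  note [measurable] = circ_lipschitz_measurable[OF Lp] circ_lipschitz_measurable[OF Lm]
  have nz: "Z \<noteq> 0" using Z by auto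
  have ipw: "integrable ucirc (\<lambda>w. gm \<phi> w * w powi (- (-1)))" "integrable ucirc (\<lambda>w. gp \<phi> w * w powi (- 1))"
    using integrable_ucirc_times_powi[OF im] integrable_ucirc_times_powi[OF ip] by blast+
  have hp': "hp = (\<lambda>w. gp \<phi> w * (1/2) - of_real kap / 2 * Z * (gm \<phi> w * w powi (- (-1))))"
    by (auto simp: hp_def fun_eq_iff)
  have hm': "hm = (\<lambda>w. gm \<phi> w * (1/2) - of_real kap / 2 / Z * (gp \<phi> w * w powi (- 1)))"
    by (auto simp: hm_def fun_eq_iff power_int_minus field_simps)
  have ihp: "integrable ucirc hp"
    unfolding hp' by (intro Bochner_Integration.integrable_diff integrable_mult_left integrable_mult_right ip ipw)
  have ihm: "integrable ucirc hm"
    unfolding hm' by (intro Bochner_Integration.integrable_diff integrable_mult_left integrable_mult_right im ipw)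
  have f0: "(LINT w|ucirc. g w) = of_real (2 * pi) * fco g 0" for g by (simp add: fco_def)
  have Ihp: "(LINT w|ucirc. hp w) = of_real (2 * pi) * (fco (gp \<phi>) 0 / 2 - of_real kap / 2 * fco (gm \<phi>) (- 1) * Z)"
    unfolding hp'
    by (subst Bochner_Integration.integral_diff)
       (use ip ipw in \<open>simp_all only: integrable_mult_left integrable_mult_right integral_mult_left_zero integral_mult_right_zero integral_fco f0,
         simp add: algebra_simps\<close>)
  have Ihm: "(LINT w|ucirc. hm w) = of_real (2 * pi) * (fco (gm \<phi>) 0 / 2 - of_real kap / 2 * fco (gp \<phi>) 1 * Z powi (- 1))"
    unfolding hm'
    by (subst Bochner_Integration.integral_diff)
       (use im ipw in \<open>simp_all only: integrable_mult_left integrable_mult_right integral_mult_left_zero integral_mult_right_zero integral_fco f0,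
         simp add: power_int_minus inverse_eq_divide algebra_simps\<close>)
  note pvp = hil_principal_value_sum[OF Lp ip ihp Z r, where k="- of_real k0"]
  note pvm = hil_principal_value_sum[OF Lm im ihm Z r, where k="of_real k0"]
  have T: "T (pt c r w) = q *\<^sub>R mk2 (Kp w) (Km w)" if "norm w = 1" "Z \<noteq> w" for w
    unfolding T_def
    by (subst conormal_circle[OF mu lm k0_def kap_def r Z that])
       (simp add: gp_def[symmetric] gm_def[symmetric] mk2_scaleR Kp_def Km_def hp_def hm_def q_def scaleR_conv_of_real[where 'a=complex])
  have pt_far: "\<epsilon> < dist (pt c r Z) (pt c r w) \<longleftrightarrow> \<epsilon> < r * cmod (Z - w)" for \<epsilon> w
    by (simp add: dist_pt r)
  have int: "(LINT y : {y \<in> space S. \<epsilon> < dist (pt c r Z) y} | S. T y)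
     = mk2 (of_real (r * q) * (LINT w|ucirc. ?I \<epsilon> w *\<^sub>R Kp w)) (of_real (r * q) * (LINT w|ucirc. ?I \<epsilon> w *\<^sub>R Km w))"
    if e: "\<epsilon> > 0" for \<epsilon>
  proof -
    let ?F = "\<lambda>y. indicator {y \<in> space S. \<epsilon> < dist (pt c r Z) y} y *\<^sub>R T y"
    have F: "?F (pt c r w) = q *\<^sub>R mk2 (?I \<epsilon> w *\<^sub>R Kp w) (?I \<epsilon> w *\<^sub>R Km w)" if w: "norm w = 1" for w
    proof (cases "\<epsilon> < r * cmod (Z - w)")
      case True
      then have "Z \<noteq> w" using e by auto
      then show ?thesis using True w pt_in_sphere[OF r, of c w] pt_far[of \<epsilon> w] by (simp add: T mk2_scaleR)
    next
      case False
      have "mk2 0 0 = 0" by (simp add: mk2_def vec_eq_iff)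
      then show ?thesis using False pt_far[of \<epsilon> w] by simp
    qed
    have [measurable]: "Kp \<in> borel_measurable ucirc" "Km \<in> borel_measurable ucirc"
      unfolding Kp_def[abs_def] Km_def[abs_def] hp_def hm_def by measurable
    have "(\<lambda>w. mk2 (?I \<epsilon> w *\<^sub>R Kp w) (?I \<epsilon> w *\<^sub>R Km w)) \<in> borel_measurable ucirc"
      by (intro borel_measurable_mk2) measurable
    then have "(\<lambda>w. q *\<^sub>R mk2 (?I \<epsilon> w *\<^sub>R Kp w) (?I \<epsilon> w *\<^sub>R Km w)) \<in> borel_measurable ucirc" by measurable
    then have "(\<lambda>w. ?F (pt c r w)) \<in> borel_measurable ucirc"
      by (subst measurable_cong[of _ _ "\<lambda>w. q *\<^sub>R mk2 (?I \<epsilon> w *\<^sub>R Kp w) (?I \<epsilon> w *\<^sub>R Km w)"]) (auto simp only: F space_ucirc mem_sphere dist_0_norm)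
    then have mF: "?F \<in> borel_measurable S" by (simp add: measurable_circle_iff[OF r])
    have "(LINT y : {y \<in> space S. \<epsilon> < dist (pt c r Z) y} | S. T y) = (LINT y | S. ?F y)"
      by (simp add: set_lebesgue_integral_def)
    also have "\<dots> = r *\<^sub>R (LINT w|ucirc. ?F (pt c r w))"
      by (rule integral_circle[OF r mF])
    also have "(LINT w|ucirc. ?F (pt c r w)) = (LINT w|ucirc. q *\<^sub>R mk2 (?I \<epsilon> w *\<^sub>R Kp w) (?I \<epsilon> w *\<^sub>R Km w))"
      by (intro Bochner_Integration.integral_cong refl F) auto
    also have "\<dots> = q *\<^sub>R mk2 (LINT w|ucirc. ?I \<epsilon> w *\<^sub>R Kp w) (LINT w|ucirc. ?I \<epsilon> w *\<^sub>R Km w)"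
      using pvp(1)[OF e] pvm(1)[OF e] unfolding Kp_def[symmetric] Km_def[symmetric]
      by (simp only: integral_scaleR_right integral_mk2)
    finally show ?thesis by (simp only: scaleR_scaleR) (simp only: mk2_scaleR scaleR_conv_of_real[where 'a=complex])
  qed
  have "((\<lambda>\<epsilon>. mk2 (of_real (r * q) * (LINT w|ucirc. ?I \<epsilon> w *\<^sub>R Kp w)) (of_real (r * q) * (LINT w|ucirc. ?I \<epsilon> w *\<^sub>R Km w)))
    \<longlongrightarrow> mk2 (of_real (r * q) * ((LINT w|ucirc. hp w) + (- of_real k0) * (of_real (2 * pi) * hil (gp \<phi>) Z)))
            (of_real (r * q) * ((LINT w|ucirc. hm w) + of_real k0 * (of_real (2 * pi) * hil (gm \<phi>) Z)))) (at_right 0)"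
    unfolding Kp_def Km_def by (intro tendsto_mk2 tendsto_mult tendsto_const pvp(2) pvm(2))
  also have "of_real (r * q) * ((LINT w|ucirc. hp w) + (- of_real k0) * (of_real (2 * pi) * hil (gp \<phi>) Z)) = Np \<phi> Z"
    using r by (simp add: Ihp Np_def q_def field_simps)
  also have "of_real (r * q) * ((LINT w|ucirc. hm w) + of_real k0 * (of_real (2 * pi) * hil (gm \<phi>) Z)) = Nm \<phi> Z"
    using r by (simp add: Ihm Nm_def q_def field_simps)
  finally have "((\<lambda>\<epsilon>. mk2 (of_real (r * q) * (LINT w|ucirc. ?I \<epsilon> w *\<^sub>R Kp w)) (of_real (r * q) * (LINT w|ucirc. ?I \<epsilon> w *\<^sub>R Km w)))
    \<longlongrightarrow> mk2 (Np \<phi> Z) (Nm \<phi> Z)) (at_right 0)" .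
  then have "((\<lambda>\<epsilon>. LINT y : {y \<in> space S. \<epsilon> < dist (pt c r Z) y} | S. T y) \<longlongrightarrow> mk2 (Np \<phi> Z) (Nm \<phi> Z)) (at_right 0)"
  proof (rule tendsto_cong[THEN iffD1, rotated])
    have "eventually (\<lambda>\<epsilon>. \<epsilon> > (0::real)) (at_right 0)" by (simp add: eventually_at_right_less)
    then show "\<forall>\<^sub>F \<epsilon> in at_right 0. mk2 (of_real (r * q) * (LINT w|ucirc. ?I \<epsilon> w *\<^sub>R Kp w)) (of_real (r * q) * (LINT w|ucirc. ?I \<epsilon> w *\<^sub>R Km w))
       = (LINT y : {y \<in> space S. \<epsilon> < dist (pt c r Z) y} | S. T y)"
      by eventually_elim (simp only: int)
  qed
  then show ?thesis
    unfolding np_pv_def T_def by (intro tendsto_Lim) auto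
qed

section \<open>Fourier coefficients and bounds of the image of a density\<close>

lemma fco_Np:
  assumes L: "circ_lipschitz L (gp \<phi>)"
  shows "fco (Np \<phi>) n = (if n = 0 then fco (gp \<phi>) 0 / 2 else 0) - of_real kap / 2 * (if n = 1 then fco (gm \<phi>) (- 1) else 0)
      + of_real k0 * of_int (sgn n) * fco (gp \<phi>) n"
proof -
  have i: "integrable ucirc (hil (gp \<phi>))"
    using hil_measurable[OF circ_lipschitz_measurable[OF L]] hil_bound[OF L] by (intro integrable_ucirc_bounded) auto
  have eq: "Np \<phi> = (\<lambda>Z. fco (gp \<phi>) 0 / 2 * Z powi 0 - of_real kap / 2 * fco (gm \<phi>) (- 1) * Z powi 1 - of_real k0 * hil (gp \<phi>) Z)"
    by (auto simp: Np_def)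
  show ?thesis
    unfolding eq by (simp only: fco_diff fco_cmult fco_powi fco_hil[OF L] integrable_mult_right integrable_ucirc_powi i
        Bochner_Integration.integrable_diff) auto
qed

lemma fco_Nm:
  assumes L: "circ_lipschitz L (gm \<phi>)"
  shows "fco (Nm \<phi>) n = (if n = 0 then fco (gm \<phi>) 0 / 2 else 0) - of_real kap / 2 * (if n = - 1 then fco (gp \<phi>) 1 else 0)
      - of_real k0 * of_int (sgn n) * fco (gm \<phi>) n"
proof -
  have i: "integrable ucirc (hil (gm \<phi>))"
    using hil_measurable[OF circ_lipschitz_measurable[OF L]] hil_bound[OF L] by (intro integrable_ucirc_bounded) auto
  have eq: "Nm \<phi> = (\<lambda>Z. fco (gm \<phi>) 0 / 2 * Z powi 0 - of_real kap / 2 * fco (gp \<phi>) 1 * Z powi (- 1) + of_real k0 * hil (gm \<phi>) Z)"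
    by (auto simp: Nm_def)
  show ?thesis
    unfolding eq by (simp only: fco_diff fco_add fco_cmult fco_powi fco_hil[OF L] integrable_mult_right integrable_ucirc_powi i
        Bochner_Integration.integrable_diff) auto
qed

lemma N_measurable:
  assumes Lp: "circ_lipschitz L (gp \<phi>)" and Lm: "circ_lipschitz L (gm \<phi>)"
  shows "Np \<phi> \<in> borel_measurable ucirc" "Nm \<phi> \<in> borel_measurable ucirc"
proof -
  note [measurable] = hil_measurable[OF circ_lipschitz_measurable[OF Lp]] hil_measurable[OF circ_lipschitz_measurable[OF Lm]]
  show "Np \<phi> \<in> borel_measurable ucirc" "Nm \<phi> \<in> borel_measurable ucirc"
    unfolding Np_def[abs_def] Nm_def[abs_def] by measurable
qed

text \<open>Used to place the image of a Lipschitz density in the dual, through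
  \<open>functional_of_bounded\<close>.\<close>

lemma N_bounded:
  assumes Lp: "circ_lipschitz L (gp \<phi>)" and Lm: "circ_lipschitz L (gm \<phi>)"
  shows "\<exists>B. \<forall>Z. norm Z = 1 \<longrightarrow> cmod (Np \<phi> Z) \<le> B \<and> cmod (Nm \<phi> Z) \<le> B"
proof -
  let ?Bp = "cmod (fco (gp \<phi>) 0 / 2) + cmod (of_real kap / 2 * fco (gm \<phi>) (- 1)) + \<bar>k0\<bar> * (2 * \<bar>L\<bar>)"
  let ?Bm = "cmod (fco (gm \<phi>) 0 / 2) + cmod (of_real kap / 2 * fco (gp \<phi>) 1) + \<bar>k0\<bar> * (2 * \<bar>L\<bar>)"
  have "cmod (Np \<phi> Z) \<le> ?Bp" if Z: "norm Z = 1" for Z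
  proof -
    have "cmod (of_real k0 * hil (gp \<phi>) Z) \<le> \<bar>k0\<bar> * (2 * \<bar>L\<bar>)"
      using hil_bound[OF Lp Z] by (simp add: norm_mult mult_left_mono)
    moreover have "cmod (of_real kap / 2 * fco (gm \<phi>) (- 1) * Z) = cmod (of_real kap / 2 * fco (gm \<phi>) (- 1))"
      using Z by (simp add: norm_mult)
    ultimately show ?thesis
      unfolding Np_def by (intro norm_triangle_le_diff) (auto intro!: add_mono norm_triangle_ineq4[THEN order_trans])
  qed
  moreover have "cmod (Nm \<phi> Z) \<le> ?Bm" if Z: "norm Z = 1" for Z
  proof -
    have "cmod (of_real k0 * hil (gm \<phi>) Z) \<le> \<bar>k0\<bar> * (2 * \<bar>L\<bar>)"
      using hil_bound[OF Lm Z] by (simp add: norm_mult mult_left_mono)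
    moreover have "cmod (of_real kap / 2 * fco (gp \<phi>) 1 * Z powi (- 1)) = cmod (of_real kap / 2 * fco (gp \<phi>) 1)"
      using Z by (simp add: norm_mult norm_power_int norm_inverse)
    ultimately show ?thesis
      unfolding Nm_def by (intro norm_triangle_le) (auto intro!: add_mono norm_triangle_ineq4[THEN order_trans])
  qed
  ultimately show ?thesis by (intro exI[of _ "max ?Bp ?Bm"]) (auto simp: le_max_iff_disj)
qed

end

section \<open>The space \<open>H\<^sup>1\<^sup>/\<^sup>2\<close> in Fourier coordinates\<close>

lemma ennreal_lin_comb:
  "0 \<le> a \<Longrightarrow> 0 \<le> b \<Longrightarrow> 0 \<le> u \<Longrightarrow> 0 \<le> v \<Longrightarrow> ennreal a * ennreal b + ennreal u * ennreal v = ennreal (a * b + u * v)"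
  "0 \<le> a \<Longrightarrow> 0 \<le> b \<Longrightarrow> 0 \<le> u \<Longrightarrow> ennreal a * (ennreal b + ennreal u) = ennreal (a * (b + u))"
  by (simp_all add: ennreal_mult)

context elastic_disk begin

text \<open>Coefficients with respect to the orthogonal real fields \<open>(cos n\<theta>, sin n\<theta>)\<close> (index \<open>(False, n)\<close>) and
  \<open>(- sin n\<theta>, cos n\<theta>)\<close> (index \<open>(True, n)\<close>), with \<open>n\<close> ranging over all integers.\<close>

definition cf :: "field \<Rightarrow> bool \<times> int \<Rightarrow> complex" where
  "cf f i = (if fst i then \<i> * (fco (gm f) (- snd i) - fco (gp f) (snd i)) / 2
             else (fco (gm f) (- snd i) + fco (gp f) (snd i)) / 2)"

text \<open>The L^2 part of the energy contributes 2 pi r, the length of the circle; the Gagliardo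
  part is invariant under scaling and contributes 4 pi^2 |n|.\<close>

definition wt :: "bool \<times> int \<Rightarrow> real" where
  "wt i = 2 * pi * r + 4 * pi\<^sup>2 * \<bar>of_int (snd i)\<bar>"

lemma wt_pos: "wt i > 0"
  using r by (simp add: wt_def add_pos_nonneg)

lemma cf_sq: "(cmod (cf f (False, n)))\<^sup>2 + (cmod (cf f (True, n)))\<^sup>2
    = ((cmod (fco (gm f) (- n)))\<^sup>2 + (cmod (fco (gp f) n))\<^sup>2) / 2"
proof -
  have "(cmod ((a + b) / 2))\<^sup>2 + (cmod (\<i> * (a - b) / 2))\<^sup>2 = ((cmod a)\<^sup>2 + (cmod b)\<^sup>2) / 2" for a b
    unfolding norm_divide norm_mult power_divide power_mult_distrib cmod_power2
    by (simp add: power2_eq_square field_simps)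
  then show ?thesis by (simp add: cf_def)
qed

lemma gp_measurable: "f \<in> borel_measurable S \<Longrightarrow> gp f \<in> borel_measurable ucirc"
  and gm_measurable: "f \<in> borel_measurable S \<Longrightarrow> gm f \<in> borel_measurable ucirc"
  unfolding measurable_circle_iff[OF r] gp_def[abs_def] gm_def[abs_def]
  by (simp_all add: borel_measurable_bp borel_measurable_bm)

lemma norm_pt_diff: "(norm (f (pt c r z) - f (pt c r w)))\<^sup>2 = ((cmod (gp f z - gp f w))\<^sup>2 + (cmod (gm f z - gm f w))\<^sup>2) / 2"
  by (simp add: norm_complex2 gp_def gm_def linear_diff[OF bounded_linear.linear[OF bounded_linear_bp]] linear_diff[OF bounded_linear.linear[OF bounded_linear_bm]])

lemma measurable_circle_ident: "(\<lambda>x. x) \<in> borel_measurable S"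
  unfolding measurable_circle_iff[OF r] by (rule measurable_ucirc_continuous[OF continuous_on_pt])

lemma energy_L2:
  assumes "f \<in> borel_measurable S"
  shows "(\<integral>\<^sup>+x. ennreal ((norm (f x))\<^sup>2) \<partial>S) = ennreal (r / 2) * (sq (gp f) + sq (gm f))"
proof -
  note [measurable] = assms gp_measurable[OF assms] gm_measurable[OF assms]
  have "(\<integral>\<^sup>+x. ennreal ((norm (f x))\<^sup>2) \<partial>S) = ennreal r * (\<integral>\<^sup>+z. ennreal ((norm (f (pt c r z)))\<^sup>2) \<partial>ucirc)"
    by (rule nn_integral_circle[OF r]) measurable
  also have "(\<integral>\<^sup>+z. ennreal ((norm (f (pt c r z)))\<^sup>2) \<partial>ucirc)
     = (\<integral>\<^sup>+z. ennreal (1/2) * (ennreal ((cmod (gp f z))\<^sup>2) + ennreal ((cmod (gm f z))\<^sup>2)) \<partial>ucirc)"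
    by (intro nn_integral_cong, subst ennreal_lin_comb(2)) (simp_all add: norm_complex2 gp_def gm_def)
  also have "\<dots> = ennreal (1/2) * (sq (gp f) + sq (gm f))"
    by (simp add: nn_integral_cmult nn_integral_add sq_def)
  also have "ennreal r * \<dots> = ennreal (r / 2) * (sq (gp f) + sq (gm f))"
    unfolding mult.assoc[symmetric] using r by (subst ennreal_mult[symmetric]) simp_all
  finally show ?thesis .
qed

definition gag :: "(complex \<Rightarrow> complex) \<Rightarrow> ennreal" where
  "gag g = (\<integral>\<^sup>+z. (\<integral>\<^sup>+w. ennreal ((cmod (g z - g w))\<^sup>2 / (cmod (z - w))\<^sup>2) \<partial>ucirc) \<partial>ucirc)"

text \<open>Two arc length factors cancel the r^2 of the squared distance, so the radius disappears.
  The 1/2 comes from expressing the norm by the components \<open>bp\<close> and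
  \<open>bm\<close>.\<close>

lemma energy_gagliardo:
  assumes "f \<in> borel_measurable S"
  shows "(\<integral>\<^sup>+x. (\<integral>\<^sup>+y. ennreal ((norm (f x - f y))\<^sup>2 / (dist x y)\<^sup>2) \<partial>S) \<partial>S)
     = ennreal (1/2) * (gag (gp f) + gag (gm f))"
proof -
  note [measurable] = assms gp_measurable[OF assms] gm_measurable[OF assms] measurable_circle_ident
  define H where "H g z = (\<integral>\<^sup>+w. ennreal ((cmod (g z - g w))\<^sup>2 / (cmod (z - w))\<^sup>2) \<partial>ucirc)" for g and z :: complex
  have Hm: "H g \<in> borel_measurable ucirc" if [measurable]: "g \<in> borel_measurable ucirc" for g
    unfolding H_def[abs_def] by measurable
  note [measurable] = Hm[OF gp_measurable[OF assms]] Hm[OF gm_measurable[OF assms]]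
  define J where "J x = (\<integral>\<^sup>+y. ennreal ((norm (f x - f y))\<^sup>2 / (dist x y)\<^sup>2) \<partial>S)" for x
  have J: "J (pt c r z) = ennreal (1 / (2 * r)) * (H (gp f) z + H (gm f) z)" for z
  proof -
    have "J (pt c r z) = ennreal r * (\<integral>\<^sup>+w. ennreal ((norm (f (pt c r z) - f (pt c r w)))\<^sup>2 / (dist (pt c r z) (pt c r w))\<^sup>2) \<partial>ucirc)"
      unfolding J_def by (rule nn_integral_circle[OF r]) measurable
    also have "(\<integral>\<^sup>+w. ennreal ((norm (f (pt c r z) - f (pt c r w)))\<^sup>2 / (dist (pt c r z) (pt c r w))\<^sup>2) \<partial>ucirc)
       = (\<integral>\<^sup>+w. ennreal (1 / (2 * r\<^sup>2)) * (ennreal ((cmod (gp f z - gp f w))\<^sup>2 / (cmod (z - w))\<^sup>2)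
            + ennreal ((cmod (gm f z - gm f w))\<^sup>2 / (cmod (z - w))\<^sup>2)) \<partial>ucirc)"
    proof (rule nn_integral_cong)
      fix w
      have "(norm (f (pt c r z) - f (pt c r w)))\<^sup>2 / (dist (pt c r z) (pt c r w))\<^sup>2
        = 1 / (2 * r\<^sup>2) * ((cmod (gp f z - gp f w))\<^sup>2 / (cmod (z - w))\<^sup>2 + (cmod (gm f z - gm f w))\<^sup>2 / (cmod (z - w))\<^sup>2)"
        unfolding norm_pt_diff dist_pt[OF r] by (simp add: power_mult_distrib add_divide_distrib mult_ac)
      then show "ennreal ((norm (f (pt c r z) - f (pt c r w)))\<^sup>2 / (dist (pt c r z) (pt c r w))\<^sup>2)
        = ennreal (1 / (2 * r\<^sup>2)) * (ennreal ((cmod (gp f z - gp f w))\<^sup>2 / (cmod (z - w))\<^sup>2)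
            + ennreal ((cmod (gm f z - gm f w))\<^sup>2 / (cmod (z - w))\<^sup>2))"
        by (subst ennreal_lin_comb(2)) simp_all
    qed
    also have "\<dots> = ennreal (1 / (2 * r\<^sup>2)) * (H (gp f) z + H (gm f) z)"
      unfolding H_def by (subst nn_integral_cmult, measurable) (subst nn_integral_add, auto)
    also have "ennreal r * \<dots> = ennreal (1 / (2 * r)) * (H (gp f) z + H (gm f) z)"
      using r by (simp add: mult.assoc[symmetric] ennreal_mult[symmetric] power2_eq_square)
    finally show ?thesis .
  qed
  have "J \<in> borel_measurable S"
    unfolding measurable_circle_iff[OF r] J by measurable
  then have "(\<integral>\<^sup>+x. J x \<partial>S) = ennreal r * (\<integral>\<^sup>+z. J (pt c r z) \<partial>ucirc)"
    by (rule nn_integral_circle[OF r])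
  also have "\<dots> = ennreal r * (ennreal (1 / (2 * r)) * (gag (gp f) + gag (gm f)))"
    unfolding J gag_def H_def[symmetric] by (subst nn_integral_cmult, measurable) (subst nn_integral_add, auto)
  also have "\<dots> = ennreal (1/2) * (gag (gp f) + gag (gm f))"
    using r by (simp add: mult.assoc[symmetric] ennreal_mult[symmetric])
  finally show ?thesis by (simp add: J_def)
qed

lemma energy_fourier:
  assumes f: "f \<in> borel_measurable S" and fin: "sq (gp f) < \<infinity>" "sq (gm f) < \<infinity>"
  shows "h_half_energy S f = (\<integral>\<^sup>+i. ennreal (wt i * (cmod (cf f i))\<^sup>2) \<partial>count_space UNIV)"
proof -
  define w where "w n = 2 * pi * r + 4 * pi\<^sup>2 * \<bar>of_int n\<bar>" for n :: int
  have w0: "w n \<ge> 0" for n using r by (simp add: w_def)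
  let ?C = "count_space (UNIV :: int set)"
  have one: "ennreal (r / 2) * sq g + ennreal (1/2) * gag g = (\<integral>\<^sup>+n. ennreal (w n / 2 * (cmod (fco g n))\<^sup>2) \<partial>?C)"
    if "g \<in> borel_measurable ucirc" "sq g < \<infinity>" for g
  proof -
    have "ennreal (r / 2) * sq g + ennreal (1/2) * gag g
      = (\<integral>\<^sup>+n. ennreal (r / 2) * ennreal (2 * pi * (cmod (fco g n))\<^sup>2) \<partial>?C)
        + (\<integral>\<^sup>+n. ennreal (1 / 2) * ennreal (4 * pi\<^sup>2 * \<bar>of_int n\<bar> * (cmod (fco g n))\<^sup>2) \<partial>?C)"
      unfolding gag_def gagliardo_fourier[OF that] parseval[OF that] by (simp add: nn_integral_cmult)
    also have "\<dots> = (\<integral>\<^sup>+n. ennreal (r / 2) * ennreal (2 * pi * (cmod (fco g n))\<^sup>2)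
         + ennreal (1 / 2) * ennreal (4 * pi\<^sup>2 * \<bar>of_int n\<bar> * (cmod (fco g n))\<^sup>2) \<partial>?C)"
      by (rule nn_integral_add[symmetric]) auto
    also have "\<dots> = (\<integral>\<^sup>+n. ennreal (w n / 2 * (cmod (fco g n))\<^sup>2) \<partial>?C)"
    proof (rule nn_integral_cong)
      fix n :: int
      have "ennreal (r / 2) * ennreal (2 * pi * (cmod (fco g n))\<^sup>2)
         + ennreal (1 / 2) * ennreal (4 * pi\<^sup>2 * \<bar>of_int n\<bar> * (cmod (fco g n))\<^sup>2)
         = ennreal (r / 2 * (2 * pi * (cmod (fco g n))\<^sup>2) + 1 / 2 * (4 * pi\<^sup>2 * \<bar>of_int n\<bar> * (cmod (fco g n))\<^sup>2))"
        using r by (intro ennreal_lin_comb(1)) auto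
      also have "r / 2 * (2 * pi * (cmod (fco g n))\<^sup>2) + 1 / 2 * (4 * pi\<^sup>2 * \<bar>of_int n\<bar> * (cmod (fco g n))\<^sup>2)
         = w n / 2 * (cmod (fco g n))\<^sup>2" by (simp add: w_def field_simps)
      finally show "ennreal (r / 2) * ennreal (2 * pi * (cmod (fco g n))\<^sup>2)
         + ennreal (1 / 2) * ennreal (4 * pi\<^sup>2 * \<bar>of_int n\<bar> * (cmod (fco g n))\<^sup>2) = ennreal (w n / 2 * (cmod (fco g n))\<^sup>2)" .
    qed
    finally show ?thesis .
  qed
  \<comment> \<open>The coefficients \<open>cf\<close> pair index n of \<open>gp\<close> with index
    - n of \<open>gm\<close>; the weight is even, so the sum for \<open>gm\<close> may be
    reindexed.\<close>
  have neg: "(\<integral>\<^sup>+n. ennreal (w n / 2 * (cmod (fco g n))\<^sup>2) \<partial>?C) = (\<integral>\<^sup>+n. ennreal (w n / 2 * (cmod (fco g (- n)))\<^sup>2) \<partial>?C)" for g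
  proof -
    have "bij_betw uminus (UNIV :: int set) UNIV" by (rule bij_uminus)
    from nn_integral_bij_count_space[OF this, of "\<lambda>n. ennreal (w n / 2 * (cmod (fco g n))\<^sup>2)"]
    show ?thesis by (simp add: w_def)
  qed
  have "h_half_energy S f = (ennreal (r / 2) * sq (gp f) + ennreal (1/2) * gag (gp f)) + (ennreal (r / 2) * sq (gm f) + ennreal (1/2) * gag (gm f))"
    unfolding h_half_energy_def energy_L2[OF f] energy_gagliardo[OF f] by (simp add: distrib_left add_ac)
  also have "\<dots> = (\<integral>\<^sup>+n. ennreal (w n / 2 * (cmod (fco (gp f) n))\<^sup>2) \<partial>?C) + (\<integral>\<^sup>+n. ennreal (w n / 2 * (cmod (fco (gm f) (- n)))\<^sup>2) \<partial>?C)"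
    by (simp only: one gp_measurable gm_measurable f fin neg[symmetric])
  also have "\<dots> = (\<integral>\<^sup>+n. ennreal (w n / 2 * (cmod (fco (gp f) n))\<^sup>2) + ennreal (w n / 2 * (cmod (fco (gm f) (- n)))\<^sup>2) \<partial>?C)"
    by (rule nn_integral_add[symmetric]) auto
  also have "\<dots> = (\<integral>\<^sup>+n. ennreal (wt (False, n) * (cmod (cf f (False, n)))\<^sup>2) + ennreal (wt (True, n) * (cmod (cf f (True, n)))\<^sup>2) \<partial>?C)"
  proof (rule nn_integral_cong)
    fix n :: int
    have "w n / 2 * (cmod (fco (gp f) n))\<^sup>2 + w n / 2 * (cmod (fco (gm f) (- n)))\<^sup>2
       = w n * ((cmod (cf f (False, n)))\<^sup>2 + (cmod (cf f (True, n)))\<^sup>2)"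
      unfolding cf_sq by (simp add: algebra_simps)
    also have "\<dots> = wt (False, n) * (cmod (cf f (False, n)))\<^sup>2 + wt (True, n) * (cmod (cf f (True, n)))\<^sup>2"
      by (simp add: w_def wt_def algebra_simps)
    finally show "ennreal (w n / 2 * (cmod (fco (gp f) n))\<^sup>2) + ennreal (w n / 2 * (cmod (fco (gm f) (- n)))\<^sup>2)
       = ennreal (wt (False, n) * (cmod (cf f (False, n)))\<^sup>2) + ennreal (wt (True, n) * (cmod (cf f (True, n)))\<^sup>2)"
      using w0 wt_pos[THEN less_imp_le] by (simp add: ennreal_plus[symmetric] del: ennreal_plus)
  qed
  also have "\<dots> = (\<integral>\<^sup>+n. ennreal (wt (False, n) * (cmod (cf f (False, n)))\<^sup>2) \<partial>?C) + (\<integral>\<^sup>+n. ennreal (wt (True, n) * (cmod (cf f (True, n)))\<^sup>2) \<partial>?C)"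
    by (rule nn_integral_add) auto
  also have "\<dots> = (\<integral>\<^sup>+a. (\<integral>\<^sup>+n. ennreal (wt (a, n) * (cmod (cf f (a, n)))\<^sup>2) \<partial>?C) \<partial>count_space UNIV)"
    by (subst (3) nn_integral_count_space_finite) (auto simp: UNIV_bool)
  also have "\<dots> = (\<integral>\<^sup>+i. ennreal (wt i * (cmod (cf f i))\<^sup>2) \<partial>count_space UNIV)"
    by (rule nn_integral_fst_count_space)
  finally show ?thesis .
qed

lemma h_half_L2:
  assumes "f \<in> h_half S"
  shows "f \<in> borel_measurable S" "sq (gp f) < \<infinity>" "sq (gm f) < \<infinity>"
proof -
  show f: "f \<in> borel_measurable S" using assms by (simp add: h_half_def)
  have "h_half_energy S f < \<infinity>" using assms by (simp add: h_half_def)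
  then have "ennreal (r / 2) * (sq (gp f) + sq (gm f)) < \<infinity>"
    unfolding h_half_energy_def energy_L2[OF f] by (auto simp: less_top)
  then show "sq (gp f) < \<infinity>" "sq (gm f) < \<infinity>"
    using r by (auto simp: ennreal_mult_less_top ennreal_eq_0_iff)
qed

lemma h_half_norm_has_sum:
  assumes "f \<in> h_half S"
  shows "((\<lambda>i. wt i * (cmod (cf f i))\<^sup>2) has_sum (h_half_norm S f)\<^sup>2) UNIV"
proof -
  have fin: "h_half_energy S f < \<infinity>" using assms by (simp add: h_half_def)
  have "((\<lambda>i. wt i * (cmod (cf f i))\<^sup>2) has_sum enn2real (h_half_energy S f)) UNIV"
    using has_sum_of_nn_integral_count_space[of "\<lambda>i. wt i * (cmod (cf f i))\<^sup>2"] fin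
    unfolding energy_fourier[OF h_half_L2[OF assms]] by (simp add: wt_pos[THEN less_imp_le])
  then show ?thesis by (simp add: h_half_norm_def)
qed

lemma h_halfI:
  assumes f: "f \<in> borel_measurable S" "sq (gp f) < \<infinity>" "sq (gm f) < \<infinity>"
    and s: "((\<lambda>i. wt i * (cmod (cf f i))\<^sup>2) summable_on UNIV)"
  shows "f \<in> h_half S"
proof -
  have "h_half_energy S f = ennreal (infsum (\<lambda>i. wt i * (cmod (cf f i))\<^sup>2) UNIV)"
    unfolding energy_fourier[OF f]
    by (rule nn_integral_count_space_has_sum[OF _ has_sum_infsum[OF s]]) (simp add: wt_pos[THEN less_imp_le])
  then show ?thesis using f by (simp add: h_half_def)
qed

section \<open>Linear structure of H^(1/2)\<close>

lemma h_half_integrable: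
  assumes "f \<in> h_half S" shows "integrable ucirc (gp f)" "integrable ucirc (gm f)"
  using h_half_L2[OF assms] by (auto intro!: integrable_of_sq(3) gp_measurable gm_measurable)

lemma gp_add: "gp (\<lambda>x. f x + g x) = (\<lambda>z. gp f z + gp g z)"
  and gm_add: "gm (\<lambda>x. f x + g x) = (\<lambda>z. gm f z + gm g z)"
  and gp_cmult: "gp (\<lambda>x. a *s f x) = (\<lambda>z. a * gp f z)"
  and gm_cmult: "gm (\<lambda>x. a *s f x) = (\<lambda>z. a * gm f z)"
  by (auto simp: gp_def gm_def bp_def bm_def algebra_simps)

lemma cf_add:
  assumes "f \<in> h_half S" "g \<in> h_half S"
  shows "cf (\<lambda>x. f x + g x) i = cf f i + cf g i"
  using h_half_integrable[OF assms(1)] h_half_integrable[OF assms(2)]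
  by (simp add: cf_def gp_add gm_add fco_add field_simps)

lemma cf_cmult: "cf (\<lambda>x. a *s f x) i = a * cf f i"
  by (simp add: cf_def gp_cmult gm_cmult fco_cmult field_simps)

lemma h_half_add:
  assumes f: "f \<in> h_half S" and g: "g \<in> h_half S"
  shows "(\<lambda>x. f x + g x) \<in> h_half S"
proof (rule h_halfI)
  note [measurable] = h_half_L2(1)[OF f] h_half_L2(1)[OF g]
  show "(\<lambda>x. f x + g x) \<in> borel_measurable S" by measurable
  show "sq (gp (\<lambda>x. f x + g x)) < \<infinity>" "sq (gm (\<lambda>x. f x + g x)) < \<infinity>"
    unfolding gp_add gm_add using h_half_L2[OF f] h_half_L2[OF g]
    by (auto intro!: order_le_less_trans[OF sq_add_le] gp_measurable gm_measurable simp: ennreal_mult_less_top)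
  have "(\<lambda>i. 2 * (wt i * (cmod (cf f i))\<^sup>2) + 2 * (wt i * (cmod (cf g i))\<^sup>2)) summable_on UNIV"
    by (intro summable_on_add summable_on_cmult_right has_sum_imp_summable[OF h_half_norm_has_sum] f g)
  then show "(\<lambda>i. wt i * (cmod (cf (\<lambda>x. f x + g x) i))\<^sup>2) summable_on UNIV"
  proof (rule summable_on_comparison_test)
    fix i
    have "(cmod (cf f i + cf g i))\<^sup>2 \<le> (cmod (cf f i) + cmod (cf g i))\<^sup>2"
      by (intro power_mono norm_triangle_ineq) auto
    also have "\<dots> \<le> 2 * (cmod (cf f i))\<^sup>2 + 2 * (cmod (cf g i))\<^sup>2"
      using sum_squares_bound[of "cmod (cf f i)" "cmod (cf g i)"] by (simp add: power2_sum)
    finally have "wt i * (cmod (cf f i + cf g i))\<^sup>2 \<le> wt i * (2 * (cmod (cf f i))\<^sup>2 + 2 * (cmod (cf g i))\<^sup>2)"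
      using wt_pos[of i] by (intro mult_left_mono) auto
    then show "wt i * (cmod (cf (\<lambda>x. f x + g x) i))\<^sup>2 \<le> 2 * (wt i * (cmod (cf f i))\<^sup>2) + 2 * (wt i * (cmod (cf g i))\<^sup>2)"
      by (simp add: cf_add f g algebra_simps)
  qed (simp add: wt_pos[THEN less_imp_le])
qed

lemma h_half_cmult:
  assumes f: "f \<in> h_half S"
  shows "(\<lambda>x. a *s f x) \<in> h_half S"
proof (rule h_halfI)
  note fL = h_half_L2[OF f]
  have "(\<lambda>z. mk2 (a * gp f z) (a * gm f z)) \<in> borel_measurable ucirc"
    using gp_measurable[OF fL(1)] gm_measurable[OF fL(1)] by (intro borel_measurable_mk2) auto
  moreover have "mk2 (a * gp f z) (a * gm f z) = a *s f (pt c r z)" for z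
    by (simp add: gp_def gm_def mk2_def bp_def bm_def vec_eq_iff forall_2 field_simps)
  ultimately show "(\<lambda>x. a *s f x) \<in> borel_measurable S"
    by (simp add: measurable_circle_iff[OF r])
  show "sq (gp (\<lambda>x. a *s f x)) < \<infinity>" "sq (gm (\<lambda>x. a *s f x)) < \<infinity>"
    unfolding gp_cmult gm_cmult using fL
    by (auto simp: sq_cmult gp_measurable gm_measurable ennreal_mult_less_top)
  have "(\<lambda>i. (cmod a)\<^sup>2 * (wt i * (cmod (cf f i))\<^sup>2)) summable_on UNIV"
    by (intro summable_on_cmult_right has_sum_imp_summable[OF h_half_norm_has_sum] f)
  then show "(\<lambda>i. wt i * (cmod (cf (\<lambda>x. a *s f x) i))\<^sup>2) summable_on UNIV"
    by (simp add: cf_cmult norm_mult power_mult_distrib mult_ac)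
qed

end

section \<open>The dual space as a weighted sequence space\<close>

text \<open>Cauchy-Schwarz against the constant 1, obtained from the nonnegative variance of cmod (g
  z) about its mean \<open>m\<close>.\<close>

lemma integral_norm_le_sqrt:
  assumes g: "g \<in> borel_measurable ucirc" "sq g < \<infinity>"
  shows "(LINT z|ucirc. cmod (g z)) \<le> sqrt (2 * pi * enn2real (sq g))"
proof -
  note I = integrable_of_sq[OF g]
  define s where "s = (LINT z|ucirc. (cmod (g z))\<^sup>2)"
  define a where "a = (LINT z|ucirc. cmod (g z))"
  define m where "m = a / (2 * pi)"
  have "0 \<le> (LINT z|ucirc. (cmod (g z) - m)\<^sup>2)" by simp
  also have "\<dots> = (LINT z|ucirc. (cmod (g z))\<^sup>2 - 2 * m * cmod (g z) + m\<^sup>2)"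
    by (simp add: power2_diff algebra_simps)
  also have "\<dots> = s - 2 * m * a + 2 * pi * m\<^sup>2"
    using I by (simp add: s_def a_def)
  also have "\<dots> = s - a\<^sup>2 / (2 * pi)" by (simp add: m_def power2_eq_square field_simps)
  finally have "a\<^sup>2 \<le> 2 * pi * s" by (simp add: field_simps)
  moreover have "enn2real (sq g) = s" unfolding I(2) s_def by simp
  ultimately show ?thesis by (simp add: a_def real_le_rsqrt)
qed

context elastic_disk begin

text \<open>The powers are the two components of the rotating unit field of index n; the factors i
  and - i are those of its quarter turn.\<close>

definition ef :: "bool \<times> int \<Rightarrow> field" where
  "ef i x = mk2 ((if fst i then \<i> else 1) * unpt c r x powi snd i) ((if fst i then - \<i> else 1) * unpt c r x powi (- snd i))"

lemma gp_ef: "gp (ef i) = (\<lambda>z. (if fst i then \<i> else 1) * z powi snd i)"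
  and gm_ef: "gm (ef i) = (\<lambda>z. (if fst i then - \<i> else 1) * z powi (- snd i))"
  by (auto simp: gp_def gm_def ef_def r)

lemma cf_ef: "cf (ef j) i = (if i = j then 1 else 0)"
  by (cases i; cases j) (auto simp: cf_def gp_ef gm_ef fco_powi fco_cmult[of \<i>] fco_cmult[of "- \<i>", simplified])

lemma ef_measurable: "ef i \<in> borel_measurable S"
proof -
  have "(\<lambda>z. mk2 (gp (ef i) z) (gm (ef i) z)) \<in> borel_measurable ucirc"
    unfolding gp_ef gm_ef by (intro borel_measurable_mk2) auto
  then show ?thesis unfolding measurable_circle_iff[OF r] by (simp add: gp_def gm_def)
qed

lemma ef_bounded: "norm z = 1 \<Longrightarrow> cmod (gp (ef i) z) \<le> 1" "norm z = 1 \<Longrightarrow> cmod (gm (ef i) z) \<le> 1"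
  by (auto simp: gp_ef gm_ef norm_mult norm_power_int)

lemma summable_on_single: "(\<lambda>j. if j = i then a else 0) summable_on UNIV"
  for a :: "'b :: {comm_monoid_add, topological_space}"
  by (rule summable_on_cong_neutral[THEN iffD1, of UNIV "{i}" _ "\<lambda>j. a"]) auto

lemma ef_h_half: "ef i \<in> h_half S"
proof (rule h_halfI[OF ef_measurable])
  show "sq (gp (ef i)) < \<infinity>" "sq (gm (ef i)) < \<infinity>"
    by (rule order_le_less_trans[OF sq_le_const[OF ef_bounded(1)]], assumption, simp)
       (rule order_le_less_trans[OF sq_le_const[OF ef_bounded(2)]], assumption, simp)
  have "(\<lambda>j. wt j * (cmod (cf (ef i) j))\<^sup>2) = (\<lambda>j. if j = i then wt i else 0)" by (auto simp: cf_ef)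
  then show "(\<lambda>j. wt j * (cmod (cf (ef i) j))\<^sup>2) summable_on UNIV" by (simp only: summable_on_single)
qed

section \<open>Trigonometric polynomial fields\<close>

definition tp :: "(bool \<times> int) set \<Rightarrow> (bool \<times> int \<Rightarrow> complex) \<Rightarrow> field" where
  "tp F a = (\<lambda>x. \<Sum>i\<in>F. a i *s ef i x)"

lemma zero_h_half: "(\<lambda>x. 0) \<in> h_half S"
  using h_half_cmult[OF ef_h_half[of "(False, 0)"], of 0] by simp

lemma tp_insert: "finite F \<Longrightarrow> i \<notin> F \<Longrightarrow> tp (insert i F) a = (\<lambda>x. a i *s ef i x + tp F a x)"
  by (simp add: tp_def)

lemma tp_h_half: "finite F \<Longrightarrow> tp F a \<in> h_half S"
proof (induction F rule: finite_induct)
  case empty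
  then show ?case using zero_h_half by (simp add: tp_def)
next
  case (insert i F)
  then show ?case unfolding tp_insert[OF insert(1,2)] by (intro h_half_add h_half_cmult ef_h_half)
qed

lemma cf_zero: "cf (\<lambda>x. 0) i = 0"
  using cf_cmult[of 0 "ef i" i] by simp

lemma cf_tp: "finite F \<Longrightarrow> cf (tp F a) j = (if j \<in> F then a j else 0)"
proof (induction F rule: finite_induct)
  case empty
  then show ?case using cf_zero by (simp add: tp_def)
next
  case (insert i F)
  have "cf (tp (insert i F) a) j = a i * cf (ef i) j + cf (tp F a) j"
    unfolding tp_insert[OF insert(1,2)]
    by (subst cf_add) (auto simp: cf_cmult intro: h_half_cmult ef_h_half tp_h_half insert)
  then show ?case using insert by (auto simp: cf_ef)
qed

lemma has_sum_finite_support: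
  fixes h :: "'i \<Rightarrow> 'b :: {comm_monoid_add, topological_space}"
  assumes "finite F" shows "((\<lambda>i. if i \<in> F then h i else 0) has_sum (\<Sum>i\<in>F. h i)) UNIV"
  by (rule has_sum_cong_neutral[THEN iffD1, OF _ _ _ has_sum_finite[OF assms]]) auto

lemma norm_tp:
  assumes "finite F" shows "(h_half_norm S (tp F a))\<^sup>2 = (\<Sum>i\<in>F. wt i * (cmod (a i))\<^sup>2)"
proof -
  have "(\<lambda>i. wt i * (cmod (cf (tp F a) i))\<^sup>2) = (\<lambda>i. if i \<in> F then wt i * (cmod (a i))\<^sup>2 else 0)"
    using assms by (auto simp: cf_tp)
  then have "((\<lambda>i. wt i * (cmod (cf (tp F a) i))\<^sup>2) has_sum (\<Sum>i\<in>F. wt i * (cmod (a i))\<^sup>2)) UNIV"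
    by (simp only: has_sum_finite_support[OF assms])
  then show ?thesis
    by (rule has_sum_unique[OF h_half_norm_has_sum[OF tp_h_half[OF assms]]])
qed

lemma h_half_norm_nonneg: "h_half_norm S f \<ge> 0"
  by (simp add: h_half_norm_def)

section \<open>Functionals and their coordinate sequences\<close>

definition uc :: "functional \<Rightarrow> bool \<times> int \<Rightarrow> complex" where "uc u i = u (ef i)"

text \<open>The inverse weights are the ones dual to \<open>wt\<close>; \<open>uc\<close> and
  \<open>seqfun\<close> will be inverse bijections between the dual and these sequences.\<close>

definition ell :: "(bool \<times> int \<Rightarrow> complex) \<Rightarrow> bool" where
  "ell d \<longleftrightarrow> (\<lambda>i. (cmod (d i))\<^sup>2 / wt i) summable_on UNIV"

definition ellsq :: "(bool \<times> int \<Rightarrow> complex) \<Rightarrow> real" where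
  "ellsq d = infsum (\<lambda>i. (cmod (d i))\<^sup>2 / wt i) UNIV"

definition seqfun :: "(bool \<times> int \<Rightarrow> complex) \<Rightarrow> functional" where
  "seqfun d f = (if f \<in> h_half S then infsum (\<lambda>i. d i * cf f i) UNIV else 0)"

lemma ellsq_nonneg: "ellsq d \<ge> 0"
  unfolding ellsq_def by (intro infsum_nonneg) (simp add: wt_pos[THEN less_imp_le])

lemma mhalf_add: "u \<in> h_mhalf S \<Longrightarrow> f \<in> h_half S \<Longrightarrow> g \<in> h_half S \<Longrightarrow> u (\<lambda>x. f x + g x) = u f + u g"
  and mhalf_cmult: "u \<in> h_mhalf S \<Longrightarrow> f \<in> h_half S \<Longrightarrow> u (\<lambda>x. a *s f x) = a * u f"
  and mhalf_off: "u \<in> h_mhalf S \<Longrightarrow> f \<notin> h_half S \<Longrightarrow> u f = 0"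
  by (auto simp: h_mhalf_def)

lemma mhalf_bound:
  assumes "u \<in> h_mhalf S"
  obtains C where "C \<ge> 0" "\<And>f. f \<in> h_half S \<Longrightarrow> cmod (u f) \<le> C * h_half_norm S f"
proof -
  obtain C where C: "\<And>f. f \<in> h_half S \<Longrightarrow> cmod (u f) \<le> C * h_half_norm S f"
    using assms unfolding h_mhalf_def by blast
  show ?thesis
  proof (rule that[of "\<bar>C\<bar>"])
    fix f assume "f \<in> h_half S"
    then have "cmod (u f) \<le> C * h_half_norm S f" by (rule C)
    also have "\<dots> \<le> \<bar>C\<bar> * h_half_norm S f" by (intro mult_right_mono h_half_norm_nonneg) auto
    finally show "cmod (u f) \<le> \<bar>C\<bar> * h_half_norm S f" .
  qed simp
qed

lemma mhalf_tp:
  assumes u: "u \<in> h_mhalf S" and "finite F"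
  shows "u (tp F a) = (\<Sum>i\<in>F. a i * uc u i)"
  using assms(2)
proof (induction F rule: finite_induct)
  case empty
  show ?case using mhalf_cmult[OF u ef_h_half, of 0] by (simp add: tp_def)
next
  case (insert i F)
  have "u (tp (insert i F) a) = a i * u (ef i) + u (tp F a)"
    unfolding tp_insert[OF insert(1,2)]
    by (simp add: mhalf_add[OF u h_half_cmult[OF ef_h_half] tp_h_half[OF insert(1)]] mhalf_cmult[OF u ef_h_half])
  then show ?case using insert by (simp add: uc_def)
qed

text \<open>The remainder of f after a finite partial sum has squared norm equal to a tail of the
  sum for the norm of f, so it tends to zero and boundedness of u does the rest.\<close>

lemma mhalf_has_sum:
  assumes u: "u \<in> h_mhalf S" and f: "f \<in> h_half S"
  shows "((\<lambda>i. uc u i * cf f i) has_sum u f) UNIV"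
proof -
  obtain C where C: "C \<ge> 0" "\<And>f. f \<in> h_half S \<Longrightarrow> cmod (u f) \<le> C * h_half_norm S f"
    using mhalf_bound[OF u] by blast
  let ?N = "(h_half_norm S f)\<^sup>2"
  let ?s = "\<lambda>F. \<Sum>i\<in>F. wt i * (cmod (cf f i))\<^sup>2"
  have le: "dist (\<Sum>i\<in>F. uc u i * cf f i) (u f) \<le> C * sqrt (?N - ?s F)" if F: "finite F" for F
  proof -
    define g where "g = (\<lambda>x. f x + (- 1) *s tp F (cf f) x)"
    have g: "g \<in> h_half S" unfolding g_def by (intro h_half_add h_half_cmult tp_h_half f F)
    have cg: "cf g i = (if i \<in> F then 0 else cf f i)" for i
      unfolding g_def by (simp only: cf_add[OF f h_half_cmult[OF tp_h_half[OF F]]] cf_cmult cf_tp[OF F]) auto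
    have "((\<lambda>i. wt i * (cmod (cf f i))\<^sup>2 + - (if i \<in> F then wt i * (cmod (cf f i))\<^sup>2 else 0)) has_sum ?N + - ?s F) UNIV"
      by (intro has_sum_add h_half_norm_has_sum[OF f] has_sum_uminusI has_sum_finite_support F)
    moreover have "(\<lambda>i. wt i * (cmod (cf f i))\<^sup>2 + - (if i \<in> F then wt i * (cmod (cf f i))\<^sup>2 else 0)) = (\<lambda>i. wt i * (cmod (cf g i))\<^sup>2)"
      by (auto simp: cg)
    ultimately have "(h_half_norm S g)\<^sup>2 = ?N - ?s F"
      using has_sum_unique[OF h_half_norm_has_sum[OF g]] by simp
    then have "h_half_norm S g = sqrt (?N - ?s F)"
      using h_half_norm_nonneg[of g] by (metis real_sqrt_unique)
    moreover have "u g = u f - (\<Sum>i\<in>F. uc u i * cf f i)"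
      unfolding g_def using mhalf_add[OF u f h_half_cmult[OF tp_h_half[OF F], of "- 1"]]
        mhalf_cmult[OF u tp_h_half[OF F], of "- 1"] mhalf_tp[OF u F, of "cf f"]
      by (simp add: mult.commute[of "cf f _"] del: vector_sneg_minus1)
    ultimately show ?thesis using C(2)[OF g] by (simp add: dist_norm norm_minus_commute)
  qed
  have "(?s \<longlongrightarrow> ?N) (finite_subsets_at_top UNIV)"
    using h_half_norm_has_sum[OF f] by (simp add: has_sum_def)
  then have "((\<lambda>F. C * sqrt (?N - ?s F)) \<longlongrightarrow> C * sqrt (?N - ?N)) (finite_subsets_at_top UNIV)"
    by (intro tendsto_intros)
  then have "((\<lambda>F. C * sqrt (?N - ?s F)) \<longlongrightarrow> 0) (finite_subsets_at_top UNIV)" by simp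
  then show ?thesis
    unfolding has_sum_def tendsto_dist_iff[of "sum _"]
    by (rule tendsto_sandwich[OF _ _ tendsto_const, rotated 2]) (auto intro!: eventually_finite_subsets_at_top_weakI le)
qed

text \<open>The device behind all later identities between functionals: they are checked on one
  coordinate at a time.\<close>

lemma mhalf_ext:
  assumes "u \<in> h_mhalf S" "v \<in> h_mhalf S" "\<And>i. uc u i = uc v i"
  shows "u = v"
proof
  fix f
  have eq: "uc u = uc v" using assms(3) by auto
  show "u f = v f"
  proof (cases "f \<in> h_half S")
    case True
    show ?thesis
      using has_sum_unique[OF mhalf_has_sum[OF assms(1) True, unfolded eq] mhalf_has_sum[OF assms(2) True]] .
  qed (simp add: mhalf_off assms)
qed

lemma sum_uc_le:
  assumes u: "u \<in> h_mhalf S" and "C \<ge> 0" and C: "\<And>f. f \<in> h_half S \<Longrightarrow> cmod (u f) \<le> C * h_half_norm S f"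
    and F: "finite F"
  shows "(\<Sum>i\<in>F. (cmod (uc u i))\<^sup>2 / wt i) \<le> C\<^sup>2"
proof -
  define A where "A = (\<Sum>i\<in>F. (cmod (uc u i))\<^sup>2 / wt i)"
  \<comment> \<open>The extremal test field on F: u takes the value A on it, and its norm is sqrt
    A.\<close>
  define a where "a i = cnj (uc u i) / of_real (wt i)" for i
  have A0: "A \<ge> 0" unfolding A_def by (intro sum_nonneg) (simp add: wt_pos[THEN less_imp_le])
  have "u (tp F a) = of_real A"
    unfolding mhalf_tp[OF u F] A_def of_real_sum
    by (intro sum.cong refl) (simp only: a_def of_real_divide complex_norm_square times_divide_eq_left mult.commute times_divide_eq_right)
  moreover have "(h_half_norm S (tp F a))\<^sup>2 = A"
    unfolding norm_tp[OF F] A_def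
  proof (intro sum.cong refl)
    fix i
    show "wt i * (cmod (a i))\<^sup>2 = (cmod (uc u i))\<^sup>2 / wt i"
      using wt_pos[of i] by (simp add: a_def norm_divide power_divide) (simp add: power2_eq_square field_simps)
  qed
  then have "h_half_norm S (tp F a) = sqrt A"
    using h_half_norm_nonneg by (metis real_sqrt_unique)
  ultimately have "A \<le> C * sqrt A"
    using C[OF tp_h_half[OF F, of a]] A0 by simp
  then have "sqrt A * sqrt A \<le> C * sqrt A" using A0 by simp
  then have "sqrt A \<le> C" if "A \<noteq> 0"
    by (rule mult_right_le_imp_le) (use A0 that in simp)
  then have "sqrt A \<le> C" using \<open>C \<ge> 0\<close> by (cases "A = 0") auto
  then have "(sqrt A)\<^sup>2 \<le> C\<^sup>2" using A0 by (intro power_mono) auto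
  then show ?thesis using A0 by (simp add: A_def)
qed

lemma ell_uc: assumes u: "u \<in> h_mhalf S" shows "ell (uc u)"
proof -
  obtain C where C: "C \<ge> 0" "\<And>f. f \<in> h_half S \<Longrightarrow> cmod (u f) \<le> C * h_half_norm S f"
    using mhalf_bound[OF u] by blast
  show ?thesis
    unfolding ell_def
    by (rule nonneg_bdd_above_summable_on)
       (auto simp: wt_pos[THEN less_imp_le] bdd_above_def intro!: exI[of _ "C\<^sup>2"] sum_uc_le[OF u C])
qed

lemma cauchy_schwarz_coeff:
  assumes d: "ell d" and f: "f \<in> h_half S" and F: "finite F"
  shows "(\<Sum>i\<in>F. cmod (d i * cf f i)) \<le> sqrt (ellsq d) * h_half_norm S f"
proof -
  have "(\<Sum>i\<in>F. cmod (d i * cf f i)) = (\<Sum>i\<in>F. (cmod (d i) / sqrt (wt i)) * (sqrt (wt i) * cmod (cf f i)))"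
    by (intro sum.cong refl) (simp add: norm_mult wt_pos less_imp_neq[OF wt_pos, symmetric])
  also have "\<dots> \<le> sqrt ((\<Sum>i\<in>F. (cmod (d i) / sqrt (wt i))\<^sup>2) * (\<Sum>i\<in>F. (sqrt (wt i) * cmod (cf f i))\<^sup>2))"
    by (intro real_le_rsqrt Cauchy_Schwarz_ineq_sum)
  also have "\<dots> = sqrt (\<Sum>i\<in>F. (cmod (d i))\<^sup>2 / wt i) * sqrt (\<Sum>i\<in>F. wt i * (cmod (cf f i))\<^sup>2)"
    by (simp add: real_sqrt_mult power_divide power_mult_distrib wt_pos less_imp_le[OF wt_pos])
  also have "\<dots> \<le> sqrt (ellsq d) * sqrt ((h_half_norm S f)\<^sup>2)"
  proof (intro mult_mono real_sqrt_le_mono)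
    show "(\<Sum>i\<in>F. (cmod (d i))\<^sup>2 / wt i) \<le> ellsq d"
      unfolding ellsq_def using d F by (intro finite_sum_le_infsum) (auto simp: ell_def less_imp_le[OF wt_pos])
    show "(\<Sum>i\<in>F. wt i * (cmod (cf f i))\<^sup>2) \<le> (h_half_norm S f)\<^sup>2"
      using h_half_norm_has_sum[OF f] F by (intro finite_sum_le_has_sum) (auto simp: less_imp_le[OF wt_pos])
  qed (auto simp: ellsq_nonneg intro!: sum_nonneg mult_nonneg_nonneg less_imp_le[OF wt_pos])
  finally show ?thesis by (simp add: h_half_norm_nonneg)
qed

lemma coeff_summable:
  assumes d: "ell d" and f: "f \<in> h_half S"
  shows "(\<lambda>i. cmod (d i * cf f i)) summable_on UNIV" and "(\<lambda>i. d i * cf f i) summable_on UNIV"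
proof -
  show *: "(\<lambda>i. cmod (d i * cf f i)) summable_on UNIV"
    by (rule nonneg_bdd_above_summable_on) (auto simp: bdd_above_def intro!: exI cauchy_schwarz_coeff[OF assms])
  show "(\<lambda>i. d i * cf f i) summable_on UNIV" by (rule abs_summable_summable[OF *])
qed

lemma seqfun_bound:
  assumes d: "ell d" and f: "f \<in> h_half S"
  shows "cmod (seqfun d f) \<le> sqrt (ellsq d) * h_half_norm S f"
proof -
  have "cmod (seqfun d f) \<le> infsum (\<lambda>i. cmod (d i * cf f i)) UNIV"
    using norm_infsum_bound[OF coeff_summable(1)[OF assms]] f by (simp add: seqfun_def)
  also have "\<dots> \<le> sqrt (ellsq d) * h_half_norm S f"
    by (intro infsum_le_finite_sums coeff_summable(1) cauchy_schwarz_coeff assms)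
  finally show ?thesis .
qed

lemma seqfun_mhalf:
  assumes d: "ell d" shows "seqfun d \<in> h_mhalf S"
  unfolding h_mhalf_def
proof (intro CollectI conjI ballI allI impI)
  fix f g assume f: "f \<in> h_half S" and g: "g \<in> h_half S"
  have "(\<lambda>i. d i * cf (\<lambda>x. f x + g x) i) = (\<lambda>i. d i * cf f i + d i * cf g i)"
    by (simp add: cf_add f g algebra_simps)
  then show "seqfun d (\<lambda>x. f x + g x) = seqfun d f + seqfun d g"
    using f g by (simp add: seqfun_def h_half_add infsum_add coeff_summable d)
next
  fix a f assume f: "f \<in> h_half S"
  have "(\<lambda>i. d i * cf (\<lambda>x. a *s f x) i) = (\<lambda>i. a * (d i * cf f i))"
    by (simp add: cf_cmult algebra_simps)
  then show "seqfun d (\<lambda>x. a *s f x) = a * seqfun d f"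
    using f by (simp add: seqfun_def h_half_cmult infsum_cmult_right')
next
  show "\<exists>C. \<forall>f\<in>h_half S. cmod (seqfun d f) \<le> C * h_half_norm S f"
    using seqfun_bound[OF d] by blast
qed (simp add: seqfun_def)

lemma uc_seqfun: "uc (seqfun d) i = d i"
proof -
  have "((\<lambda>j. if j \<in> {i} then d j else 0) has_sum (\<Sum>j\<in>{i}. d j)) UNIV"
    by (rule has_sum_finite_support) simp
  then have "((\<lambda>j. d j * cf (ef i) j) has_sum d i) UNIV"
    by (simp add: cf_ef if_distrib cong: if_cong)
  then show ?thesis by (simp add: uc_def seqfun_def ef_h_half infsumI)
qed

lemma seqfun_uc: "u \<in> h_mhalf S \<Longrightarrow> seqfun (uc u) = u"
  by (rule mhalf_ext) (auto simp: uc_seqfun seqfun_mhalf ell_uc)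

text \<open>One inequality is Cauchy-Schwarz. For the other, the supremum itself is, after
  normalising the test field, an admissible constant in \<open>sum_uc_le\<close>.\<close>

lemma mhalf_norm_eq:
  assumes u: "u \<in> h_mhalf S"
  shows "h_mhalf_norm S u = sqrt (ellsq (uc u))"
proof -
  let ?X = "{cmod (u f) |f. f \<in> h_half S \<and> h_half_norm S f \<le> 1}"
  have bd: "cmod (u f) \<le> sqrt (ellsq (uc u)) * h_half_norm S f" if "f \<in> h_half S" for f
    using seqfun_bound[OF ell_uc[OF u] that] by (simp add: seqfun_uc u)
  have X: "x \<le> sqrt (ellsq (uc u))" if "x \<in> ?X" for x
  proof -
    obtain f where f: "x = cmod (u f)" "f \<in> h_half S" "h_half_norm S f \<le> 1" using \<open>x \<in> ?X\<close> by auto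
    have "x \<le> sqrt (ellsq (uc u)) * h_half_norm S f" using f bd by simp
    also have "\<dots> \<le> sqrt (ellsq (uc u)) * 1" using f by (intro mult_left_mono) (auto simp: ellsq_nonneg)
    finally show ?thesis by simp
  qed
  have n0: "h_half_norm S (\<lambda>x. 0) = 0"
    using norm_tp[of "{}" "\<lambda>_. 0"] by (simp add: tp_def)
  have u0: "u (\<lambda>x. 0) = 0" using mhalf_tp[OF u, of "{}" "\<lambda>_. 0"] by (simp add: tp_def)
  have ne: "0 \<in> ?X" using n0 u0 zero_h_half by (intro CollectI exI[of _ "\<lambda>x. 0"]) simp
  have bdd: "bdd_above ?X" using X by (intro bdd_aboveI)
  define C where "C = Sup ?X"
  have C0: "C \<ge> 0" unfolding C_def by (rule cSup_upper[OF ne bdd])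
  have "cmod (u f) \<le> C * h_half_norm S f" if f: "f \<in> h_half S" for f
  \<comment> \<open>\<open>h_half_norm\<close> is only a seminorm on functions. A field of norm zero
    cannot be normalised, but \<open>bd\<close> shows that u vanishes on it.\<close>
  proof (cases "h_half_norm S f = 0")
    case True then show ?thesis using bd[OF f] by simp
  next
    case False
    then have p: "h_half_norm S f > 0" using h_half_norm_nonneg[of f] by simp
    define a where "a = complex_of_real (1 / h_half_norm S f)"
    have g: "(\<lambda>x. a *s f x) \<in> h_half S" by (rule h_half_cmult[OF f])
    have "((\<lambda>i. (cmod a)\<^sup>2 * (wt i * (cmod (cf f i))\<^sup>2)) has_sum (cmod a)\<^sup>2 * (h_half_norm S f)\<^sup>2) UNIV"
      by (intro has_sum_cmult_right h_half_norm_has_sum f)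
    then have "((\<lambda>i. wt i * (cmod (cf (\<lambda>x. a *s f x) i))\<^sup>2) has_sum (cmod a)\<^sup>2 * (h_half_norm S f)\<^sup>2) UNIV"
      by (simp add: cf_cmult norm_mult power_mult_distrib mult_ac)
    then have "(h_half_norm S (\<lambda>x. a *s f x))\<^sup>2 = (cmod a)\<^sup>2 * (h_half_norm S f)\<^sup>2"
      by (rule has_sum_unique[OF h_half_norm_has_sum[OF g]])
    also have "\<dots> = 1" using p by (simp add: a_def norm_divide power_divide)
    finally have "h_half_norm S (\<lambda>x. a *s f x) \<le> 1"
      by (auto simp: power2_eq_1_iff)
    then have "cmod (u (\<lambda>x. a *s f x)) \<le> C"
      unfolding C_def using g by (intro cSup_upper[OF _ bdd]) auto
    then show ?thesis using p by (simp add: mhalf_cmult[OF u f] a_def norm_mult norm_divide field_simps)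
  qed
  note CF = sum_uc_le[OF u C0 this]
  have "ellsq (uc u) \<le> C\<^sup>2"
    unfolding ellsq_def using ell_uc[OF u] by (intro infsum_le_finite_sums CF) (auto simp: ell_def)
  then have "sqrt (ellsq (uc u)) \<le> C" using C0 by (simp add: real_le_lsqrt)
  moreover have "C \<le> sqrt (ellsq (uc u))" unfolding C_def using ne X by (intro cSup_least) auto
  ultimately show ?thesis by (simp add: h_mhalf_norm_def C_def)
qed

text \<open>Every coordinate is a continuous functional of u, so relations between coordinates
  survive limits.\<close>

lemma mhalf_uc_le:
  assumes u: "u \<in> h_mhalf S" shows "(cmod (uc u i))\<^sup>2 / wt i \<le> (h_mhalf_norm S u)\<^sup>2"
proof -
  have "(\<Sum>j\<in>{i}. (cmod (uc u j))\<^sup>2 / wt j) \<le> ellsq (uc u)"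
    unfolding ellsq_def using ell_uc[OF u] by (intro finite_sum_le_infsum) (auto simp: ell_def less_imp_le[OF wt_pos])
  then show ?thesis by (simp add: mhalf_norm_eq[OF u] ellsq_nonneg)
qed

section \<open>The dual as a vector space\<close>

lemma mhalf_closed_add:
  assumes u: "u \<in> h_mhalf S" and v: "v \<in> h_mhalf S" shows "u + v \<in> h_mhalf S"
proof -
  obtain C where C: "C \<ge> 0" "\<And>f. f \<in> h_half S \<Longrightarrow> cmod (u f) \<le> C * h_half_norm S f"
    using mhalf_bound[OF u] by blast
  obtain D where D: "D \<ge> 0" "\<And>f. f \<in> h_half S \<Longrightarrow> cmod (v f) \<le> D * h_half_norm S f"
    using mhalf_bound[OF v] by blast
  have "cmod ((u + v) f) \<le> (C + D) * h_half_norm S f" if "f \<in> h_half S" for f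
    using norm_triangle_ineq[of "u f" "v f"] C(2)[OF that] D(2)[OF that] by (simp add: algebra_simps)
  then have "\<exists>C. \<forall>f\<in>h_half S. cmod ((u + v) f) \<le> C * h_half_norm S f" by blast
  then show ?thesis
    using u v by (auto simp: h_mhalf_def algebra_simps)
qed

lemma mhalf_closed_fscale:
  assumes u: "u \<in> h_mhalf S" shows "fscale a u \<in> h_mhalf S"
proof -
  obtain C where C: "C \<ge> 0" "\<And>f. f \<in> h_half S \<Longrightarrow> cmod (u f) \<le> C * h_half_norm S f"
    using mhalf_bound[OF u] by blast
  have "cmod (fscale a u f) \<le> (cmod a * C) * h_half_norm S f" if "f \<in> h_half S" for f
    using mult_left_mono[OF C(2)[OF that], of "cmod a"] by (simp add: fscale_def norm_mult mult.assoc)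
  then have "\<exists>C. \<forall>f\<in>h_half S. cmod (fscale a u f) \<le> C * h_half_norm S f" by blast
  then show ?thesis
    using u by (auto simp: h_mhalf_def fscale_def algebra_simps)
qed

lemma minus_fscale: "u - v = u + fscale (- 1) v"
  by (auto simp: fscale_def)

lemma mhalf_closed_diff: "u \<in> h_mhalf S \<Longrightarrow> v \<in> h_mhalf S \<Longrightarrow> u - v \<in> h_mhalf S"
  unfolding minus_fscale by (intro mhalf_closed_add mhalf_closed_fscale)

lemma uc_add: "uc (u + v) i = uc u i + uc v i"
  and uc_fscale: "uc (fscale a u) i = a * uc u i"
  and uc_diff: "uc (u - v) i = uc u i - uc v i"
  by (simp_all add: uc_def fscale_def)

text \<open>In the components, the bilinear dot product pairs plus with minus, which is why powers n
  and - n meet in the integral.\<close>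

lemma functional_of_eq:
  assumes f: "f \<in> h_half S" and gm: "gp \<phi> \<in> borel_measurable ucirc" "gm \<phi> \<in> borel_measurable ucirc"
  shows "functional_of S \<phi> f = of_real r * (LINT z|ucirc. (gp \<phi> z * gm f z + gm \<phi> z * gp f z) / 2)"
proof -
  note [measurable] = gm gp_measurable[OF h_half_L2(1)[OF f]] gm_measurable[OF h_half_L2(1)[OF f]]
  have pt: "(\<Sum>i\<in>UNIV. \<phi> (pt c r z) $ i * f (pt c r z) $ i) = (gp \<phi> z * gm f z + gm \<phi> z * gp f z) / 2" for z
    by (simp add: sum_2 gp_def gm_def bp_def bm_def algebra_simps)
  have "(\<lambda>x. \<Sum>i\<in>UNIV. \<phi> x $ i * f x $ i) \<in> borel_measurable S"
    unfolding measurable_circle_iff[OF r] pt by measurable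
  from integral_circle[OF r this] show ?thesis
    using f by (simp add: functional_of_def pt scaleR_conv_of_real)
qed

lemma pairing_ef:
  assumes g: "integrable ucirc g" and h: "integrable ucirc h" and "gp \<phi> = g" "gm \<phi> = h"
  shows "(LINT z|ucirc. (g z * gm (ef i) z + h z * gp (ef i) z) / 2) = of_real (2 * pi) * cf \<phi> i"
proof -
  have "(LINT z|ucirc. (g z * gm (ef i) z + h z * gp (ef i) z) / 2)
     = (LINT z|ucirc. (if fst i then - \<i> else 1) / 2 * (g z * z powi (- snd i)) + (if fst i then \<i> else 1) / 2 * (h z * z powi (- (- snd i))))"
    by (intro Bochner_Integration.integral_cong refl) (simp add: gp_ef gm_ef field_simps)
  also have "\<dots> = (if fst i then - \<i> else 1) / 2 * (of_real (2 * pi) * fco g (snd i)) + (if fst i then \<i> else 1) / 2 * (of_real (2 * pi) * fco h (- snd i))"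
    by (simp only: Bochner_Integration.integral_add integrable_mult_right integrable_ucirc_times_powi g h
        integral_mult_right_zero integral_fco)
  also have "\<dots> = of_real (2 * pi) * cf \<phi> i"
    using assms(3,4) by (simp add: cf_def field_simps)
  finally show ?thesis .
qed

text \<open>Each \<open>ef i\<close> is real of length one at every point of the circle, so 2 pi r
  is its squared L^2 norm, and testing bilinearly against it extracts the coefficient of the same
  index.\<close>

lemma functional_of_ef_right:
  assumes "integrable ucirc (gp \<phi>)" "integrable ucirc (gm \<phi>)"
  shows "uc (functional_of S \<phi>) i = of_real (2 * pi * r) * cf \<phi> i"
  using assms pairing_ef[OF assms refl refl, of i] unfolding uc_def
  by (subst functional_of_eq[OF ef_h_half]) auto

lemma functional_of_bounded:
  assumes m: "gp \<phi> \<in> borel_measurable ucirc" "gm \<phi> \<in> borel_measurable ucirc"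
    and B: "\<And>z. norm z = 1 \<Longrightarrow> cmod (gp \<phi> z) \<le> B" "\<And>z. norm z = 1 \<Longrightarrow> cmod (gm \<phi> z) \<le> B"
  shows "functional_of S \<phi> \<in> h_mhalf S"
proof -
  have B0: "B \<ge> 0" using B(1)[of 1] norm_ge_zero[of "gp \<phi> 1"] by (simp del: norm_ge_zero)
  have I: "integrable ucirc (\<lambda>z. gp \<phi> z * gm f z)" "integrable ucirc (\<lambda>z. gm \<phi> z * gp f z)" if "f \<in> h_half S" for f
    using integrable_ucirc_times_bounded[OF h_half_integrable(2)[OF that] m(1) B(1)]
      integrable_ucirc_times_bounded[OF h_half_integrable(1)[OF that] m(2) B(2)] by (simp_all add: mult.commute)
  have bd: "cmod (functional_of S \<phi> f) \<le> (B * sqrt (4 * pi * r)) * h_half_norm S f" if f: "f \<in> h_half S" for f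
  proof -
    note fL = h_half_L2[OF f]
    note gL = gp_measurable[OF fL(1)] gm_measurable[OF fL(1)]
    define N where "N = h_half_norm S f"
    have "h_half_energy S f < \<infinity>" using f by (simp add: h_half_def)
    then have hE: "h_half_energy S f = ennreal (N\<^sup>2)" by (simp add: N_def h_half_norm_def)
    have "ennreal (r / 2) * (sq (gp f) + sq (gm f)) \<le> ennreal (N\<^sup>2)"
      unfolding hE[symmetric] h_half_energy_def energy_L2[OF fL(1)] by simp
    moreover have e: "sq (gp f) = ennreal (enn2real (sq (gp f)))" "sq (gm f) = ennreal (enn2real (sq (gm f)))"
      using fL by simp_all
    ultimately have "ennreal (r / 2 * (enn2real (sq (gp f)) + enn2real (sq (gm f)))) \<le> ennreal (N\<^sup>2)"
      using r by (subst ennreal_lin_comb(2)[symmetric]) auto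
    then have E: "r / 2 * (enn2real (sq (gp f)) + enn2real (sq (gm f))) \<le> N\<^sup>2"
      by (subst (asm) ennreal_le_iff) auto
    \<comment> \<open>The squared norm of g is at most 2 N^2 / r, and Cauchy-Schwarz on total mass 2
      pi multiplies it by 2 pi.\<close>
    have half: "(LINT z|ucirc. cmod (g z)) \<le> sqrt (4 * pi / r) * N"
      if "g \<in> borel_measurable ucirc" "sq g < \<infinity>" "r / 2 * enn2real (sq g) \<le> N\<^sup>2" for g
    proof -
      have "(LINT z|ucirc. cmod (g z)) \<le> sqrt (2 * pi * enn2real (sq g))"
        by (rule integral_norm_le_sqrt[OF that(1,2)])
      also have "\<dots> \<le> sqrt (4 * pi / r * N\<^sup>2)"
        using that(3) r by (intro real_sqrt_le_mono) (simp add: field_simps)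
      also have "\<dots> = sqrt (4 * pi / r) * N" by (subst real_sqrt_mult) (simp add: N_def h_half_norm_nonneg)
      finally show ?thesis .
    qed
    have "0 \<le> r / 2 * enn2real (sq (gp f))" "0 \<le> r / 2 * enn2real (sq (gm f))"
      using r by (intro mult_nonneg_nonneg; simp)+
    then have E1: "r / 2 * enn2real (sq (gp f)) \<le> N\<^sup>2" "r / 2 * enn2real (sq (gm f)) \<le> N\<^sup>2"
      using E unfolding distrib_left by linarith+
    have "cmod (functional_of S \<phi> f) = r * cmod (LINT z|ucirc. (gp \<phi> z * gm f z + gm \<phi> z * gp f z) / 2)"
      using r by (simp add: functional_of_eq[OF f m] norm_mult)
    also have "\<dots> \<le> r * (LINT z|ucirc. cmod ((gp \<phi> z * gm f z + gm \<phi> z * gp f z) / 2))"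
      using r by (intro mult_left_mono integral_norm_bound) auto
    also have "\<dots> \<le> r * (LINT z|ucirc. B / 2 * cmod (gm f z) + B / 2 * cmod (gp f z))"
    proof (intro mult_left_mono integral_mono)
      fix z assume "z \<in> space ucirc"
      then have z: "norm z = 1" by simp
      have "cmod (gp \<phi> z * gm f z + gm \<phi> z * gp f z) \<le> B * cmod (gm f z) + B * cmod (gp f z)"
        using B[OF z] by (intro norm_triangle_le add_mono) (auto simp: norm_mult intro: mult_right_mono)
      then show "cmod ((gp \<phi> z * gm f z + gm \<phi> z * gp f z) / 2) \<le> B / 2 * cmod (gm f z) + B / 2 * cmod (gp f z)"
        by (simp add: norm_divide)
    qed (use I[OF f] h_half_integrable[OF f] r in auto)
    also have "\<dots> = r * (B / 2 * (LINT z|ucirc. cmod (gm f z)) + B / 2 * (LINT z|ucirc. cmod (gp f z)))"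
      using h_half_integrable[OF f] by simp
    also have "\<dots> \<le> r * (B / 2 * (sqrt (4 * pi / r) * N) + B / 2 * (sqrt (4 * pi / r) * N))"
      using r B0 by (intro mult_left_mono add_mono half gL fL E1) auto
    also have "\<dots> = B * (r * sqrt (4 * pi / r)) * N" by (simp add: algebra_simps)
    also have "r * sqrt (4 * pi / r) = sqrt (4 * pi * r)"
    proof -
      have "r * sqrt (4 * pi / r) = sqrt (r\<^sup>2) * sqrt (4 * pi / r)" using r by simp
      also have "\<dots> = sqrt (r\<^sup>2 * (4 * pi / r))" by (simp only: real_sqrt_mult)
      also have "r\<^sup>2 * (4 * pi / r) = 4 * pi * r" using r by (simp add: power2_eq_square)
      finally show ?thesis .
    qed
    finally show ?thesis by (simp add: N_def)
  qed
  show ?thesis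
    unfolding h_mhalf_def
  proof (intro CollectI conjI ballI allI impI)
    fix f g assume f: "f \<in> h_half S" and g: "g \<in> h_half S"
    have "(LINT z|ucirc. (gp \<phi> z * (gm f z + gm g z) + gm \<phi> z * (gp f z + gp g z)) / 2)
       = (LINT z|ucirc. (gp \<phi> z * gm f z + gm \<phi> z * gp f z) / 2 + (gp \<phi> z * gm g z + gm \<phi> z * gp g z) / 2)"
      by (intro Bochner_Integration.integral_cong refl) (simp add: field_simps)
    also have "\<dots> = (LINT z|ucirc. (gp \<phi> z * gm f z + gm \<phi> z * gp f z) / 2) + (LINT z|ucirc. (gp \<phi> z * gm g z + gm \<phi> z * gp g z) / 2)"
      using I[OF f] I[OF g] by (intro Bochner_Integration.integral_add) auto
    finally show "functional_of S \<phi> (\<lambda>x. f x + g x) = functional_of S \<phi> f + functional_of S \<phi> g"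
      by (simp add: functional_of_eq m f g h_half_add gp_add gm_add distrib_left)
  next
    fix a f assume f: "f \<in> h_half S"
    have "(LINT z|ucirc. (gp \<phi> z * (a * gm f z) + gm \<phi> z * (a * gp f z)) / 2)
       = (LINT z|ucirc. a * ((gp \<phi> z * gm f z + gm \<phi> z * gp f z) / 2))"
      by (intro Bochner_Integration.integral_cong refl) (simp add: field_simps)
    also have "\<dots> = a * (LINT z|ucirc. (gp \<phi> z * gm f z + gm \<phi> z * gp f z) / 2)"
      by (rule integral_mult_right_zero)
    finally show "functional_of S \<phi> (\<lambda>x. a *s f x) = a * functional_of S \<phi> f"
      by (simp add: functional_of_eq m f h_half_cmult gp_cmult gm_cmult)
  next
    show "\<exists>C. \<forall>f\<in>h_half S. cmod (functional_of S \<phi> f) \<le> C * h_half_norm S f" using bd by blast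
  qed (simp add: functional_of_def)
qed

end

section \<open>Diagonalisation of the Neumann--Poincare operator\<close>

text \<open>For negative n, conjugation on the circle changes the sign of the exponent and preserves
  the modulus.\<close>

lemma lipschitz_powi:
  assumes "norm z = 1" "norm w = (1::real)"
  shows "cmod (z powi n - w powi n) \<le> \<bar>of_int n\<bar> * cmod (z - w)"
proof (cases "n \<ge> 0")
  case True
  then show ?thesis
    using norm_power_diff[of z w "nat n"] assms by (simp add: power_int_def)
next
  case False
  have "cmod (z powi n - w powi n) = cmod (cnj (z powi (- n) - w powi (- n)))"
    using assms by (simp add: cnj_powi_unit)
  also have "\<dots> = cmod (z powi (- n) - w powi (- n))" by (rule complex_mod_cnj)
  also have "\<dots> \<le> \<bar>of_int n\<bar> * cmod (z - w)"
    using False norm_power_diff[of z w "nat (- n)"] assms by (simp add: power_int_def)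
  finally show ?thesis .
qed

lemma fco_cong: "(\<And>z. norm z = 1 \<Longrightarrow> g z = h z) \<Longrightarrow> fco g n = fco h n"
  unfolding fco_def by (intro arg_cong2[of _ _ _ _ "(/)"] Bochner_Integration.integral_cong) auto

context elastic_disk begin

text \<open>The value 1/2 belongs to the rigid motions: n = 0 gives the translations and (True, 1)
  the infinitesimal rotation. The index (False, 1) is the dilation field.\<close>

definition kv :: "bool \<times> int \<Rightarrow> real" where
  "kv i = (if snd i = 0 then 1 / 2
           else if snd i = 1 then (if fst i then 1 / 2 else - (lam / (2 * (2 * mu + lam))))
           else if snd i > 1 then k0 else - k0)"

text \<open>The form in which the values come out of the Fourier computation. At n = 1 it rests on
  \<open>k0\<close> + \<open>kap\<close> / 2 = 1/2 and \<open>k0\<close> - \<open>kap\<close> / 2 =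
  - lam / (2 (2 mu + lam)).\<close>

lemma kv_eq: "kv i = (if snd i = 0 then 1 / 2 else 0) + k0 * of_int (sgn (snd i))
    + (if fst i then kap / 2 else - (kap / 2)) * (if snd i = 1 then 1 else 0)"
proof -
  define q where "q = 1 / (2 * mu + lam)"
  have q: "(2 * mu + lam) * q = 1" using lm by (simp add: q_def)
  have "k0 = mu * q / 2" "kap = (mu + lam) * q" "lam / (2 * (2 * mu + lam)) = lam * q / 2"
    by (simp_all add: k0_def kap_def q_def)
  then have "2 * (k0 + kap / 2) = (2 * mu + lam) * q" "k0 - kap / 2 = - (lam / (2 * (2 * mu + lam)))"
    by (simp_all only:, simp_all add: field_simps)
  then have "k0 + kap / 2 = 1 / 2" "k0 - kap / 2 = - (lam / (2 * (2 * mu + lam)))"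
    unfolding q by simp_all
  then show ?thesis by (auto simp: kv_def)
qed

abbreviation np where "np \<equiv> np_pv lam mu S (circle_normal c r)"

text \<open>The reflection exchanges coefficient 1 of \<open>gp\<close> with coefficient -1 of
  \<open>gm\<close> and multiplies by - \<open>kap\<close> / 2, hence acts by that factor on the
  half sum and by its negative on the half difference. The opposite signs of the Hilbert parts are
  compensated by the opposite indices, so both give \<open>k0\<close> sgn n.\<close>

lemma cf_np_pv:
  assumes Lp: "circ_lipschitz L (gp \<phi>)" and Lm: "circ_lipschitz L (gm \<phi>)"
  shows "cf (np \<phi>) i = of_real (kv i) * cf \<phi> i"
proof -
  let ?\<psi> = "np \<phi>"
  have p: "fco (gp ?\<psi>) n = fco (Np \<phi>) n" for n
    by (rule fco_cong) (simp add: gp_def[of ?\<psi>] np_pv_circle[OF assms])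
  have m: "fco (gm ?\<psi>) n = fco (Nm \<phi>) n" for n
    by (rule fco_cong) (simp add: gm_def[of ?\<psi>] np_pv_circle[OF assms])
  show ?thesis
    by (cases i) (auto simp: cf_def p m fco_Np[OF Lp] fco_Nm[OF Lm] kv_eq field_simps)
qed

lemma np_pv_mhalf:
  assumes Lp: "circ_lipschitz L (gp \<phi>)" and Lm: "circ_lipschitz L (gm \<phi>)"
  defines "\<psi> \<equiv> np \<phi>"
  shows "functional_of S \<psi> \<in> h_mhalf S" "functional_of S \<phi> \<in> h_mhalf S"
    "uc (functional_of S \<psi>) i = of_real (kv i) * uc (functional_of S \<phi>) i"
proof -
  have gp: "gp \<psi> z = Np \<phi> z" if "norm z = 1" for z
    unfolding gp_def[of \<psi>] unfolding \<psi>_def np_pv_circle[OF Lp Lm that] by (rule bp_mk2)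
  have gm: "gm \<psi> z = Nm \<phi> z" if "norm z = 1" for z
    unfolding gm_def[of \<psi>] unfolding \<psi>_def np_pv_circle[OF Lp Lm that] by (rule bm_mk2)
  note g = gp gm
  have m: "gp \<psi> \<in> borel_measurable ucirc" "gm \<psi> \<in> borel_measurable ucirc"
    using N_measurable[OF Lp Lm] measurable_cong[of ucirc "gp \<psi>" "Np \<phi>" borel] measurable_cong[of ucirc "gm \<psi>" "Nm \<phi>" borel] g
    by auto
  obtain B where B: "\<And>z. norm z = 1 \<Longrightarrow> cmod (gp \<psi> z) \<le> B" "\<And>z. norm z = 1 \<Longrightarrow> cmod (gm \<psi> z) \<le> B"
    using N_bounded[OF Lp Lm] g by metis
  show "functional_of S \<psi> \<in> h_mhalf S" by (rule functional_of_bounded[OF m B])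
  let ?B = "max (cmod (gp \<phi> 1)) (cmod (gm \<phi> 1)) + \<bar>L\<bar> * 2"
  have "cmod (gp \<phi> z) \<le> ?B" "cmod (gm \<phi> z) \<le> ?B" if "norm z = 1" for z
    using circ_lipschitz_bounded[OF Lp that] circ_lipschitz_bounded[OF Lm that] by linarith+
  then show "functional_of S \<phi> \<in> h_mhalf S"
    by (intro functional_of_bounded[of _ ?B] circ_lipschitz_measurable[OF Lp] circ_lipschitz_measurable[OF Lm])
  have i: "integrable ucirc (gp \<psi>)" "integrable ucirc (gm \<psi>)"
    by (auto intro: integrable_ucirc_bounded[OF m(1) B(1)] integrable_ucirc_bounded[OF m(2) B(2)])
  show "uc (functional_of S \<psi>) i = of_real (kv i) * uc (functional_of S \<phi>) i"
    unfolding functional_of_ef_right[OF i] functional_of_ef_right[OF circ_lipschitz_integrable[OF Lp] circ_lipschitz_integrable[OF Lm]]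
    unfolding \<psi>_def cf_np_pv[OF Lp Lm] by (simp only: mult_ac)
qed

text \<open>The 2 bounds cmod (b1 + i b2) by the norm of b, and likewise for the difference; r
  rescales the distance.\<close>

lemma lipschitz_circ:
  assumes "L-lipschitz_on (space S) \<phi>"
  shows "circ_lipschitz (2 * L * r) (gp \<phi>)" "circ_lipschitz (2 * L * r) (gm \<phi>)"
proof -
  have b: "cmod (bp v) \<le> 2 * norm v" "cmod (bm v) \<le> 2 * norm v" for v
    using norm_triangle_ineq[of "v $ 1" "\<i> * v $ 2"] norm_triangle_ineq4[of "v $ 1" "\<i> * v $ 2"]
      Finite_Cartesian_Product.norm_nth_le[of v 1] Finite_Cartesian_Product.norm_nth_le[of v 2]
    by (auto simp: bp_def bm_def norm_mult)
  have d: "2 * norm (\<phi> (pt c r z) - \<phi> (pt c r w)) \<le> 2 * L * r * cmod (z - w)"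
    if "norm z = 1" "norm w = 1" for z w
    using lipschitz_onD[OF assms, of "pt c r z" "pt c r w"] that
    by (simp add: pt_in_sphere[OF r, simplified] dist_pt[OF r] dist_norm[of "\<phi> _"])
  show "circ_lipschitz (2 * L * r) (gp \<phi>)" "circ_lipschitz (2 * L * r) (gm \<phi>)"
    unfolding circ_lipschitz_def gp_def gm_def
      linear_diff[OF bounded_linear.linear[OF bounded_linear_bp], symmetric]
      linear_diff[OF bounded_linear.linear[OF bounded_linear_bm], symmetric]
    using b d by (meson order_trans)+
qed

text \<open>Makes every basis field an admissible density in the definition of the operator, whose
  value there is thereby prescribed.\<close>

lemma ef_lipschitz: "(\<bar>of_int (snd i)\<bar> / r)-lipschitz_on (space S) (ef i)"
proof (rule lipschitz_onI)
  fix x y assume "x \<in> space S" "y \<in> space S"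
  then have n: "norm (unpt c r x) = 1" "norm (unpt c r y) = 1" using r by (simp_all add: norm_unpt)
  let ?z = "unpt c r x" and ?w = "unpt c r y"
  have xy: "pt c r ?z = x" "pt c r ?w = y" using r by simp_all
  let ?b = "\<bar>of_int (snd i)\<bar> * cmod (?z - ?w)"
  have "cmod (gp (ef i) ?z - gp (ef i) ?w) \<le> ?b" "cmod (gm (ef i) ?z - gm (ef i) ?w) \<le> ?b"
    using lipschitz_powi[OF n, of "snd i"] lipschitz_powi[OF n, of "- snd i"]
    by (simp_all add: gp_ef gm_ef norm_mult norm_minus_commute flip: right_diff_distrib)
  then have "(cmod (gp (ef i) ?z - gp (ef i) ?w))\<^sup>2 \<le> ?b\<^sup>2" "(cmod (gm (ef i) ?z - gm (ef i) ?w))\<^sup>2 \<le> ?b\<^sup>2"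
    by (auto intro: power_mono)
  from add_mono[OF this] have "(norm (ef i x - ef i y))\<^sup>2 \<le> ?b\<^sup>2"
    using norm_pt_diff[of "ef i" ?z ?w] unfolding xy by (simp only: divide_le_eq_numeral1(1) mult_2_right)
  then have "norm (ef i x - ef i y) \<le> ?b" by (rule power2_le_imp_le) simp
  also have "?b = \<bar>of_int (snd i)\<bar> / r * dist x y"
    using dist_pt[OF r, of c ?z ?w] r unfolding xy by simp
  finally show "dist (ef i x) (ef i y) \<le> \<bar>of_int (snd i)\<bar> / r * dist x y" by (simp add: dist_norm)
qed (use r in simp)

section \<open>Diagonal operators on the dual space\<close>

definition diagop :: "(bool \<times> int \<Rightarrow> complex) \<Rightarrow> functional \<Rightarrow> functional" where
  "diagop a u = (if u \<in> h_mhalf S then seqfun (\<lambda>i. a i * uc u i) else 0)"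

lemma ell_times:
  assumes d: "ell d" and a: "\<And>i. cmod (a i) \<le> A"
  shows "ell (\<lambda>i. a i * d i)" "ellsq (\<lambda>i. a i * d i) \<le> A\<^sup>2 * ellsq d"
proof -
  have le: "(cmod (a i * d i))\<^sup>2 / wt i \<le> A\<^sup>2 * ((cmod (d i))\<^sup>2 / wt i)" for i
  proof -
    have "(cmod (a i))\<^sup>2 \<le> A\<^sup>2" using a by (intro power_mono) auto
    then have "(cmod (a i))\<^sup>2 * ((cmod (d i))\<^sup>2 / wt i) \<le> A\<^sup>2 * ((cmod (d i))\<^sup>2 / wt i)"
      by (intro mult_right_mono) (auto simp: less_imp_le[OF wt_pos])
    then show ?thesis by (simp add: norm_mult power_mult_distrib)
  qed
  have s: "(\<lambda>i. A\<^sup>2 * ((cmod (d i))\<^sup>2 / wt i)) summable_on UNIV"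
    using d unfolding ell_def by (rule summable_on_cmult_right)
  show e: "ell (\<lambda>i. a i * d i)"
    unfolding ell_def by (rule summable_on_comparison_test[OF s le]) (simp add: less_imp_le[OF wt_pos])
  have "ellsq (\<lambda>i. a i * d i) \<le> infsum (\<lambda>i. A\<^sup>2 * ((cmod (d i))\<^sup>2 / wt i)) UNIV"
    unfolding ellsq_def using e by (intro infsum_mono s le) (simp add: ell_def)
  also have "\<dots> = A\<^sup>2 * ellsq d" unfolding ellsq_def by (rule infsum_cmult_right')
  finally show "ellsq (\<lambda>i. a i * d i) \<le> A\<^sup>2 * ellsq d" .
qed

lemma diagop_mhalf:
  assumes u: "u \<in> h_mhalf S" and a: "\<And>i. cmod (a i) \<le> A"
  shows "diagop a u \<in> h_mhalf S" "uc (diagop a u) i = a i * uc u i"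
  using u by (simp_all add: diagop_def seqfun_mhalf[OF ell_times(1)[OF ell_uc[OF u] a]] uc_seqfun)

lemma diagop_bounded_operator:
  assumes a: "\<And>i. cmod (a i) \<le> A"
  shows "bounded_operator S (diagop a)"
  unfolding bounded_operator_def
proof (intro conjI ballI allI)
  note M = diagop_mhalf[OF _ a]
  show "diagop a \<in> h_mhalf S \<rightarrow> h_mhalf S" using M by auto
  fix u assume u: "u \<in> h_mhalf S"
  show "diagop a (u + v) = diagop a u + diagop a v" if v: "v \<in> h_mhalf S" for v
    by (rule mhalf_ext) (simp_all add: M u v mhalf_closed_add uc_add distrib_left)
  show "diagop a (fscale b u) = fscale b (diagop a u)" for b
    by (rule mhalf_ext) (simp_all add: M u mhalf_closed_fscale uc_fscale)
next
  note M = diagop_mhalf[OF _ a]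
  have A0: "A \<ge> 0" using a[of "(False, 0)"] norm_ge_zero order_trans by blast
  have "h_mhalf_norm S (diagop a u) \<le> A * h_mhalf_norm S u" if u: "u \<in> h_mhalf S" for u
  proof -
    have "uc (diagop a u) = (\<lambda>i. a i * uc u i)" using M[OF u] by auto
    then have "h_mhalf_norm S (diagop a u) \<le> sqrt (A\<^sup>2 * ellsq (uc u))"
      unfolding mhalf_norm_eq[OF M(1)[OF u]] by (simp add: ell_times(2)[OF ell_uc[OF u] a])
    also have "\<dots> = A * h_mhalf_norm S u" using A0 by (simp add: mhalf_norm_eq[OF u] real_sqrt_mult)
    finally show ?thesis .
  qed
  then show "\<exists>C. \<forall>u\<in>h_mhalf S. h_mhalf_norm S (diagop a u) \<le> C * h_mhalf_norm S u" by blast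
qed

section \<open>Basis functionals and finite projections\<close>

definition bas :: "bool \<times> int \<Rightarrow> functional" where "bas i = functional_of S (ef i)"

lemma bas_mhalf: "bas i \<in> h_mhalf S"
  unfolding bas_def by (rule np_pv_mhalf(2)[OF lipschitz_circ[OF ef_lipschitz]])

lemma uc_bas: "uc (bas i) j = (if i = j then of_real (2 * pi * r) else 0)"
  unfolding bas_def
  by (subst functional_of_ef_right[OF h_half_integrable[OF ef_h_half]]) (auto simp: cf_ef)

text \<open>The division compensates for \<open>bas i\<close> having coordinate 2 pi r, not 1, at
  i.\<close>

definition proj :: "(bool \<times> int) set \<Rightarrow> functional \<Rightarrow> functional" where
  "proj F u = (\<Sum>i\<in>F. fscale (uc u i / of_real (2 * pi * r)) (bas i))"

lemma zero_mhalf: "0 \<in> h_mhalf S"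
proof -
  have "0 = fscale 0 (bas (False, 0))" by (auto simp: fscale_def)
  then show ?thesis using mhalf_closed_fscale[OF bas_mhalf] by metis
qed

lemma uc_zero: "uc 0 i = 0" by (simp add: uc_def)

lemma proj_props:
  assumes "finite F"
  shows "proj F u \<in> h_mhalf S" "uc (proj F u) j = (if j \<in> F then uc u j else 0)"
proof -
  have "proj F u \<in> h_mhalf S \<and> (\<forall>j. uc (proj F u) j = (if j \<in> F then uc u j else 0))"
    using assms
  proof (induction F rule: finite_induct)
    case empty show ?case by (simp only: proj_def sum.empty zero_mhalf uc_zero empty_iff if_False simp_thms)
  next
    case (insert i F)
    have "proj (insert i F) u = fscale (uc u i / of_real (2 * pi * r)) (bas i) + proj F u"
      using insert by (simp add: proj_def)
    note eq = this
    show ?case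
    proof (intro conjI allI)
      show "proj (insert i F) u \<in> h_mhalf S"
        unfolding eq using insert by (intro mhalf_closed_add mhalf_closed_fscale bas_mhalf) auto
      note IH = insert.IH[THEN conjunct2, rule_format]
      show "uc (proj (insert i F) u) j = (if j \<in> insert i F then uc u j else 0)" for j
        unfolding eq uc_add uc_fscale uc_bas IH using insert(2) r by auto
    qed
  qed
  then show "proj F u \<in> h_mhalf S" "uc (proj F u) j = (if j \<in> F then uc u j else 0)" by blast+
qed

text \<open>The squared distance is the tail of a convergent sum. The set F0 lets a chosen
  coordinate be forced into F.\<close>

lemma proj_approx:
  assumes u: "u \<in> h_mhalf S" and "e > 0" and F0: "finite F0"
  obtains F where "finite F" "F0 \<subseteq> F" "h_mhalf_norm S (u - proj F u) < e"
proof -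
  let ?h = "\<lambda>i. (cmod (uc u i))\<^sup>2 / wt i"
  have hs: "(?h has_sum ellsq (uc u)) UNIV"
    using ell_uc[OF u] unfolding ell_def ellsq_def by (rule has_sum_infsum)
  have "\<forall>\<^sub>F X in finite_subsets_at_top UNIV. dist (sum ?h X) (ellsq (uc u)) < e\<^sup>2"
    using hs \<open>e > 0\<close> unfolding has_sum_def by (intro tendstoD) auto
  then obtain X where X: "finite X" "\<And>Y. finite Y \<Longrightarrow> X \<subseteq> Y \<Longrightarrow> dist (sum ?h Y) (ellsq (uc u)) < e\<^sup>2"
    unfolding eventually_finite_subsets_at_top by auto
  define F where "F = X \<union> F0"
  have F: "finite F" using X F0 by (simp add: F_def)
  have v: "u - proj F u \<in> h_mhalf S" by (intro mhalf_closed_diff u proj_props F)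
  have "((\<lambda>i. ?h i + - (if i \<in> F then ?h i else 0)) has_sum ellsq (uc u) + - sum ?h F) UNIV"
    by (intro has_sum_add hs has_sum_uminusI has_sum_finite_support F)
  also have "(\<lambda>i. ?h i + - (if i \<in> F then ?h i else 0)) = (\<lambda>i. (cmod (uc (u - proj F u) i))\<^sup>2 / wt i)"
    by (auto simp: uc_diff proj_props(2)[OF F])
  finally have "ellsq (uc (u - proj F u)) = ellsq (uc u) - sum ?h F"
    unfolding ellsq_def[of "uc (u - _)"] by (simp add: infsumI)
  also have "\<dots> < e\<^sup>2" using X(2)[OF F] by (auto simp: F_def dist_real_def)
  finally have "sqrt (ellsq (uc (u - proj F u))) < e"
    using \<open>e > 0\<close> by (simp add: real_less_lsqrt)
  then have "h_mhalf_norm S (u - proj F u) < e" by (simp only: mhalf_norm_eq[OF v])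
  then show ?thesis using that[OF F] by (simp add: F_def)
qed

text \<open>On each finite projection of u the claim follows from linearity. The remainder is small,
  T is bounded and the coordinate j is continuous, so a discrepancy \<delta> > 0 would be smaller
  than itself.\<close>

lemma bounded_operator_diagonal:
  assumes T: "bounded_operator S T" and d: "\<And>i. T (bas i) = fscale (a i) (bas i)" and u: "u \<in> h_mhalf S"
  shows "uc (T u) j = a j * uc u j"
proof (rule ccontr)
  assume ne: "uc (T u) j \<noteq> a j * uc u j"
  have Tm: "T v \<in> h_mhalf S" if "v \<in> h_mhalf S" for v
    using T that unfolding bounded_operator_def by auto
  have Tadd: "T (v + w) = T v + T w" if "v \<in> h_mhalf S" "w \<in> h_mhalf S" for v w
    using T that unfolding bounded_operator_def by auto
  have Tsc: "T (fscale b v) = fscale b (T v)" if "v \<in> h_mhalf S" for b v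
    using T that unfolding bounded_operator_def by auto
  obtain C where C: "\<And>v. v \<in> h_mhalf S \<Longrightarrow> h_mhalf_norm S (T v) \<le> C * h_mhalf_norm S v"
    using T unfolding bounded_operator_def by blast
  have T0: "T 0 = 0"
  proof -
    have "T 0 = T (fscale 0 0)" by (rule arg_cong[of _ _ T]) (auto simp: fscale_def)
    also have "\<dots> = fscale 0 (T 0)" by (rule Tsc[OF zero_mhalf])
    also have "\<dots> = 0" by (auto simp: fscale_def)
    finally show ?thesis .
  qed
  have Tproj: "uc (T (proj F u)) j = (if j \<in> F then a j * uc u j else 0)" if "finite F" for F
    using that
  proof (induction F rule: finite_induct)
    case empty show ?case by (simp only: proj_def sum.empty T0 uc_zero empty_iff if_False)
  next
    case (insert i F)
    have "proj (insert i F) u = fscale (uc u i / of_real (2 * pi * r)) (bas i) + proj F u"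
      using insert by (simp add: proj_def)
    then have "T (proj (insert i F) u) = fscale (uc u i / of_real (2 * pi * r)) (fscale (a i) (bas i)) + T (proj F u)"
      by (simp add: Tadd Tsc mhalf_closed_fscale bas_mhalf proj_props(1) insert(1) d)
    note eq = this
    show ?case unfolding eq uc_add uc_fscale uc_bas insert(3) using insert(2) r by auto
  qed
  define \<delta> where "\<delta> = cmod (uc (T u) j - a j * uc u j)"
  have "\<delta> > 0" using ne by (simp add: \<delta>_def)
  \<comment> \<open>Chosen so that sqrt (wt j) (|C| + 1) e = \<delta>; the modulus and the 1 guard
    against a constant C that is negative or zero.\<close>
  define e where "e = \<delta> / (sqrt (wt j) * (\<bar>C\<bar> + 1))"
  have sw: "sqrt (wt j) > 0" using wt_pos by simp
  have "e > 0" using \<open>\<delta> > 0\<close> sw by (simp add: e_def)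
  obtain F where F: "finite F" "{j} \<subseteq> F" "h_mhalf_norm S (u - proj F u) < e"
    using proj_approx[OF u \<open>e > 0\<close>, of "{j}"] by auto
  let ?v = "u - proj F u"
  have v: "?v \<in> h_mhalf S" by (intro mhalf_closed_diff u proj_props F)
  have "T u = T ?v + T (proj F u)" using Tadd[OF v proj_props(1)[OF F(1)], of u] by simp
  then have "uc (T ?v) j = uc (T u) j - a j * uc u j"
    using Tproj[OF F(1)] F(2) by (simp add: uc_add)
  then have "\<delta>\<^sup>2 / wt j \<le> (h_mhalf_norm S (T ?v))\<^sup>2"
    using mhalf_uc_le[OF Tm[OF v], of j] by (simp add: \<delta>_def)
  then have "\<delta>\<^sup>2 \<le> (sqrt (wt j) * h_mhalf_norm S (T ?v))\<^sup>2"
    using wt_pos[of j] by (simp add: power_mult_distrib field_simps)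
  moreover have nn: "h_mhalf_norm S w \<ge> 0" if "w \<in> h_mhalf S" for w
    using that by (simp add: mhalf_norm_eq ellsq_nonneg)
  ultimately have "\<delta> \<le> sqrt (wt j) * h_mhalf_norm S (T ?v)"
    using sw nn[OF Tm[OF v]] by (intro power2_le_imp_le[OF _ mult_nonneg_nonneg]) auto
  also have "\<dots> \<le> sqrt (wt j) * (C * h_mhalf_norm S ?v)"
    using sw by (intro mult_left_mono C v) auto
  also have "\<dots> \<le> sqrt (wt j) * ((\<bar>C\<bar> + 1) * h_mhalf_norm S ?v)"
    using sw nn[OF v] by (intro mult_left_mono mult_right_mono) auto
  also have "\<dots> < sqrt (wt j) * ((\<bar>C\<bar> + 1) * e)"
    using sw F(3) by (intro mult_strict_left_mono) auto
  also have "\<dots> = \<delta>" using sw by (simp add: e_def)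
  finally show False by simp
qed

lemma kv_bounded: "cmod (of_real (kv i)) \<le> 1 / 2 + \<bar>lam / (2 * (2 * mu + lam))\<bar> + \<bar>k0\<bar>"
  by (auto simp: kv_def)

text \<open>Existence: the diagonal operator and the principal value agree in coordinates on every
  Lipschitz density, and \<open>diagop\<close> is 0 off the space as prescribed. Uniqueness: a
  competitor has all basis functionals as eigenvectors, because the basis fields are Lipschitz, and
  is therefore diagonal with the same values.\<close>

lemma np_operator_eq: "np_operator lam mu S (circle_normal c r) = diagop (\<lambda>i. of_real (kv i))"
  unfolding np_operator_def
proof (rule the_equality)
  let ?K = "diagop (\<lambda>i. of_real (kv i))"
  note KM = diagop_mhalf[OF _ kv_bounded]
  show "bounded_operator S ?K \<and> (\<forall>u. u \<notin> h_mhalf S \<longrightarrow> ?K u = 0) \<and>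
    (\<forall>\<phi>. (\<exists>L. L-lipschitz_on (space S) \<phi>) \<longrightarrow>
       ?K (functional_of S \<phi>) = functional_of S (np \<phi>))"
  proof (intro conjI allI impI)
    show "bounded_operator S ?K" by (rule diagop_bounded_operator[OF kv_bounded])
    show "?K u = 0" if "u \<notin> h_mhalf S" for u using that by (simp add: diagop_def)
    fix \<phi> :: field assume "\<exists>L. L-lipschitz_on (space S) \<phi>"
    then obtain L where "L-lipschitz_on (space S) \<phi>" by blast
    note N = np_pv_mhalf[OF lipschitz_circ[OF this]]
    show "?K (functional_of S \<phi>) = functional_of S (np \<phi>)"
      by (rule mhalf_ext) (simp_all add: N KM)
  qed
  fix T assume T: "bounded_operator S T \<and> (\<forall>u. u \<notin> h_mhalf S \<longrightarrow> T u = 0) \<and>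
    (\<forall>\<phi>. (\<exists>L. L-lipschitz_on (space S) \<phi>) \<longrightarrow>
       T (functional_of S \<phi>) = functional_of S (np \<phi>))"
  have d: "T (bas i) = fscale (of_real (kv i)) (bas i)" for i
  proof -
    have "T (bas i) = functional_of S (np (ef i))"
      unfolding bas_def using T ef_lipschitz by blast
    also have "\<dots> = fscale (of_real (kv i)) (bas i)"
    proof (rule mhalf_ext)
      note N = np_pv_mhalf[OF lipschitz_circ[OF ef_lipschitz[of i]]]
      show "functional_of S (np (ef i)) \<in> h_mhalf S" by (rule N)
      show "fscale (of_real (kv i)) (bas i) \<in> h_mhalf S" by (intro mhalf_closed_fscale bas_mhalf)
      show "uc (functional_of S (np (ef i))) j = uc (fscale (of_real (kv i)) (bas i)) j" for j
        unfolding N(3) bas_def[symmetric] uc_fscale uc_bas by simp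
    qed
    finally show ?thesis .
  qed
  show "T = ?K"
  proof
    fix u show "T u = ?K u"
    proof (cases "u \<in> h_mhalf S")
      case True
      have "T u \<in> h_mhalf S" using T True unfolding bounded_operator_def by auto
      then show ?thesis
        using True bounded_operator_diagonal[OF _ d True] T by (intro mhalf_ext) (simp_all add: KM)
    next
      case False then show ?thesis using T by (simp add: diagop_def)
    qed
  qed
qed

section \<open>Spectrum and eigenspaces of the diagonal operator\<close>

abbreviation K where "K \<equiv> diagop (\<lambda>i. of_real (kv i))"

lemma K_props: "u \<in> h_mhalf S \<Longrightarrow> K u \<in> h_mhalf S" "u \<in> h_mhalf S \<Longrightarrow> uc (K u) i = of_real (kv i) * uc u i"
  using diagop_mhalf[OF _ kv_bounded] by auto

lemma eigenspace_iff:
  "u \<in> eigenspace S K z \<longleftrightarrow> u \<in> h_mhalf S \<and> (\<forall>i. of_real (kv i) = z \<or> uc u i = 0)"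
proof -
  have "K u = fscale z u \<longleftrightarrow> (\<forall>i. of_real (kv i) = z \<or> uc u i = 0)" if u: "u \<in> h_mhalf S"
  proof
    assume eq: "K u = fscale z u"
    show "\<forall>i. of_real (kv i) = z \<or> uc u i = 0"
    proof
      fix i
      have "of_real (kv i) * uc u i = z * uc u i"
        using arg_cong[OF eq, of "\<lambda>v. uc v i"] by (simp add: K_props u uc_fscale)
      then show "of_real (kv i) = z \<or> uc u i = 0" by auto
    qed
  next
    assume *: "\<forall>i. of_real (kv i) = z \<or> uc u i = 0"
    have "of_real (kv i) * uc u i = z * uc u i" for i using *[rule_format, of i] by auto
    then show "K u = fscale z u"
      by (intro mhalf_ext) (simp_all add: K_props u mhalf_closed_fscale uc_fscale)
  qed
  then show ?thesis by (auto simp: eigenspace_def)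
qed

lemma eigenspace_fscale:
  assumes v: "v \<in> eigenspace S K z" shows "fscale a v \<in> eigenspace S K z"
proof -
  have "of_real (kv i) = z \<or> uc (fscale a v) i = 0" for i
    using v unfolding eigenspace_iff uc_fscale by (metis mult_zero_right)
  then show ?thesis
    using v mhalf_closed_fscale unfolding eigenspace_iff by blast
qed

lemma bas_nonzero: "bas i \<noteq> 0"
proof
  assume "bas i = 0"
  then have "uc (bas i) i = 0" by (simp add: uc_zero)
  then show False using r by (simp add: uc_bas)
qed

lemma bas_eigen: "bas i \<in> eigenspace S K (of_real (kv i))"
  by (auto simp: eigenspace_iff bas_mhalf uc_bas)

lemma kv_range: "range kv = {1/2, - (lam / (2 * (2 * mu + lam))), k0, - k0}"
proof
  show "range kv \<subseteq> {1/2, - (lam / (2 * (2 * mu + lam))), k0, - k0}" by (auto simp: kv_def)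
  have "kv (False, 0) = 1/2" "kv (False, 1) = - (lam / (2 * (2 * mu + lam)))" "kv (False, 2) = k0" "kv (False, -1) = - k0"
    by (simp_all add: kv_def)
  then show "{1/2, - (lam / (2 * (2 * mu + lam))), k0, - k0} \<subseteq> range kv"
    by (metis (no_types, lifting) empty_subsetI insert_subset rangeI)
qed

text \<open>\<open>kv\<close> has finite range, so off this range 1 / (kv i - z) is bounded in i and
  defines a bounded resolvent. Each value in the range has an eigenvector, which rules out an
  inverse.\<close>

lemma spectrum_K: "op_spectrum S K = of_real ` range kv"
proof (intro equalityI subsetI)
  fix z assume z: "z \<in> op_spectrum S K"
  show "z \<in> complex_of_real ` range kv"
  proof (rule ccontr)
    assume nz: "z \<notin> complex_of_real ` range kv"
    define a where "a i = 1 / (of_real (kv i) - z)" for i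
    have nzi: "of_real (kv i) - z \<noteq> 0" for i using nz by auto
    \<comment> \<open>The maximum runs over the values of \<open>kv\<close>, of which there are four
      at most, and not over the infinitely many indices.\<close>
    define A where "A = Max ((\<lambda>k. cmod (1 / (of_real k - z))) ` range kv)"
    have a: "cmod (a i) \<le> A" for i
      unfolding A_def
    proof (rule Max_ge)
      show "cmod (a i) \<in> (\<lambda>k. cmod (1 / (of_real k - z))) ` range kv"
        by (rule image_eqI[where x="kv i"]) (simp_all add: a_def)
    qed (simp add: kv_range)
    note M = diagop_mhalf[OF _ a]
    have "bounded_operator S (diagop a) \<and> (\<forall>u\<in>h_mhalf S. diagop a (K u - fscale z u) = u \<and> K (diagop a u) - fscale z (diagop a u) = u)"
    proof (intro conjI ballI)
      show "bounded_operator S (diagop a)" by (rule diagop_bounded_operator[OF a])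
      fix u assume u: "u \<in> h_mhalf S"
      have inv: "a i * (of_real (kv i) * y - z * y) = y" "of_real (kv i) * (a i * y) - z * (a i * y) = y" for i y
      proof -
        have a1: "a i * (of_real (kv i) - z) = 1" using nzi[of i] by (simp add: a_def)
        have "a i * (of_real (kv i) * y - z * y) = a i * (of_real (kv i) - z) * y"
          "of_real (kv i) * (a i * y) - z * (a i * y) = a i * (of_real (kv i) - z) * y"
          by (simp_all add: algebra_simps)
        then show "a i * (of_real (kv i) * y - z * y) = y" "of_real (kv i) * (a i * y) - z * (a i * y) = y"
          by (simp_all only: a1 mult_1)
      qed
      have w: "K u - fscale z u \<in> h_mhalf S" by (intro mhalf_closed_diff K_props mhalf_closed_fscale u)
      show "diagop a (K u - fscale z u) = u"
        by (rule mhalf_ext) (simp_all add: M[OF w] u uc_diff K_props uc_fscale inv)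
      have w': "K (diagop a u) - fscale z (diagop a u) \<in> h_mhalf S" by (intro mhalf_closed_diff K_props mhalf_closed_fscale M u)
      show "K (diagop a u) - fscale z (diagop a u) = u"
        by (rule mhalf_ext) (simp_all add: w' M[OF u] u uc_diff K_props uc_fscale inv)
    qed
    then show False using z unfolding op_spectrum_def by blast
  qed
next
  fix z assume "z \<in> complex_of_real ` range kv"
  then obtain i where i: "z = of_real (kv i)" by auto
  show "z \<in> op_spectrum S K"
    unfolding op_spectrum_def
  proof (intro CollectI notI)
    assume "\<exists>R. bounded_operator S R \<and> (\<forall>u\<in>h_mhalf S. R (K u - fscale z u) = u \<and> K (R u) - fscale z (R u) = u)"
    then obtain R where R: "bounded_operator S R" "\<And>u. u \<in> h_mhalf S \<Longrightarrow> R (K u - fscale z u) = u" by blast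
    \<comment> \<open>K - z sends both \<open>bas i\<close> and 0 to 0, so a left inverse would have
      two values at 0.\<close>
    have "K (bas i) = fscale z (bas i)" using bas_eigen[of i] by (simp add: eigenspace_def i)
    then have "R 0 = bas i" using R(2)[OF bas_mhalf[of i]] by simp
    moreover have "R 0 = R (K 0 - fscale z 0)"
      by (rule arg_cong[of _ _ R], rule mhalf_ext)
         (simp_all add: zero_mhalf mhalf_closed_diff K_props mhalf_closed_fscale uc_diff uc_fscale uc_zero)
    then have "R 0 = 0" using R(2)[OF zero_mhalf] by simp
    ultimately show False using bas_nonzero by simp
  qed
qed

text \<open>An element of the closed span has vanishing coordinates wherever kv i differs from z,
  because this holds on the span and coordinates are continuous. Conversely, the finite projections
  of an eigenvector use only those \<open>bas i\<close> with kv i = z, and they converge to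
  it.\<close>

lemma eigenspace_closed_span:
  assumes A: "\<And>v. v \<in> A \<Longrightarrow> v \<in> eigenspace S K z"
    and B: "\<And>i. of_real (kv i) = z \<Longrightarrow> bas i \<in> functional_space.span A"
  shows "eigenspace S K z = closed_span S A"
proof (intro equalityI subsetI)
  have sub: "functional_space.subspace (eigenspace S K z)"
    unfolding functional_space.subspace_def
  proof (intro conjI ballI allI)
    show "0 \<in> eigenspace S K z" by (simp add: eigenspace_iff zero_mhalf uc_zero)
  next
    fix v w assume v: "v \<in> eigenspace S K z" and w: "w \<in> eigenspace S K z"
    have "of_real (kv i) = z \<or> uc (v + w) i = 0" for i
      using v w unfolding eigenspace_iff uc_add by (metis add.right_neutral)
    then show "v + w \<in> eigenspace S K z"
      using v w mhalf_closed_add unfolding eigenspace_iff by blast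
  next
    show "fscale a v \<in> eigenspace S K z" if "v \<in> eigenspace S K z" for a v
      by (rule eigenspace_fscale[OF that])
  qed
  fix u assume u: "u \<in> closed_span S A"
  then have um: "u \<in> h_mhalf S" by (simp add: closed_span_def)
  have "uc u i = 0" if i: "of_real (kv i) \<noteq> z" for i
  proof (rule ccontr)
    assume "uc u i \<noteq> 0"
    then have "cmod (uc u i) / sqrt (wt i) > 0" using wt_pos by simp
    then obtain v where v: "v \<in> functional_space.span A" "h_mhalf_norm S (u - v) < cmod (uc u i) / sqrt (wt i)"
      using u unfolding closed_span_def by blast
    have "v \<in> eigenspace S K z" using functional_space.span_minimal[of A, OF _ sub] A v(1) by blast
    then have vm: "v \<in> h_mhalf S" "uc v i = 0" using i unfolding eigenspace_iff by blast+
    note d = mhalf_closed_diff[OF um vm(1)]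
    have "(cmod (uc u i))\<^sup>2 / wt i \<le> (h_mhalf_norm S (u - v))\<^sup>2"
      using mhalf_uc_le[OF d, of i] by (simp add: uc_diff vm(2))
    also have "\<dots> < (cmod (uc u i) / sqrt (wt i))\<^sup>2"
      using v(2) by (intro power_strict_mono) (auto simp: mhalf_norm_eq[OF d] ellsq_nonneg)
    also have "\<dots> = (cmod (uc u i))\<^sup>2 / wt i" using wt_pos[of i] by (simp add: power_divide)
    finally show False by simp
  qed
  then show "u \<in> eigenspace S K z" using um by (auto simp: eigenspace_iff)
next
  fix u assume u: "u \<in> eigenspace S K z"
  then have um: "u \<in> h_mhalf S" by (simp add: eigenspace_iff)
  have p: "proj F u \<in> functional_space.span A" for F
    unfolding proj_def
  proof (rule functional_space.span_sum)
    fix i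
    show "fscale (uc u i / of_real (2 * pi * r)) (bas i) \<in> functional_space.span A"
    proof (cases "uc u i = 0")
      case True
      then have "fscale (uc u i / of_real (2 * pi * r)) (bas i) = 0" by (auto simp: fscale_def)
      then show ?thesis using functional_space.span_zero by metis
    next
      case False
      then have "of_real (kv i) = z" using u unfolding eigenspace_iff by blast
      then show ?thesis by (intro functional_space.span_scale B)
    qed
  qed
  show "u \<in> closed_span S A"
    unfolding closed_span_def
  proof (intro CollectI conjI um allI impI)
    fix e :: real assume "e > 0"
    obtain F where "h_mhalf_norm S (u - proj F u) < e"
      using proj_approx[OF um \<open>e > 0\<close>, of "{}"] by auto
    then show "\<exists>v\<in>functional_space.span A. h_mhalf_norm S (u - v) < e" using p by blast
  qed
qed

lemma functional_of_cong:
  assumes "\<And>x. x \<in> sphere c r \<Longrightarrow> \<phi> x = a *s \<psi> x"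
  shows "functional_of S \<phi> = fscale a (functional_of S \<psi>)"
proof
  fix f
  have "(LINT x|S. (\<Sum>i\<in>UNIV. \<phi> x $ i * f x $ i)) = (LINT x|S. a * (\<Sum>i\<in>UNIV. \<psi> x $ i * f x $ i))"
    by (intro Bochner_Integration.integral_cong refl) (simp add: assms sum_distrib_left mult.assoc)
  then show "functional_of S \<phi> f = fscale a (functional_of S \<psi>) f"
    by (simp add: functional_of_def fscale_def)
qed

lemma ef_trig:
  assumes "cis t = unpt c r p"
  shows "ef (False, n) p = vector [complex_of_real (cos (of_int n * t)), complex_of_real (sin (of_int n * t))]"
    and "ef (True, n) p = vector [complex_of_real (- sin (of_int n * t)), complex_of_real (cos (of_int n * t))]"
  unfolding ef_def assms[symmetric]
  by (simp_all add: cis_power_int mk2_def vec_eq_iff forall_2 complex_eq_iff)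

end

text \<open>After the diagonalisation it remains to match the listed fields with the indices:
  constants with n = 0, the fields in x and y with n = 1, the third family with n = m and the fourth
  with n = - m.\<close>

theorem mainTheorem4:
  fixes lam mu r :: real and c :: "real^2"
  assumes "mu > 0" and "2 * lam + 2 * mu > 0" and "r > 0"
  defines "S \<equiv> circle_measure c r"
  defines "K \<equiv> np_operator lam mu S (circle_normal c r)"
  defines "k0 \<equiv> mu / (2 * (2 * mu + lam))"
  defines "k1 \<equiv> - (lam / (2 * (2 * mu + lam)))"
  defines "x \<equiv> \<lambda>p::real^2. (p - c) $ 1"
  defines "y \<equiv> \<lambda>p::real^2. (p - c) $ 2"
  defines "\<theta> \<equiv> \<lambda>p. Arg (Complex (x p) (y p))"
  defines "vec2 \<equiv> \<lambda>a b :: real. (vector [complex_of_real a, complex_of_real b] :: complex^2)"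
  defines "E_half \<equiv> {\<lambda>p. vec2 1 0, \<lambda>p. vec2 0 1, \<lambda>p. vec2 (y p) (- x p)}"
  defines "E_k1 \<equiv> {\<lambda>p. vec2 (x p) (y p)}"
  defines "E_k0 \<equiv>
      {\<lambda>p. vec2 (cos (real m * \<theta> p)) (sin (real m * \<theta> p)) | m. m \<ge> 2}
    \<union> {\<lambda>p. vec2 (- sin (real m * \<theta> p)) (cos (real m * \<theta> p)) | m. m \<ge> 2}"
  defines "E_mk0 \<equiv>
      {\<lambda>p. vec2 (cos (real m * \<theta> p)) (- sin (real m * \<theta> p)) | m. m \<ge> 1}
    \<union> {\<lambda>p. vec2 (sin (real m * \<theta> p)) (cos (real m * \<theta> p)) | m. m \<ge> 1}"
  shows "op_spectrum S K = complex_of_real ` {1/2, k1, k0, - k0}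
    \<and> (\<forall>z\<in>op_spectrum S K. is_eigenvalue S K z)
    \<and> (\<forall>\<phi>\<in>E_half. is_eigenfunction S K (1/2) \<phi>)
    \<and> (\<forall>\<phi>\<in>E_k1. is_eigenfunction S K (of_real k1) \<phi>)
    \<and> (\<forall>\<phi>\<in>E_k0. is_eigenfunction S K (of_real k0) \<phi>)
    \<and> (\<forall>\<phi>\<in>E_mk0. is_eigenfunction S K (of_real (- k0)) \<phi>)
    \<and> (\<forall>z. eigenspace S K z =
           closed_span S (functional_of S `
             {\<phi>. z = 1/2 \<and> \<phi> \<in> E_half \<or> z = of_real k1 \<and> \<phi> \<in> E_k1
                \<or> z = of_real k0 \<and> \<phi> \<in> E_k0 \<or> z = of_real (- k0) \<and> \<phi> \<in> E_mk0}))"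
proof -
  interpret D: elastic_disk lam mu r c
    by unfold_locales (use assms(1-3) in linarith)+
  have K: "K = D.K" unfolding K_def S_def by (rule D.np_operator_eq)
  have kv: "D.kv (a, 0) = 1/2" "D.kv (False, 1) = k1" "D.kv (True, 1) = 1/2"
    "n \<ge> 2 \<Longrightarrow> D.kv (a, n) = k0" "n \<le> -1 \<Longrightarrow> D.kv (a, n) = - k0" for a n
    by (auto simp: D.kv_def D.k0_def k0_def k1_def)
  \<comment> \<open>Only integer multiples of the angle occur, so just
    \<open>cis (\<theta> p)\<close> matters and the branch of \<open>Arg\<close> is
    immaterial.\<close>
  have unit: "cis (\<theta> p) = unpt c r p" "x p = r * Re (unpt c r p)" "y p = r * Im (unpt c r p)"
    if p: "p \<in> sphere c r" for p
  proof -
    show xy: "x p = r * Re (unpt c r p)" "y p = r * Im (unpt c r p)"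
      using \<open>r > 0\<close> by (simp_all add: x_def y_def unpt_def)
    have C: "Complex (x p) (y p) = of_real r * unpt c r p" by (simp add: xy complex_eq_iff)
    have n: "norm (unpt c r p) = 1" using p \<open>r > 0\<close> by (simp add: norm_unpt)
    have nz: "of_real r * unpt c r p \<noteq> 0" using n \<open>r > 0\<close> by auto
    have "cis (\<theta> p) = sgn (of_real r * unpt c r p)"
      unfolding \<theta>_def C by (rule cis_Arg[OF nz])
    also have "\<dots> = unpt c r p" using n \<open>r > 0\<close> by (simp add: sgn_eq norm_mult)
    finally show "cis (\<theta> p) = unpt c r p" .
  qed
  have ef: "D.ef (False, n) p = vec2 (cos (of_int n * \<theta> p)) (sin (of_int n * \<theta> p))"
    "D.ef (True, n) p = vec2 (- sin (of_int n * \<theta> p)) (cos (of_int n * \<theta> p))" if "p \<in> sphere c r" for n p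
    using D.ef_trig[OF unit(1)[OF that]] by (simp_all only: vec2_def)
  have multiple: "functional_of S \<phi> = fscale a (D.bas i)" if "\<And>p. p \<in> sphere c r \<Longrightarrow> \<phi> p = a *s D.ef i p" for \<phi> a i
    unfolding S_def D.bas_def by (rule D.functional_of_cong[OF that])
  have smult: "complex_of_real s *s vec2 a b = vec2 (s * a) (s * b)" for s a b
    by (simp add: vec2_def vec_eq_iff forall_2)
  have xy: "x p = r * cos (\<theta> p)" "y p = r * sin (\<theta> p)" if "p \<in> sphere c r" for p
    using unit[OF that] by (simp_all flip: unit(1)[OF that])
  \<comment> \<open>On the circle (x, y) is r times (cos \<theta>, sin \<theta>) and (y, -x) is - r
    times (- sin \<theta>, cos \<theta>).\<close>
  have b00: "functional_of S (\<lambda>p. vec2 1 0) = fscale (of_real 1) (D.bas (False, 0))"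
    and b10: "functional_of S (\<lambda>p. vec2 0 1) = fscale (of_real 1) (D.bas (True, 0))"
    and b11: "functional_of S (\<lambda>p. vec2 (y p) (- x p)) = fscale (of_real (- r)) (D.bas (True, 1))"
    and b01: "functional_of S (\<lambda>p. vec2 (x p) (y p)) = fscale (of_real r) (D.bas (False, 1))"
    by (rule multiple; simp only: ef smult; simp add: xy)+
  have b0p: "functional_of S (\<lambda>p. vec2 (cos (real m * \<theta> p)) (sin (real m * \<theta> p))) = fscale (of_real 1) (D.bas (False, int m))"
    and b1p: "functional_of S (\<lambda>p. vec2 (- sin (real m * \<theta> p)) (cos (real m * \<theta> p))) = fscale (of_real 1) (D.bas (True, int m))"
    and b0m: "functional_of S (\<lambda>p. vec2 (cos (real m * \<theta> p)) (- sin (real m * \<theta> p))) = fscale (of_real 1) (D.bas (False, - int m))"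
    and b1m: "functional_of S (\<lambda>p. vec2 (sin (real m * \<theta> p)) (cos (real m * \<theta> p))) = fscale (of_real 1) (D.bas (True, - int m))"
    for m
    by (rule multiple; simp only: ef smult; simp)+
  \<comment> \<open>Listed eigenvalues may coincide: k1 = - k0 when lam = mu. The eigenspace is then
    generated by both lists, hence a union over all matching cases.\<close>
  define G where "G z = {\<phi>. z = 1/2 \<and> \<phi> \<in> E_half \<or> z = of_real k1 \<and> \<phi> \<in> E_k1
                \<or> z = of_real k0 \<and> \<phi> \<in> E_k0 \<or> z = of_real (- k0) \<and> \<phi> \<in> E_mk0}" for z :: complex
  have G_basis: "\<exists>i a. a \<noteq> 0 \<and> of_real (D.kv i) = z \<and> functional_of S \<phi> = fscale (of_real a) (D.bas i)"
    if "\<phi> \<in> G z" for \<phi> z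
  proof -
    define Q where "Q e \<longleftrightarrow> (\<exists>i a. a \<noteq> 0 \<and> D.kv i = e \<and> functional_of S \<phi> = fscale (of_real a) (D.bas i))" for e
    have QI: "Q e" if "functional_of S \<phi> = fscale (of_real a) (D.bas i)" "D.kv i = e" "a \<noteq> 0" for a i e
      unfolding Q_def using that by blast
    have half: "Q (1/2)" if E: "\<phi> \<in> E_half"
    proof -
      consider "\<phi> = (\<lambda>p. vec2 1 0)" | "\<phi> = (\<lambda>p. vec2 0 1)" | "\<phi> = (\<lambda>p. vec2 (y p) (- x p))"
        using E unfolding E_half_def by blast
      then show ?thesis
      proof cases
        case 1 show ?thesis by (rule QI[OF _ kv(1)]) (simp_all only: 1 b00, simp)
      next
        case 2 show ?thesis by (rule QI[OF _ kv(1)]) (simp_all only: 2 b10, simp)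
      next
        case 3 show ?thesis by (rule QI[OF _ kv(3)]) (use \<open>r > 0\<close> in \<open>simp_all only: 3 b11, simp\<close>)
      qed
    qed
    have k1: "Q k1" if E: "\<phi> \<in> E_k1"
    proof -
      have \<phi>: "\<phi> = (\<lambda>p. vec2 (x p) (y p))" using E unfolding E_k1_def by blast
      show ?thesis by (rule QI[OF _ kv(2)]) (use \<open>r > 0\<close> in \<open>simp_all only: \<phi> b01, simp\<close>)
    qed
    have k0: "Q k0" if E: "\<phi> \<in> E_k0"
    proof -
      obtain m :: nat where m: "m \<ge> 2" and "\<phi> = (\<lambda>p. vec2 (cos (real m * \<theta> p)) (sin (real m * \<theta> p)))
          \<or> \<phi> = (\<lambda>p. vec2 (- sin (real m * \<theta> p)) (cos (real m * \<theta> p)))"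
        using E unfolding E_k0_def by blast
      from this(2) show ?thesis
      proof
        assume \<phi>: "\<phi> = (\<lambda>p. vec2 (cos (real m * \<theta> p)) (sin (real m * \<theta> p)))"
        show ?thesis by (rule QI[OF _ kv(4)[of "int m"]]) (use m in \<open>simp_all only: \<phi> b0p, simp_all\<close>)
      next
        assume \<phi>: "\<phi> = (\<lambda>p. vec2 (- sin (real m * \<theta> p)) (cos (real m * \<theta> p)))"
        show ?thesis by (rule QI[OF _ kv(4)[of "int m"]]) (use m in \<open>simp_all only: \<phi> b1p, simp_all\<close>)
      qed
    qed
    have mk0: "Q (- k0)" if E: "\<phi> \<in> E_mk0"
    proof -
      obtain m :: nat where m: "m \<ge> 1" and "\<phi> = (\<lambda>p. vec2 (cos (real m * \<theta> p)) (- sin (real m * \<theta> p)))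
          \<or> \<phi> = (\<lambda>p. vec2 (sin (real m * \<theta> p)) (cos (real m * \<theta> p)))"
        using E unfolding E_mk0_def by blast
      from this(2) show ?thesis
      proof
        assume \<phi>: "\<phi> = (\<lambda>p. vec2 (cos (real m * \<theta> p)) (- sin (real m * \<theta> p)))"
        show ?thesis by (rule QI[OF _ kv(5)[of "- int m"]]) (use m in \<open>simp_all only: \<phi> b0m, simp_all\<close>)
      next
        assume \<phi>: "\<phi> = (\<lambda>p. vec2 (sin (real m * \<theta> p)) (cos (real m * \<theta> p)))"
        show ?thesis by (rule QI[OF _ kv(5)[of "- int m"]]) (use m in \<open>simp_all only: \<phi> b1m, simp_all\<close>)
      qed
    qed
    from that have "\<exists>e. z = of_real e \<and> Q e"
      unfolding G_def mem_Collect_eq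
    proof (elim disjE conjE)
      assume "z = 1/2" "\<phi> \<in> E_half"
      then show ?thesis using half by (intro exI[of _ "1/2"]) simp
    next
      assume "z = of_real k1" "\<phi> \<in> E_k1"
      then show ?thesis using k1 by blast
    next
      assume "z = of_real k0" "\<phi> \<in> E_k0"
      then show ?thesis using k0 by blast
    next
      assume "z = of_real (- k0)" "\<phi> \<in> E_mk0"
      then show ?thesis using mk0 by blast
    qed
    then show ?thesis unfolding Q_def by blast
  qed
  \<comment> \<open>The converse of \<open>G_basis\<close>: every index is reached by a listed
    field, so the lists generate whole eigenspaces.\<close>
  have basis_G: "\<exists>\<phi>\<in>G (of_real (D.kv i)). \<exists>a\<noteq>0. functional_of S \<phi> = fscale (of_real a) (D.bas i)" for i
  proof -
    have GI: ?thesis if "functional_of S \<phi> = fscale (of_real a) (D.bas j)" "a \<noteq> 0" "\<phi> \<in> G (of_real e)"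
      "D.kv j = e" "i = j" for \<phi> a j e
      using that by blast
    have G: "\<phi> \<in> E_half \<Longrightarrow> \<phi> \<in> G (of_real (1/2))" "\<phi> \<in> E_k1 \<Longrightarrow> \<phi> \<in> G (of_real k1)"
      "\<phi> \<in> E_k0 \<Longrightarrow> \<phi> \<in> G (of_real k0)" "\<phi> \<in> E_mk0 \<Longrightarrow> \<phi> \<in> G (of_real (- k0))" for \<phi>
      by (simp_all add: G_def)
    obtain b n where i: "i = (b, n)" by (cases i)
    have mem: "m \<ge> 2 \<Longrightarrow> (\<lambda>p. vec2 (cos (real m * \<theta> p)) (sin (real m * \<theta> p))) \<in> E_k0"
      "m \<ge> 2 \<Longrightarrow> (\<lambda>p. vec2 (- sin (real m * \<theta> p)) (cos (real m * \<theta> p))) \<in> E_k0"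
      "m \<ge> 1 \<Longrightarrow> (\<lambda>p. vec2 (cos (real m * \<theta> p)) (- sin (real m * \<theta> p))) \<in> E_mk0"
      "m \<ge> 1 \<Longrightarrow> (\<lambda>p. vec2 (sin (real m * \<theta> p)) (cos (real m * \<theta> p))) \<in> E_mk0" for m
      unfolding E_k0_def E_mk0_def by blast+
    have n: "n = 0 \<or> n = 1 \<or> n \<ge> 2 \<or> n \<le> -1" by linarith
    consider "n = 0" "b = False" | "n = 0" "b = True" | "n = 1" "b = False" | "n = 1" "b = True"
      | "n \<ge> 2" "b = False" | "n \<ge> 2" "b = True" | "n \<le> -1" "b = False" | "n \<le> -1" "b = True"
      using n by (cases b) blast+
    then show ?thesis
    proof cases
      case 1
      then show ?thesis by (intro GI[OF b00 _ G(1) kv(1)]) (simp_all add: E_half_def i)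
    next
      case 2
      then show ?thesis by (intro GI[OF b10 _ G(1) kv(1)]) (simp_all add: E_half_def i)
    next
      case 3
      then show ?thesis using \<open>r > 0\<close> by (intro GI[OF b01 _ G(2) kv(2)]) (simp_all add: E_k1_def i)
    next
      case 4
      then show ?thesis using \<open>r > 0\<close> by (intro GI[OF b11 _ G(1) kv(3)]) (simp_all add: E_half_def i)
    next
      case 5
      show ?thesis
        by (rule GI[OF b0p[of "nat n"] _ G(3)[OF mem(1)] kv(4)]) (use 5 in \<open>auto simp: i\<close>)
    next
      case 6
      show ?thesis
        by (rule GI[OF b1p[of "nat n"] _ G(3)[OF mem(2)] kv(4)]) (use 6 in \<open>auto simp: i\<close>)
    next
      case 7
      show ?thesis
        by (rule GI[OF b0m[of "nat (- n)"] _ G(4)[OF mem(3)] kv(5)]) (use 7 in \<open>auto simp: i\<close>)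
    next
      case 8
      show ?thesis
        by (rule GI[OF b1m[of "nat (- n)"] _ G(4)[OF mem(4)] kv(5)]) (use 8 in \<open>auto simp: i\<close>)
    qed
  qed
  have eig: "is_eigenfunction S K z \<phi>" if \<phi>: "\<phi> \<in> G z" for \<phi> z
  proof -
    obtain i a where ia: "a \<noteq> 0" "of_real (D.kv i) = z" "functional_of S \<phi> = fscale (of_real a) (D.bas i)"
      using G_basis[OF \<phi>] by blast
    have "D.bas i \<in> eigenspace S K z" using D.bas_eigen[of i] ia(2) by (simp add: K S_def)
    then have "functional_of S \<phi> \<in> eigenspace S K z"
      unfolding ia(3) unfolding K S_def by (rule D.eigenspace_fscale)
    moreover have "functional_of S \<phi> \<noteq> 0"
      unfolding ia(3) functional_space.scale_eq_0_iff using ia(1) D.bas_nonzero by simp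
    ultimately show ?thesis by (simp add: is_eigenfunction_def)
  qed
  have spec: "op_spectrum S K = complex_of_real ` range D.kv"
    unfolding K S_def by (rule D.spectrum_K)
  show ?thesis
  proof (intro conjI ballI allI)
    show "op_spectrum S K = complex_of_real ` {1/2, k1, k0, - k0}"
      unfolding spec D.kv_range D.k0_def k0_def k1_def ..
    show "is_eigenvalue S K z" if z: "z \<in> op_spectrum S K" for z
    proof -
      obtain i where "z = of_real (D.kv i)" using z spec by blast
      then show ?thesis
        using D.bas_eigen[of i] D.bas_nonzero[of i] unfolding is_eigenvalue_def K S_def by blast
    qed
    show "is_eigenfunction S K (1/2) \<phi>" if "\<phi> \<in> E_half" for \<phi>
      using that by (intro eig) (simp add: G_def)
    show "is_eigenfunction S K (of_real k1) \<phi>" if "\<phi> \<in> E_k1" for \<phi>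
      using that by (intro eig) (simp add: G_def)
    show "is_eigenfunction S K (of_real k0) \<phi>" if "\<phi> \<in> E_k0" for \<phi>
      using that by (intro eig) (simp add: G_def)
    show "is_eigenfunction S K (of_real (- k0)) \<phi>" if "\<phi> \<in> E_mk0" for \<phi>
      using that by (intro eig) (simp add: G_def)
    fix z
    have "eigenspace S K z = closed_span S (functional_of S ` G z)"
      unfolding K S_def
    proof (rule D.eigenspace_closed_span; unfold K[symmetric] S_def[symmetric])
      show "v \<in> eigenspace S K z" if "v \<in> functional_of S ` G z" for v
        using that eig by (auto simp: is_eigenfunction_def)
      show "D.bas i \<in> functional_space.span (functional_of S ` G z)" if z: "of_real (D.kv i) = z" for i
      proof -
        obtain \<phi> a where \<phi>: "\<phi> \<in> G z" "a \<noteq> 0" "functional_of S \<phi> = fscale (of_real a) (D.bas i)"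
          using basis_G[of i] z by blast
        have "D.bas i = fscale (of_real (1 / a)) (functional_of S \<phi>)"
          unfolding \<phi>(3) using \<phi>(2) by (simp add: fscale_def)
        then show ?thesis
          using functional_space.span_scale[OF functional_space.span_base[OF imageI[OF \<phi>(1)]]] by metis
      qed
    qed
    then show "eigenspace S K z = closed_span S (functional_of S `
             {\<phi>. z = 1/2 \<and> \<phi> \<in> E_half \<or> z = of_real k1 \<and> \<phi> \<in> E_k1
                \<or> z = of_real k0 \<and> \<phi> \<in> E_k0 \<or> z = of_real (- k0) \<and> \<phi> \<in> E_mk0})"
      by (simp only: G_def)
  qed
qed

end
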